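(* Let $G$ be a Hausdorff principal groupoid whose orbits are discrete, let $\pi:E\to G$ be a Fell line bundle, and let $A$ be a localizable completion. Then the quantic bundle $p:\operatorname{Max}A\to\Omega(G)$ is stable.
   Context: Groupoids. A groupoid $G$ is a topological groupoid with unit space $G_0\subset G$, $d(g)=g^{-1}g$, $r(g)=gg^{-1}$, $G_2=\{(g,h): d(g)=r(h)\}$. Every groupoid is assumed étale ($d$ is a local homeomorphism) with $G_0$ locally compact Hausdorff. A local bisection is an open $U\subset G$ on which $d$ and $r$ are injective; $\mathcal I(G)$ is the set of local bisections. $G$ is principal if $\{g:d(g)=r(g)=x\}=\{x\}$ for all $x\in G_0$. The orbits are the equivalence classes of the relation $\{(d(g),r(g)):g\in G\}$ on $G_0$; they are discrete if each is a discrete subspace of $G_0$. Quantales. An involutive quantale is a complete lattice with an associative product distributing over arbitrary joins on both sides and a join-preserving involution with $(ab)^*=b^*a^*$. A map $p:Q\to X$ of involutive quantales is a map $p^*:X\to Q$ preserving arbitrary joins, products and involution; $p$ is a surjection if $p^*$ is injective, and semiopen if $p^*$ has a left adjoint $p_!:Q\to X$ ($p_!(a)\le x\iff a\le p^*(x)$). $\Omega(G)$, the topology of $G$, is an involutive quantale under pointwise product and $U\mapsto U^{-1}$. $\operatorname{Max}A$ is the involutive quantale of closed linear subspaces of a C*-algebra $A$ with inclusion order, pointwise involution, and product $VW=\overline{\operatorname{span}}\{ab:a\in V,b\in W\}$. A map $p:Q\to\Omega(G)$ is a quantic bundle if it is semiopen, surjective, and $p_!(a\,p^*(U)\,b)=p_!(a)\,U\,p_!(b)$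 for all $U\in\Omega(G)$ and all $a,b\in Q$ with $p_!(a),p_!(b)\in\mathcal I(G)$; it is stable if this equation holds for all $a,b\in Q$ and all $U\in\Omega(G)$. Fell bundles. A Banach bundle over a locally Hausdorff space $X$ is a continuous open surjection $\pi:E\to X$ with complex Banach space fibres $E_x=\pi^{-1}(\{x\})$ such that: $\pi^{-1}(U)$ is Hausdorff for each Hausdorff open $U\subset X$; addition $E\times_XE\to E$ and scalar multiplication by each $\lambda\in\mathbb C$ are continuous; $e\mapsto\|e\|$ is upper semicontinuous; for each $x$ and open $V\ni 0_x$ there are $\varepsilon>0$ and an open $U\ni x$ with $\{e\in\pi^{-1}(U):\|e\|<\varepsilon\}\subset V$. A Fell bundle on $G$ is a Banach bundle $\pi:E\to G$ with a continuous associative multiplication $(e,f)\mapsto ef$ defined when $(\pi(e),\pi(f))\in G_2$ and a continuous involution $e\mapsto e^*$, such that $\pi(ef)=\pi(e)\pi(f)$, $\pi(e^* )=\pi(e)^{-1}$, multiplication is fibrewise bilinear, the involution is fibrewise conjugate-linear, $e^{**}=e$, $(ef)^*=f^*e^*$, $\|ef\|\le\|e\|\|f\|$, $\|e^*\|=\|e\|$, $\|e^*e\|=\|e\|^2$, and $e^*e\ge0$ in the C*-algebra over $d(\pi(e))$. A Fell line bundle is one all of whose fibres have complex dimension $1$ (it is automatically saturated: $E_gE_h=E_{gh}$ for $(g,h)\in G_2$). Convolution algebra. For $G$ Hausdorff, the convolution algebra $C_c(G,E)$ is the space of compactly supported continuous sections of $\pi$, a $*$-algebra with $st(g)=\sum_{g=hk}s(h)t(k)$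 and $s^*(g)=s(g^{-1})^*$; for open $U\subset G$, $C_c(U,E)\subset C_c(G,E)$ consists of the sections with compact support contained in $U$. Let $\|s\|_\infty=\sup_g\|s(g)\|$. A compatible norm is a C*-norm $\|\cdot\|$ on $C_c(G,E)$ with $\|s\|_\infty\le\|s\|$ for all $s$ and $\|s\|_\infty=\|s\|$ if $s\in C_c(U,E)$ for some $U\in\mathcal I(G)$; the C*-completion $A$ in it is a compatible completion. For $g\in G$, $s\mapsto s(g)$ extends to a continuous linear map $\operatorname{eval}_g:A\to E_g$. The associated map $p:\operatorname{Max}A\to\Omega(G)$ is given by $p^*(V)=\overline{\operatorname{span}}\bigcup\{C_c(U,E):U\in\mathcal I(G),\ U\subset V\}$. Localizability. For $a\in A$ let $\sigma(\langle a\rangle)=\operatorname{int}\{g\in G:\operatorname{eval}_g(a)\ne0\}$, and for $V\in\Omega(G)$ let $\gamma(V)=\overline{\operatorname{span}}\{a\in A:\sigma(\langle a\rangle)\subset V\}$. A localizable completion is a compatible completion $A$ with $p^*=\gamma$; then $p$ is semiopen with $p_!(V)=\bigcup_{a\in V}\operatorname{int}\{g:\operatorname{eval}_g(a)\neq0\}$, and for a Fell line bundle $p$ is a quantic bundle. *)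

theory Defs
  imports "HOL-Analysis.Analysis" "HOL-Algebra.Module" "HOL-Algebra.Galois_Connection"
begin

section \<open>Groupoids\<close>

text \<open>
  The arrows of a groupoid are the elements of a type. The product is a total function whose
  values matter only on composable pairs.
\<close>

record 'g groupoid =
  gmul :: "'g \<Rightarrow> 'g \<Rightarrow> 'g"
  ginv :: "'g \<Rightarrow> 'g"

definition gdom :: "'g groupoid \<Rightarrow> 'g \<Rightarrow> 'g" where
  "gdom G g = gmul G (ginv G g) g"

definition gran :: "'g groupoid \<Rightarrow> 'g \<Rightarrow> 'g" where
  "gran G g = gmul G g (ginv G g)"

definition gunits :: "'g groupoid \<Rightarrow> 'g set" where
  "gunits G = range (gdom G)"

definition gcomposable :: "'g groupoid \<Rightarrow> ('g \<times> 'g) set" where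
  "gcomposable G = {(g, h). gdom G g = gran G h}"

text \<open>
  The algebraic axioms are the usual ones for a small category in which every arrow is invertible,
  with the source and range of \<open>g\<close> represented by the units \<open>g\<^sup>-\<^sup>1 g\<close> and \<open>g g\<^sup>-\<^sup>1\<close>.
\<close>

locale etale_groupoid =
  fixes G :: "('g::topological_space) groupoid"
  assumes inv_inv: "ginv G (ginv G g) = g"
    and dom_mul: "(g, h) \<in> gcomposable G \<Longrightarrow> gdom G (gmul G g h) = gdom G h"
    and ran_mul: "(g, h) \<in> gcomposable G \<Longrightarrow> gran G (gmul G g h) = gran G g"
    and mul_assoc: "(g, h) \<in> gcomposable G \<Longrightarrow> (h, k) \<in> gcomposable G \<Longrightarrow>
          gmul G (gmul G g h) k = gmul G g (gmul G h k)"
    and inv_mul_cancel: "(g, h) \<in> gcomposable G \<Longrightarrow> gmul G (ginv G g) (gmul G g h) = h"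
    and mul_inv_cancel: "(g, h) \<in> gcomposable G \<Longrightarrow> gmul G (gmul G g h) (ginv G h) = g"
    and continuous_mul: "continuous_on (gcomposable G) (\<lambda>(g, h). gmul G g h)"
    and continuous_inv: "continuous_on UNIV (ginv G)"
    and dom_local_homeomorphism:
      "\<exists>U. open U \<and> g \<in> U \<and> openin (top_of_set (gunits G)) (gdom G ` U) \<and>
           (\<exists>i. homeomorphism U (gdom G ` U) (gdom G) i)"
    and Hausdorff_units: "Hausdorff_space (top_of_set (gunits G))"
    and locally_compact_units: "locally_compact_space (top_of_set (gunits G))"

definition local_bisections :: "('g::topological_space) groupoid \<Rightarrow> 'g set set" where
  "local_bisections G = {U. open U \<and> inj_on (gdom G) U \<and> inj_on (gran G) U}"

definition principal_groupoid :: "'g groupoid \<Rightarrow> bool" where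
  "principal_groupoid G \<longleftrightarrow> (\<forall>x\<in>gunits G. {g. gdom G g = x \<and> gran G g = x} = {x})"

definition orbit_rel :: "'g groupoid \<Rightarrow> ('g \<times> 'g) set" where
  "orbit_rel G = {(gdom G g, gran G g) |g. True}"

definition discrete_orbits :: "('g::topological_space) groupoid \<Rightarrow> bool" where
  "discrete_orbits G \<longleftrightarrow> (\<forall>S \<in> gunits G // orbit_rel G. discrete S)"


section \<open>Involutive quantales\<close>

record 'q quantale = "'q gorder" +
  qmul :: "'q \<Rightarrow> 'q \<Rightarrow> 'q"
  qinv :: "'q \<Rightarrow> 'q"

definition qsup :: "'q quantale \<Rightarrow> 'q set \<Rightarrow> 'q" where
  "qsup Q S = Lattice.sup Q S"

locale involutive_quantale =
  fixes Q :: "'q quantale"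
  assumes complete: "Complete_Lattice.complete_lattice Q"
    and mul_closed: "a \<in> carrier Q \<Longrightarrow> b \<in> carrier Q \<Longrightarrow> qmul Q a b \<in> carrier Q"
    and inv_closed: "a \<in> carrier Q \<Longrightarrow> qinv Q a \<in> carrier Q"
    and assoc: "a \<in> carrier Q \<Longrightarrow> b \<in> carrier Q \<Longrightarrow> c \<in> carrier Q \<Longrightarrow>
          qmul Q (qmul Q a b) c = qmul Q a (qmul Q b c)"
    and mul_sup: "a \<in> carrier Q \<Longrightarrow> S \<subseteq> carrier Q \<Longrightarrow>
          qmul Q a (qsup Q S) = qsup Q (qmul Q a ` S)"
    and sup_mul: "a \<in> carrier Q \<Longrightarrow> S \<subseteq> carrier Q \<Longrightarrow>
          qmul Q (qsup Q S) a = qsup Q ((\<lambda>b. qmul Q b a) ` S)"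
    and inv_inv: "a \<in> carrier Q \<Longrightarrow> qinv Q (qinv Q a) = a"
    and inv_mul: "a \<in> carrier Q \<Longrightarrow> b \<in> carrier Q \<Longrightarrow>
          qinv Q (qmul Q a b) = qmul Q (qinv Q b) (qinv Q a)"
    and inv_sup: "S \<subseteq> carrier Q \<Longrightarrow> qinv Q (qsup Q S) = qsup Q (qinv Q ` S)"

text \<open>
  A map \<open>p : Q \<rightarrow> X\<close> is given by its inverse image \<open>ps\<close>, a function from \<open>X\<close> to \<open>Q\<close>.
\<close>

locale quantale_map = Q: involutive_quantale Q + X: involutive_quantale X
  for Q :: "'q quantale" and X :: "'x quantale" +
  fixes ps :: "'x \<Rightarrow> 'q"
  assumes ps_closed: "x \<in> carrier X \<Longrightarrow> ps x \<in> carrier Q"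
    and ps_sup: "S \<subseteq> carrier X \<Longrightarrow> ps (qsup X S) = qsup Q (ps ` S)"
    and ps_mul: "x \<in> carrier X \<Longrightarrow> y \<in> carrier X \<Longrightarrow> ps (qmul X x y) = qmul Q (ps x) (ps y)"
    and ps_inv: "x \<in> carrier X \<Longrightarrow> ps (qinv X x) = qinv Q (ps x)"

text \<open>\<open>pl\<close> is the direct image \<open>p\<^sub>!\<close>, left adjoint to \<open>ps\<close>; it is unique on \<open>carrier Q\<close>.\<close>

definition direct_image :: "'q quantale \<Rightarrow> 'x quantale \<Rightarrow> ('x \<Rightarrow> 'q) \<Rightarrow> ('q \<Rightarrow> 'x) \<Rightarrow> bool" where
  "direct_image Q X ps pl \<longleftrightarrow>
     galois_connection \<lparr>orderA = Q, orderB = X, lower = pl, upper = ps\<rparr>"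

definition open_quantale :: "('g::topological_space) groupoid \<Rightarrow> 'g set quantale" where
  "open_quantale G =
     \<lparr>carrier = {U. open U}, eq = (=), le = (\<subseteq>),
      qmul = (\<lambda>U V. {gmul G g h |g h. g \<in> U \<and> h \<in> V \<and> (g, h) \<in> gcomposable G}),
      qinv = (\<lambda>U. ginv G ` U)\<rparr>"

definition quantic_bundle ::
  "('g::topological_space) groupoid \<Rightarrow> 'q quantale \<Rightarrow> ('g set \<Rightarrow> 'q) \<Rightarrow> bool" where
  "quantic_bundle G Q ps \<longleftrightarrow>
     quantale_map Q (open_quantale G) ps \<and>
     inj_on ps (carrier (open_quantale G)) \<and>
     (\<exists>pl. direct_image Q (open_quantale G) ps pl \<and>
       (\<forall>U \<in> carrier (open_quantale G). \<forall>a \<in> carrier Q. \<forall>b \<in> carrier Q.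
          pl a \<in> local_bisections G \<longrightarrow> pl b \<in> local_bisections G \<longrightarrow>
          pl (qmul Q (qmul Q a (ps U)) b) =
          qmul (open_quantale G) (qmul (open_quantale G) (pl a) U) (pl b)))"

definition stable_quantic_bundle ::
  "('g::topological_space) groupoid \<Rightarrow> 'q quantale \<Rightarrow> ('g set \<Rightarrow> 'q) \<Rightarrow> bool" where
  "stable_quantic_bundle G Q ps \<longleftrightarrow>
     quantic_bundle G Q ps \<and>
     (\<exists>pl. direct_image Q (open_quantale G) ps pl \<and>
       (\<forall>U \<in> carrier (open_quantale G). \<forall>a \<in> carrier Q. \<forall>b \<in> carrier Q.
          pl (qmul Q (qmul Q a (ps U)) b) =
          qmul (open_quantale G) (qmul (open_quantale G) (pl a) U) (pl b)))"


section \<open>Banach bundles and Fell bundles\<close>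

text \<open>
  The fibrewise operations are total functions on the total space \<open>'e\<close>; the values of
  \<open>fadd\<close> matter only on pairs in a common fibre and those of \<open>fmul\<close> only over composable pairs.
\<close>

record ('g, 'e) banach_bundle =
  proj :: "'e \<Rightarrow> 'g"
  fzero :: "'g \<Rightarrow> 'e"
  fadd :: "'e \<Rightarrow> 'e \<Rightarrow> 'e"
  fscale :: "complex \<Rightarrow> 'e \<Rightarrow> 'e"
  fnorm :: "'e \<Rightarrow> real"

record ('g, 'e) fell_bundle = "('g, 'e) banach_bundle" +
  fmul :: "'e \<Rightarrow> 'e \<Rightarrow> 'e"
  fstar :: "'e \<Rightarrow> 'e"

definition complex_ring :: "complex ring" where
  "complex_ring = \<lparr>carrier = UNIV, monoid.mult = (*), one = 1, ring.zero = 0, add = (+)\<rparr>"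

text \<open>
  The fibre over \<open>x\<close> as a module in the sense of \<open>HOL-Algebra\<close>. The record type has multiplicative
  fields, which modules do not use.
\<close>

definition fibre :: "('g, 'e, 'z) banach_bundle_scheme \<Rightarrow> 'g \<Rightarrow> (complex, 'e) module" where
  "fibre E x = \<lparr>carrier = proj E -` {x}, monoid.mult = undefined, one = undefined,
     ring.zero = fzero E x, add = fadd E, smult = fscale E\<rparr>"

locale banach_bundle =
  fixes E :: "('g::topological_space, 'e::topological_space, 'z) banach_bundle_scheme"
  assumes base_locally_Hausdorff:
      "\<exists>U. open U \<and> (x::'g) \<in> U \<and> Hausdorff_space (top_of_set U)"
    and proj_continuous: "continuous_on UNIV (proj E)"
    and proj_open: "open V \<Longrightarrow> open (proj E ` V)"
    and proj_surj: "surj (proj E)"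
    and fibre_module: "Module.module complex_ring (fibre E x)"
    and norm_nonneg: "0 \<le> fnorm E e"
    and norm_eq_0_iff: "fnorm E e = 0 \<longleftrightarrow> e = fzero E (proj E e)"
    and norm_triangle: "proj E e = proj E f \<Longrightarrow> fnorm E (fadd E e f) \<le> fnorm E e + fnorm E f"
    and norm_scale: "fnorm E (fscale E c e) = cmod c * fnorm E e"
    and fibre_complete:
      "\<lbrakk>\<And>n. u n \<in> carrier (fibre E x);
        \<And>\<epsilon>. \<epsilon> > 0 \<Longrightarrow>
           \<exists>N. \<forall>m\<ge>N. \<forall>n\<ge>N. fnorm E (u m \<ominus>\<^bsub>fibre E x\<^esub> u n) < \<epsilon>\<rbrakk>
       \<Longrightarrow> \<exists>l \<in> carrier (fibre E x). (\<lambda>n::nat. fnorm E (u n \<ominus>\<^bsub>fibre E x\<^esub> l)) \<longlonglongrightarrow> 0"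
    and restriction_Hausdorff:
      "open U \<Longrightarrow> Hausdorff_space (top_of_set U) \<Longrightarrow> Hausdorff_space (top_of_set (proj E -` U))"
    and add_continuous:
      "continuous_on {(e, f). proj E e = proj E f} (\<lambda>(e, f). fadd E e f)"
    and scale_continuous: "continuous_on UNIV (fscale E c)"
    and norm_upper_semicontinuous: "open {e. fnorm E e < t}"
    and zero_neighbourhoods:
      "open V \<Longrightarrow> fzero E x \<in> V \<Longrightarrow>
       \<exists>\<epsilon>>0. \<exists>U. open U \<and> x \<in> U \<and> {e \<in> proj E -` U. fnorm E e < \<epsilon>} \<subseteq> V"

text \<open>
  Positivity of \<open>e\<^sup>* e\<close> is taken in the C*-algebra \<open>E\<^sub>x\<close>, whose positive elements are those of the
  form \<open>f\<^sup>* f\<close> with \<open>f\<close> in \<open>E\<^sub>x\<close> itself.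
\<close>

definition fibre_positive ::
  "('g, 'e) fell_bundle \<Rightarrow> 'g \<Rightarrow> 'e \<Rightarrow> bool" where
  "fibre_positive E x e \<longleftrightarrow> (\<exists>f \<in> carrier (fibre E x). e = fmul E (fstar E f) f)"

locale fell_bundle = etale_groupoid G + banach_bundle E
  for G :: "('g::topological_space) groupoid"
    and E :: "('g, 'e::topological_space) fell_bundle" +
  assumes mul_continuous:
      "continuous_on {(e, f). (proj E e, proj E f) \<in> gcomposable G} (\<lambda>(e, f). fmul E e f)"
    and star_continuous: "continuous_on UNIV (fstar E)"
    and proj_mul: "(proj E e, proj E f) \<in> gcomposable G \<Longrightarrow>
          proj E (fmul E e f) = gmul G (proj E e) (proj E f)"
    and proj_star: "proj E (fstar E e) = ginv G (proj E e)"
    and fmul_assoc: "(proj E e, proj E f) \<in> gcomposable G \<Longrightarrow>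
          (proj E f, proj E k) \<in> gcomposable G \<Longrightarrow>
          fmul E (fmul E e f) k = fmul E e (fmul E f k)"
    and fmul_add_left: "proj E e = proj E e' \<Longrightarrow> (proj E e, proj E f) \<in> gcomposable G \<Longrightarrow>
          fmul E (fadd E e e') f = fadd E (fmul E e f) (fmul E e' f)"
    and fmul_add_right: "proj E f = proj E f' \<Longrightarrow> (proj E e, proj E f) \<in> gcomposable G \<Longrightarrow>
          fmul E e (fadd E f f') = fadd E (fmul E e f) (fmul E e f')"
    and fmul_scale_left: "(proj E e, proj E f) \<in> gcomposable G \<Longrightarrow>
          fmul E (fscale E c e) f = fscale E c (fmul E e f)"
    and fmul_scale_right: "(proj E e, proj E f) \<in> gcomposable G \<Longrightarrow>
          fmul E e (fscale E c f) = fscale E c (fmul E e f)"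
    and star_add: "proj E e = proj E f \<Longrightarrow>
          fstar E (fadd E e f) = fadd E (fstar E e) (fstar E f)"
    and star_scale: "fstar E (fscale E c e) = fscale E (cnj c) (fstar E e)"
    and star_star: "fstar E (fstar E e) = e"
    and star_mul: "(proj E e, proj E f) \<in> gcomposable G \<Longrightarrow>
          fstar E (fmul E e f) = fmul E (fstar E f) (fstar E e)"
    and norm_mul: "(proj E e, proj E f) \<in> gcomposable G \<Longrightarrow>
          fnorm E (fmul E e f) \<le> fnorm E e * fnorm E f"
    and norm_star: "fnorm E (fstar E e) = fnorm E e"
    and norm_star_mul: "fnorm E (fmul E (fstar E e) e) = (fnorm E e)\<^sup>2"
    and star_mul_positive:
      "fibre_positive E (gdom G (proj E e)) (fmul E (fstar E e) e)"

locale fell_line_bundle = fell_bundle G E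
  for G :: "('g::topological_space) groupoid"
    and E :: "('g, 'e::topological_space) fell_bundle" +
  assumes fibre_one_dimensional:
    "\<exists>e \<in> carrier (fibre E g). e \<noteq> fzero E g \<and>
       (\<forall>f \<in> carrier (fibre E g). \<exists>c. f = fscale E c e)"


section \<open>Convolution algebra\<close>

text \<open>
  Supports are closures of non-vanishing sets, so these definitions are meant for Hausdorff
  groupoids only.
\<close>

definition section_support ::
  "('g::topological_space, 'e) fell_bundle \<Rightarrow> ('g \<Rightarrow> 'e) \<Rightarrow> 'g set" where
  "section_support E s = closure {g. s g \<noteq> fzero E g}"

definition Cc_on ::
  "('g::topological_space, 'e::topological_space) fell_bundle \<Rightarrow> 'g set \<Rightarrow> ('g \<Rightarrow> 'e) set" where
  "Cc_on E U = {s. (\<forall>g. proj E (s g) = g) \<and> continuous_on UNIV s \<and>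
     compact (section_support E s) \<and> section_support E s \<subseteq> U}"

abbreviation Cc ::
  "('g::topological_space, 'e::topological_space) fell_bundle \<Rightarrow> ('g \<Rightarrow> 'e) set" where
  "Cc E \<equiv> Cc_on E UNIV"

definition szero :: "('g, 'e) fell_bundle \<Rightarrow> 'g \<Rightarrow> 'e" where
  "szero E = fzero E"

definition sadd :: "('g, 'e) fell_bundle \<Rightarrow> ('g \<Rightarrow> 'e) \<Rightarrow> ('g \<Rightarrow> 'e) \<Rightarrow> 'g \<Rightarrow> 'e" where
  "sadd E s t = (\<lambda>g. fadd E (s g) (t g))"

definition sscale :: "('g, 'e) fell_bundle \<Rightarrow> complex \<Rightarrow> ('g \<Rightarrow> 'e) \<Rightarrow> 'g \<Rightarrow> 'e" where
  "sscale E c s = (\<lambda>g. fscale E c (s g))"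

text \<open>
  The sum runs over the non-zero terms only: the set of all factorizations of \<open>g\<close> may be infinite,
  and \<open>finsum\<close> over an infinite set is zero by convention.
\<close>

definition sconv ::
  "'g groupoid \<Rightarrow> ('g, 'e) fell_bundle \<Rightarrow> ('g \<Rightarrow> 'e) \<Rightarrow> ('g \<Rightarrow> 'e) \<Rightarrow> 'g \<Rightarrow> 'e" where
  "sconv G E s t = (\<lambda>g. finsum (fibre E g) (\<lambda>(h, k). fmul E (s h) (t k))
     {(h, k). (h, k) \<in> gcomposable G \<and> gmul G h k = g \<and> fmul E (s h) (t k) \<noteq> fzero E g})"

definition sstar ::
  "'g groupoid \<Rightarrow> ('g, 'e) fell_bundle \<Rightarrow> ('g \<Rightarrow> 'e) \<Rightarrow> 'g \<Rightarrow> 'e" where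
  "sstar G E s = (\<lambda>g. fstar E (s (ginv G g)))"

definition sup_norm :: "('g, 'e) fell_bundle \<Rightarrow> ('g \<Rightarrow> 'e) \<Rightarrow> real" where
  "sup_norm E s = (SUP g. fnorm E (s g))"

locale compatible_norm =
  fixes G :: "('g::topological_space) groupoid"
    and E :: "('g, 'e::topological_space) fell_bundle"
    and N :: "('g \<Rightarrow> 'e) \<Rightarrow> real"
  assumes N_nonneg: "s \<in> Cc E \<Longrightarrow> 0 \<le> N s"
    and N_eq_0_iff: "s \<in> Cc E \<Longrightarrow> N s = 0 \<longleftrightarrow> s = szero E"
    and N_triangle: "s \<in> Cc E \<Longrightarrow> t \<in> Cc E \<Longrightarrow> N (sadd E s t) \<le> N s + N t"
    and N_scale: "s \<in> Cc E \<Longrightarrow> N (sscale E c s) = cmod c * N s"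
    and N_conv: "s \<in> Cc E \<Longrightarrow> t \<in> Cc E \<Longrightarrow> N (sconv G E s t) \<le> N s * N t"
    and N_star_conv: "s \<in> Cc E \<Longrightarrow> N (sconv G E (sstar G E s) s) = (N s)\<^sup>2"
    and sup_norm_le: "s \<in> Cc E \<Longrightarrow> sup_norm E s \<le> N s"
    and sup_norm_eq: "U \<in> local_bisections G \<Longrightarrow> s \<in> Cc_on E U \<Longrightarrow> sup_norm E s = N s"


section \<open>C*-algebras and completions\<close>

text \<open>
  The type classes provide a real Banach algebra, not necessarily unital; the record adds the
  complex scalar multiplication and the involution.
\<close>

record 'a cstar_algebra =
  cscale :: "complex \<Rightarrow> 'a \<Rightarrow> 'a"
  cstar :: "'a \<Rightarrow> 'a"

locale cstar_algebra =
  fixes A :: "('a::{real_normed_algebra, banach}) cstar_algebra"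
  assumes cscale_vector_space: "vector_space (cscale A)"
    and cscale_of_real: "cscale A (complex_of_real r) a = r *\<^sub>R a"
    and norm_cscale: "norm (cscale A c a) = cmod c * norm a"
    and cscale_mult_left: "cscale A c a * b = cscale A c (a * b)"
    and cscale_mult_right: "a * cscale A c b = cscale A c (a * b)"
    and cstar_add: "cstar A (a + b) = cstar A a + cstar A b"
    and cstar_cscale: "cstar A (cscale A c a) = cscale A (cnj c) (cstar A a)"
    and cstar_mult: "cstar A (a * b) = cstar A b * cstar A a"
    and cstar_cstar: "cstar A (cstar A a) = a"
    and norm_cstar_mult: "norm (cstar A a * a) = (norm a)\<^sup>2"

abbreviation complex_span ::
  "('a::{real_normed_algebra, banach}) cstar_algebra \<Rightarrow> 'a set \<Rightarrow> 'a set" where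
  "complex_span A \<equiv> Modules.module.span (cscale A)"

definition max_quantale ::
  "('a::{real_normed_algebra, banach}) cstar_algebra \<Rightarrow> 'a set quantale" where
  "max_quantale A =
     \<lparr>carrier = {V. closed V \<and> Modules.module.subspace (cscale A) V}, eq = (=), le = (\<subseteq>),
      qmul = (\<lambda>V W. closure (complex_span A {a * b |a b. a \<in> V \<and> b \<in> W})),
      qinv = (\<lambda>V. cstar A ` V)\<rparr>"

text \<open>
  A compatible completion: the completion \<open>A\<close> of the convolution algebra in the compatible norm
  \<open>N\<close>, together with the canonical embedding \<open>\<iota>\<close> of the convolution algebra.
\<close>

locale compatible_completion =
  compatible_norm G E N + cstar_algebra A
  for G :: "('g::topological_space) groupoid"
    and E :: "('g, 'e::topological_space) fell_bundle"
    and N :: "('g \<Rightarrow> 'e) \<Rightarrow> real"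
    and A :: "('a::{real_normed_algebra, banach}) cstar_algebra" +
  fixes \<iota> :: "('g \<Rightarrow> 'e) \<Rightarrow> 'a"
  assumes embed_add: "s \<in> Cc E \<Longrightarrow> t \<in> Cc E \<Longrightarrow> \<iota> (sadd E s t) = \<iota> s + \<iota> t"
    and embed_scale: "s \<in> Cc E \<Longrightarrow> \<iota> (sscale E c s) = cscale A c (\<iota> s)"
    and embed_conv: "s \<in> Cc E \<Longrightarrow> t \<in> Cc E \<Longrightarrow> \<iota> (sconv G E s t) = \<iota> s * \<iota> t"
    and embed_star: "s \<in> Cc E \<Longrightarrow> \<iota> (sstar G E s) = cstar A (\<iota> s)"
    and embed_norm: "s \<in> Cc E \<Longrightarrow> norm (\<iota> s) = N s"
    and embed_dense: "closure (\<iota> ` Cc E) = UNIV"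

text \<open>
  \<open>eval_at E A \<iota> g\<close> is the continuous linear map from \<open>A\<close> to the fibre over \<open>g\<close> extending
  evaluation of sections at \<open>g\<close>. Continuity is expressed by boundedness, for the norm of the fibre.
\<close>

definition eval_at ::
  "('g::topological_space, 'e::topological_space) fell_bundle \<Rightarrow>
   ('a::{real_normed_algebra, banach}) cstar_algebra \<Rightarrow> (('g \<Rightarrow> 'e) \<Rightarrow> 'a) \<Rightarrow> 'g \<Rightarrow> 'a \<Rightarrow> 'e" where
  "eval_at E A \<iota> g = (THE f.
     (\<forall>a. proj E (f a) = g) \<and>
     (\<forall>a b. f (a + b) = fadd E (f a) (f b)) \<and>
     (\<forall>c a. f (cscale A c a) = fscale E c (f a)) \<and>
     (\<exists>K. \<forall>a. fnorm E (f a) \<le> K * norm a) \<and>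
     (\<forall>s \<in> Cc E. f (\<iota> s) = s g))"

definition open_support ::
  "('g::topological_space, 'e::topological_space) fell_bundle \<Rightarrow>
   ('a::{real_normed_algebra, banach}) cstar_algebra \<Rightarrow> (('g \<Rightarrow> 'e) \<Rightarrow> 'a) \<Rightarrow> 'a \<Rightarrow> 'g set" where
  "open_support E A \<iota> a = interior {g. eval_at E A \<iota> g a \<noteq> fzero E g}"

definition gamma ::
  "('g::topological_space, 'e::topological_space) fell_bundle \<Rightarrow>
   ('a::{real_normed_algebra, banach}) cstar_algebra \<Rightarrow> (('g \<Rightarrow> 'e) \<Rightarrow> 'a) \<Rightarrow> 'g set \<Rightarrow> 'a set" where
  "gamma E A \<iota> V = closure (complex_span A {a. open_support E A \<iota> a \<subseteq> V})"

text \<open>\<open>assoc_map\<close> is the inverse image \<open>p\<^sup>*\<close> of the map from \<open>max_quantale A\<close> to \<open>open_quantale G\<close>.\<close>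

definition assoc_map ::
  "('g::topological_space) groupoid \<Rightarrow> ('g, 'e::topological_space) fell_bundle \<Rightarrow>
   ('a::{real_normed_algebra, banach}) cstar_algebra \<Rightarrow> (('g \<Rightarrow> 'e) \<Rightarrow> 'a) \<Rightarrow> 'g set \<Rightarrow> 'a set" where
  "assoc_map G E A \<iota> V =
     closure (complex_span A (\<Union>U \<in> {U \<in> local_bisections G. U \<subseteq> V}. \<iota> ` Cc_on E U))"

locale localizable_completion = compatible_completion G E N A \<iota>
  for G :: "('g::topological_space) groupoid"
    and E :: "('g, 'e::topological_space) fell_bundle"
    and N :: "('g \<Rightarrow> 'e) \<Rightarrow> real"
    and A :: "('a::{real_normed_algebra, banach}) cstar_algebra"
    and \<iota> :: "('g \<Rightarrow> 'e) \<Rightarrow> 'a" +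
  assumes localizable: "open V \<Longrightarrow> assoc_map G E A \<iota> V = gamma E A \<iota> V"

end

theory Submission
  imports Defs
begin

text \<open>
  Write \<open>ps\<close> for the inverse image map of the bundle and \<open>pl V\<close> for the union of the open supports of
  the elements of \<open>V\<close>. Localizability makes \<open>pl\<close> left adjoint to \<open>ps\<close> (\<open>pl_subset_iff\<close>). Since \<open>ps\<close>
  preserves products (\<open>ps_set_mul\<close>), the inclusion of \<open>pl (V \<cdot> ps U \<cdot> W)\<close> in \<open>pl V \<cdot> U \<cdot> pl W\<close> is formal
  (\<open>pl_product_subset\<close>), and the content of stability is the converse.

  Let \<open>a \<in> V\<close> be non-zero at \<open>h\<close>, let \<open>u \<in> U\<close>, and let \<open>b \<in> W\<close> be non-zero at \<open>k\<close>, where the product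
  \<open>h u k\<close> is defined. For a section \<open>s\<close> supported in \<open>U\<close>, the value of \<open>a s b\<close> at \<open>h u k\<close> is a sum over
  all factorizations \<open>h' u' k'\<close> of this arrow, and its terms might cancel. All sources of the possible
  middle factors \<open>u'\<close> lie in one orbit. As the orbit is discrete, a local bisection \<open>B\<close> around \<open>u\<close> can be
  chosen such that \<open>src u\<close> is the only point of the orbit in \<open>src ` B\<close>. If \<open>s\<close> is supported in \<open>B\<close>, this
  leaves \<open>u' = u\<close> alone, and then \<open>h' = h\<close> and \<open>k' = k\<close> because the groupoid is principal
  (\<open>unique_factorization_bisection\<close>). So the sum is the single product \<open>a(h) s(u) b(k)\<close>. For elements
  \<open>a\<close> and \<open>b\<close> of the completion this formula follows from the case of sections on local bisections,
  both sides being bilinear and continuous (\<open>ev_sandwich\<close>). In a Fell line bundle a product of non-zero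
  elements is non-zero (\<open>coord_fmul_nonzero\<close>), so \<open>h u k\<close> lies in the open support of \<open>a s b\<close>.

  All of this, and already the injectivity of \<open>ps\<close>, depends on a supply of continuous sections, which
  is not part of the definition of a Banach bundle. For a Fell line bundle sections are constructed in
  \<open>local_section\<close>. The units of the fibres over the unit space form a continuous section, which
  makes the norm continuous through \<open>\<parallel>e\<parallel>\<^sup>2 = \<parallel>e\<^sup>* e\<parallel>\<close>; the elements of norm one then form a bundle of
  circles that is compact over compact sets, and averaging a bump function over the circle action
  produces a section. Ratios of sections are continuous functions (\<open>continuous_on_coord_quotient\<close>), so
  sections supported where a given section does not vanish are multiples of it.
\<close>

section \<open>Quantales of sets ordered by inclusion\<close>

lemma inclusion_order:
  fixes Q :: "'b set quantale"
  assumes "eq Q = (=)" "le Q = (\<subseteq>)"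
  shows "Order.partial_order Q"
  by unfold_locales (use assms in \<open>auto simp: fun_eq_iff\<close>)

lemma inclusion_complete_lattice:
  fixes Q :: "'b set quantale"
  assumes eq: "eq Q = (=)" and le: "le Q = (\<subseteq>)"
    and lub: "\<And>S. S \<subseteq> carrier Q \<Longrightarrow> L S \<in> carrier Q \<and> (\<forall>B\<in>S. B \<subseteq> L S) \<and>
                 (\<forall>C\<in>carrier Q. (\<forall>B\<in>S. B \<subseteq> C) \<longrightarrow> L S \<subseteq> C)"
    and glb: "\<And>S. S \<subseteq> carrier Q \<Longrightarrow> J S \<in> carrier Q \<and> (\<forall>B\<in>S. J S \<subseteq> B) \<and>
                 (\<forall>C\<in>carrier Q. (\<forall>B\<in>S. C \<subseteq> B) \<longrightarrow> C \<subseteq> J S)"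
  shows "Complete_Lattice.complete_lattice Q"
    and "S \<subseteq> carrier Q \<Longrightarrow> qsup Q S = L S"
proof -
  interpret Q: Order.partial_order Q by (rule inclusion_order [OF eq le])
  have least: "least Q (L S) (Upper Q S)" if "S \<subseteq> carrier Q" for S
    unfolding least_def
  proof (intro conjI ballI)
    fix C assume C: "C \<in> Upper Q S"
    then have "C \<in> carrier Q" "\<forall>B\<in>S. B \<subseteq> C"
      using that unfolding Upper_def le by blast+
    then show "le Q (L S) C" using lub[OF that] by (simp add: le)
  qed (use lub[OF that] in \<open>simp_all add: Upper_def le\<close>)
  have greatest: "greatest Q (J S) (Lower Q S)" if "S \<subseteq> carrier Q" for S
    unfolding greatest_def
  proof (intro conjI ballI)
    fix C assume C: "C \<in> Lower Q S"
    then have "C \<in> carrier Q" "\<forall>B\<in>S. C \<subseteq> B"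
      using that unfolding Lower_def le by blast+
    then show "le Q C (J S)" using glb[OF that] by (simp add: le)
  qed (use glb[OF that] in \<open>simp_all add: Lower_def le\<close>)
  show "Complete_Lattice.complete_lattice Q"
    by unfold_locales (use least greatest in blast)+
  show "qsup Q S = L S" if "S \<subseteq> carrier Q"
    unfolding qsup_def Lattice.sup_def
    by (rule some_equality) (use least[OF that] Q.least_unique in blast)+
qed


section \<open>Closed subspaces of a C*-algebra\<close>

context cstar_algebra
begin

interpretation VS: vector_space "cscale A"
  by (rule cscale_vector_space)

definition closed_span :: "'a set \<Rightarrow> 'a set" where
  "closed_span S = closure (complex_span A S)"

definition closed_subspaces :: "'a set set" where
  "closed_subspaces = {V. closed V \<and> Modules.module.subspace (cscale A) V}"

lemma closed_subspacesD:
  assumes "V \<in> closed_subspaces"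
  shows "closed V" "0 \<in> V" "x \<in> V \<Longrightarrow> y \<in> V \<Longrightarrow> x + y \<in> V" "x \<in> V \<Longrightarrow> cscale A c x \<in> V"
  using assms unfolding closed_subspaces_def
  by (auto intro: VS.subspace_0 VS.subspace_add VS.subspace_scale)

lemma closed_subspacesI:
  assumes "closed V" "0 \<in> V" "\<And>x y. x \<in> V \<Longrightarrow> y \<in> V \<Longrightarrow> x + y \<in> V"
    and "\<And>c x. x \<in> V \<Longrightarrow> cscale A c x \<in> V"
  shows "V \<in> closed_subspaces"
  using assms unfolding closed_subspaces_def VS.subspace_def by auto

lemma continuous_cscale: "continuous_on UNIV (cscale A c)"
proof -
  have "bounded_linear (cscale A c)"
  proof (rule bounded_linear_intro[where K = "cmod c"])
    fix x y :: 'a and r :: real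
    show "cscale A c (x + y) = cscale A c x + cscale A c y"
      by (rule VS.scale_right_distrib)
    show "cscale A c (r *\<^sub>R x) = r *\<^sub>R cscale A c x"
      unfolding cscale_of_real[symmetric] by (rule VS.scale_left_commute)
    show "norm (cscale A c x) \<le> norm x * cmod c"
      by (simp add: norm_cscale mult.commute)
  qed
  then show ?thesis by (rule linear_continuous_on)
qed

lemma closed_span_least:
  assumes "M \<in> closed_subspaces" "S \<subseteq> M"
  shows "closed_span S \<subseteq> M"
  using assms unfolding closed_span_def closed_subspaces_def
  by (intro closure_minimal VS.span_minimal) auto

lemma closed_span_superset: "S \<subseteq> closed_span S"
  unfolding closed_span_def using VS.span_superset closure_subset by blast

lemma closed_span_closed_subspace: "closed_span S \<in> closed_subspaces"
proof (rule closed_subspacesI)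
  let ?T = "complex_span A S"
  show "closed (closed_span S)" by (simp add: closed_span_def)
  show "0 \<in> closed_span S"
    unfolding closed_span_def using VS.span_zero closure_subset by blast
  show "x + y \<in> closed_span S" if "x \<in> closed_span S" "y \<in> closed_span S" for x y
  proof -
    have "(\<lambda>(x, y). x + y) ` closure (?T \<times> ?T) \<subseteq> closure ?T"
    proof (rule image_closure_subset)
      show "continuous_on (closure (?T \<times> ?T)) (\<lambda>(x, y). x + y)"
        by (auto intro!: continuous_intros simp: case_prod_unfold)
      show "(\<lambda>(x, y). x + y) ` (?T \<times> ?T) \<subseteq> closure ?T"
        by (auto intro!: subsetD[OF closure_subset] VS.span_add)
    qed simp
    then show ?thesis
      using that by (auto simp: closed_span_def closure_Times)
  qed
  show "cscale A c x \<in> closed_span S" if "x \<in> closed_span S" for c x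
  proof -
    have "cscale A c ` closure ?T \<subseteq> closure ?T"
    proof (rule image_closure_subset)
      show "continuous_on (closure ?T) (cscale A c)"
        using continuous_cscale continuous_on_subset by blast
      show "cscale A c ` ?T \<subseteq> closure ?T"
        by (auto intro!: subsetD[OF closure_subset] VS.span_scale)
    qed simp
    then show ?thesis using that by (auto simp: closed_span_def)
  qed
qed

lemma closed_span_mono: "S \<subseteq> T \<Longrightarrow> closed_span S \<subseteq> closed_span T"
  by (meson closed_span_closed_subspace closed_span_least closed_span_superset order_trans)

lemma closed_span_eq:
  assumes "V \<in> closed_subspaces"
  shows "closed_span V = V"
  by (simp add: assms closed_span_least closed_span_superset subset_antisym)

lemma closed_subspace_preimage:
  assumes M: "M \<in> closed_subspaces" and f: "continuous_on UNIV f" "f 0 = 0"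
    and add: "\<And>x y. f (x + y) = f x + f y"
    and scale: "\<And>c x. \<exists>c'. f (cscale A c x) = cscale A c' (f x)"
  shows "f -` M \<in> closed_subspaces"
proof (rule closed_subspacesI)
  show "closed (f -` M)"
    using continuous_closed_vimage f(1) closed_subspacesD(1)[OF M]
    by (metis continuous_on_eq_continuous_at open_UNIV UNIV_I)
  show "cscale A c x \<in> f -` M" if "x \<in> f -` M" for c x
    using scale[of c x] closed_subspacesD(4)[OF M] that by auto
qed (use f add closed_subspacesD[OF M] in auto)

definition subspace_product :: "'a set \<Rightarrow> 'a set \<Rightarrow> 'a set" where
  "subspace_product V W = closed_span {a * b |a b. a \<in> V \<and> b \<in> W}"

lemma mult_in_subspace_product: "a \<in> V \<Longrightarrow> b \<in> W \<Longrightarrow> a * b \<in> subspace_product V W"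
  unfolding subspace_product_def by (rule subsetD[OF closed_span_superset]) blast

text \<open>
  Multiplication by a fixed element is linear and continuous, so the elements it sends into \<open>M\<close> form
  a closed subspace; this is applied on each side in turn. Associativity of the product and its
  distributivity over joins are consequences.
\<close>

lemma subspace_product_least:
  assumes M: "M \<in> closed_subspaces" and ST: "\<And>a b. a \<in> S \<Longrightarrow> b \<in> T \<Longrightarrow> a * b \<in> M"
  shows "subspace_product (closed_span S) (closed_span T) \<subseteq> M"
proof -
  have left: "a * b \<in> M" if "a \<in> closed_span S" "b \<in> T" for a b
  proof -
    have "(\<lambda>a. a * b) -` M \<in> closed_subspaces"
      by (rule closed_subspace_preimage[OF M])
         (auto intro!: continuous_intros simp: distrib_right cscale_mult_left)
    then have "closed_span S \<subseteq> (\<lambda>a. a * b) -` M"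
      by (rule closed_span_least) (use ST \<open>b \<in> T\<close> in auto)
    then show ?thesis using that by auto
  qed
  have "a * b \<in> M" if "a \<in> closed_span S" "b \<in> closed_span T" for a b
  proof -
    have "(\<lambda>b. a * b) -` M \<in> closed_subspaces"
      by (rule closed_subspace_preimage[OF M])
         (auto intro!: continuous_intros simp: distrib_left cscale_mult_right)
    then have "closed_span T \<subseteq> (\<lambda>b. a * b) -` M"
      by (rule closed_span_least) (use left that in auto)
    then show ?thesis using that by auto
  qed
  then show ?thesis
    unfolding subspace_product_def by (auto intro!: closed_span_least[OF M])
qed

lemma subspace_product_closed_subspace: "subspace_product V W \<in> closed_subspaces"
  by (simp add: subspace_product_def closed_span_closed_subspace)

lemma subspace_product_closed_span:
  "subspace_product (closed_span S) (closed_span T) = closed_span {a * b |a b. a \<in> S \<and> b \<in> T}"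
proof
  show "subspace_product (closed_span S) (closed_span T) \<subseteq> closed_span {a * b |a b. a \<in> S \<and> b \<in> T}"
    by (rule subspace_product_least[OF closed_span_closed_subspace])
       (use closed_span_superset[of "{a * b |a b. a \<in> S \<and> b \<in> T}"] in blast)
  show "closed_span {a * b |a b. a \<in> S \<and> b \<in> T} \<subseteq> subspace_product (closed_span S) (closed_span T)"
    unfolding subspace_product_def using closed_span_superset[of S] closed_span_superset[of T]
    by (intro closed_span_mono) blast
qed

lemma subspace_product_mono:
  "V \<subseteq> V' \<Longrightarrow> W \<subseteq> W' \<Longrightarrow> subspace_product V W \<subseteq> subspace_product V' W'"
  unfolding subspace_product_def by (intro closed_span_mono) blast

lemma subspace_product_assoc:
  assumes "U \<in> closed_subspaces" "V \<in> closed_subspaces" "W \<in> closed_subspaces"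
  shows "subspace_product (subspace_product U V) W = subspace_product U (subspace_product V W)"
proof -
  have "subspace_product (subspace_product U V) W =
        closed_span {x * c |x c. x \<in> {a * b |a b. a \<in> U \<and> b \<in> V} \<and> c \<in> W}"
    using subspace_product_closed_span[of _ W] unfolding subspace_product_def[of U V]
    by (simp add: closed_span_eq assms)
  also have "{x * c |x c. x \<in> {a * b |a b. a \<in> U \<and> b \<in> V} \<and> c \<in> W} =
        {a * x |a x. a \<in> U \<and> x \<in> {b * c |b c. b \<in> V \<and> c \<in> W}}"
    by (auto simp: mult.assoc) (metis mult.assoc)+
  also have "closed_span \<dots> = subspace_product U (subspace_product V W)"
    using subspace_product_closed_span[of U] unfolding subspace_product_def[of V W]
    by (simp add: closed_span_eq assms)
  finally show ?thesis .
qed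

lemma norm_cstar: "norm (cstar A a) = norm a"
proof -
  have *: "norm a \<le> norm (cstar A a)" for a
  proof (cases "norm a = 0")
    case False
    have "norm a * norm a \<le> norm (cstar A a) * norm a"
      using norm_cstar_mult[of a] norm_mult_ineq[of "cstar A a" a] by (simp add: power2_eq_square)
    then show ?thesis using False by simp
  qed simp
  show ?thesis using *[of a] *[of "cstar A a"] by (simp add: cstar_cstar)
qed

lemma bounded_linear_cstar: "bounded_linear (cstar A)"
proof (rule bounded_linear_intro[where K = 1])
  show "cstar A (r *\<^sub>R x) = r *\<^sub>R cstar A x" for r x
    using cstar_cscale[of "complex_of_real r" x] by (simp add: cscale_of_real)
qed (simp_all add: cstar_add norm_cstar)

lemma cstar_image: "cstar A ` V = cstar A -` V"
  by (auto simp: cstar_cstar image_iff) (metis cstar_cstar)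

lemma cstar_closed_subspace:
  assumes "V \<in> closed_subspaces"
  shows "cstar A ` V \<in> closed_subspaces"
  unfolding cstar_image using bounded_linear_cstar
  by (intro closed_subspace_preimage[OF assms])
     (auto simp: cstar_add cstar_cscale linear_continuous_on bounded_linear.linear linear_0)

lemma cstar_closed_span: "cstar A ` closed_span S = closed_span (cstar A ` S)"
proof -
  have *: "closed_span (cstar A ` S) \<subseteq> cstar A ` closed_span S" for S
    by (intro closed_span_least cstar_closed_subspace closed_span_closed_subspace image_mono
        closed_span_superset)
  have "cstar A ` closed_span S \<subseteq> closed_span (cstar A ` S)"
    using image_mono[OF *[of "cstar A ` S"], of "cstar A"] by (simp add: image_image cstar_cstar)
  with * show ?thesis by blast
qed

lemma max_quantale_simps [simp]:
  "carrier (max_quantale A) = closed_subspaces"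
  "eq (max_quantale A) = (=)" "le (max_quantale A) = (\<subseteq>)"
  "qmul (max_quantale A) = subspace_product" "qinv (max_quantale A) = (`) (cstar A)"
  by (auto simp: max_quantale_def closed_subspaces_def subspace_product_def closed_span_def fun_eq_iff)

lemma closed_subspaces_Inter: "S \<subseteq> closed_subspaces \<Longrightarrow> \<Inter>S \<in> closed_subspaces"
  by (intro closed_subspacesI closed_Inter) (auto dest!: subsetD intro: closed_subspacesD)

lemma max_quantale_complete_lattice:
  shows "Complete_Lattice.complete_lattice (max_quantale A)"
    and qsup_max_quantale: "S \<subseteq> closed_subspaces \<Longrightarrow> qsup (max_quantale A) S = closed_span (\<Union>S)"
proof -
  have lub: "closed_span (\<Union>S) \<in> carrier (max_quantale A) \<and> (\<forall>B\<in>S. B \<subseteq> closed_span (\<Union>S)) \<and>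
     (\<forall>C\<in>carrier (max_quantale A). (\<forall>B\<in>S. B \<subseteq> C) \<longrightarrow> closed_span (\<Union>S) \<subseteq> C)" for S
    using closed_span_superset[of "\<Union>S"] closed_span_least[of _ "\<Union>S"] by (auto simp: closed_span_closed_subspace Union_least dest: subsetD)
  have glb: "\<Inter>S \<in> carrier (max_quantale A) \<and> (\<forall>B\<in>S. \<Inter>S \<subseteq> B) \<and>
     (\<forall>C\<in>carrier (max_quantale A). (\<forall>B\<in>S. C \<subseteq> B) \<longrightarrow> C \<subseteq> \<Inter>S)"
    if "S \<subseteq> carrier (max_quantale A)" for S
    using closed_subspaces_Inter[of S] that by auto
  note * = inclusion_complete_lattice[of "max_quantale A" "\<lambda>S. closed_span (\<Union>S)" Inter]
  show "Complete_Lattice.complete_lattice (max_quantale A)"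
    by (rule *(1)) (use lub glb in auto)
  show "S \<subseteq> closed_subspaces \<Longrightarrow> qsup (max_quantale A) S = closed_span (\<Union>S)"
    by (rule *(2)) (use lub glb in auto)
qed

lemma closed_span_UN_closed_span:
  "closed_span (\<Union>i\<in>I. closed_span (S i)) = closed_span (\<Union>i\<in>I. S i)"
proof
  show "closed_span (\<Union>i\<in>I. closed_span (S i)) \<subseteq> closed_span (\<Union>i\<in>I. S i)"
    by (intro closed_span_least closed_span_closed_subspace UN_least closed_span_mono) auto
  show "closed_span (\<Union>i\<in>I. S i) \<subseteq> closed_span (\<Union>i\<in>I. closed_span (S i))"
    by (intro closed_span_mono UN_mono closed_span_superset) auto
qed

lemma max_quantale_involutive_quantale: "involutive_quantale (max_quantale A)"
proof (rule involutive_quantale.intro)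
  show "Complete_Lattice.complete_lattice (max_quantale A)"
    by (rule max_quantale_complete_lattice)
next
  fix U V W assume "U \<in> carrier (max_quantale A)" "V \<in> carrier (max_quantale A)"
    "W \<in> carrier (max_quantale A)"
  then show "qmul (max_quantale A) (qmul (max_quantale A) U V) W =
      qmul (max_quantale A) U (qmul (max_quantale A) V W)"
    by (simp add: subspace_product_assoc)
next
  fix V S assume V: "V \<in> carrier (max_quantale A)" and "S \<subseteq> carrier (max_quantale A)"
  then have S: "S \<subseteq> closed_subspaces" by simp
  have "qmul (max_quantale A) V (qsup (max_quantale A) S) =
      subspace_product (closed_span V) (closed_span (\<Union>S))"
    using V by (simp add: closed_span_eq qsup_max_quantale S)
  also have "\<dots> = closed_span (\<Union>W\<in>S. {a * b |a b. a \<in> V \<and> b \<in> W})"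
    unfolding subspace_product_closed_span by (rule arg_cong[where f = closed_span]) blast
  also have "\<dots> = closed_span (\<Union>W\<in>S. subspace_product V W)"
    unfolding subspace_product_def closed_span_UN_closed_span ..
  also have "\<dots> = qsup (max_quantale A) (qmul (max_quantale A) V ` S)"
    by (subst qsup_max_quantale) (auto simp: subspace_product_closed_subspace)
  finally show "qmul (max_quantale A) V (qsup (max_quantale A) S) =
      qsup (max_quantale A) (qmul (max_quantale A) V ` S)" .
  have "qmul (max_quantale A) (qsup (max_quantale A) S) V =
      subspace_product (closed_span (\<Union>S)) (closed_span V)"
    using V by (simp add: closed_span_eq qsup_max_quantale S)
  also have "\<dots> = closed_span (\<Union>W\<in>S. {a * b |a b. a \<in> W \<and> b \<in> V})"
    unfolding subspace_product_closed_span by (rule arg_cong[where f = closed_span]) blast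
  also have "\<dots> = closed_span (\<Union>W\<in>S. subspace_product W V)"
    unfolding subspace_product_def closed_span_UN_closed_span ..
  also have "\<dots> = qsup (max_quantale A) ((\<lambda>W. qmul (max_quantale A) W V) ` S)"
    by (subst qsup_max_quantale) (auto simp: subspace_product_closed_subspace)
  finally show "qmul (max_quantale A) (qsup (max_quantale A) S) V =
      qsup (max_quantale A) ((\<lambda>W. qmul (max_quantale A) W V) ` S)" .
next
  fix V W assume "V \<in> carrier (max_quantale A)" "W \<in> carrier (max_quantale A)"
  have "cstar A ` {a * b |a b. a \<in> V \<and> b \<in> W} = {a * b |a b. a \<in> cstar A ` W \<and> b \<in> cstar A ` V}"
  proof (intro Set.set_eqI iffI)
    fix x assume "x \<in> {a * b |a b. a \<in> cstar A ` W \<and> b \<in> cstar A ` V}"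
    then obtain a b where "x = cstar A (b * a)" "a \<in> W" "b \<in> V" by (auto simp: cstar_mult)
    then show "x \<in> cstar A ` {a * b |a b. a \<in> V \<and> b \<in> W}" by blast
  next
    fix x assume "x \<in> cstar A ` {a * b |a b. a \<in> V \<and> b \<in> W}"
    then obtain a b where "x = cstar A b * cstar A a" "a \<in> V" "b \<in> W" by (auto simp: cstar_mult)
    then show "x \<in> {a * b |a b. a \<in> cstar A ` W \<and> b \<in> cstar A ` V}" by blast
  qed
  then show "qinv (max_quantale A) (qmul (max_quantale A) V W) =
      qmul (max_quantale A) (qinv (max_quantale A) W) (qinv (max_quantale A) V)"
    by (simp add: subspace_product_def cstar_closed_span)
next
  fix S assume "S \<subseteq> carrier (max_quantale A)"
  then show "qinv (max_quantale A) (qsup (max_quantale A) S) =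
      qsup (max_quantale A) (qinv (max_quantale A) ` S)"
    by (subst (1 2) qsup_max_quantale)
       (auto simp: cstar_closed_subspace cstar_closed_span image_UN image_Union)
qed (simp_all add: subspace_product_closed_subspace cstar_closed_subspace image_image cstar_cstar)

end


section \<open>The quantale of an etale groupoid\<close>

definition set_mul :: "'g groupoid \<Rightarrow> 'g set \<Rightarrow> 'g set \<Rightarrow> 'g set" where
  "set_mul G U V = {gmul G g h |g h. g \<in> U \<and> h \<in> V \<and> gdom G g = gran G h}"

lemma open_quantale_simps [simp]:
  "carrier (open_quantale G) = {U. open U}"
  "eq (open_quantale G) = (=)" "le (open_quantale G) = (\<subseteq>)"
  "qmul (open_quantale G) = set_mul G" "qinv (open_quantale G) = (`) (ginv G)"
  by (auto simp: open_quantale_def set_mul_def gcomposable_def fun_eq_iff)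

context etale_groupoid
begin

abbreviation "src \<equiv> gdom G"
abbreviation "tgt \<equiv> gran G"
abbreviation "opp \<equiv> ginv G"
abbreviation mul (infixl "\<star>" 70) where "g \<star> h \<equiv> gmul G g h"

lemma src_opp [simp]: "src (opp g) = tgt g"
  by (simp add: gdom_def gran_def inv_inv)

lemma tgt_opp [simp]: "tgt (opp g) = src g"
  by (simp add: gdom_def gran_def inv_inv)

lemma src_mul [simp]: "src g = tgt h \<Longrightarrow> src (g \<star> h) = src h"
  using dom_mul by (simp add: gcomposable_def)

lemma tgt_mul [simp]: "src g = tgt h \<Longrightarrow> tgt (g \<star> h) = tgt g"
  using ran_mul by (simp add: gcomposable_def)

lemma assoc: "src g = tgt h \<Longrightarrow> src h = tgt k \<Longrightarrow> (g \<star> h) \<star> k = g \<star> (h \<star> k)"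
  using mul_assoc by (simp add: gcomposable_def)

lemma opp_mul_cancel [simp]: "src g = tgt h \<Longrightarrow> opp g \<star> (g \<star> h) = h"
  using inv_mul_cancel by (simp add: gcomposable_def)

lemma mul_cancel_opp [simp]: "src g = tgt h \<Longrightarrow> (g \<star> h) \<star> opp h = g"
  using mul_inv_cancel by (simp add: gcomposable_def)

lemma mul_opp_cancel [simp]: "src g = src h \<Longrightarrow> (g \<star> opp h) \<star> h = g"
  using mul_cancel_opp[of g "opp h"] by (simp add: inv_inv)

lemma opp_mul_self: "opp g \<star> g = src g" and mul_opp_self: "g \<star> opp g = tgt g"
  by (simp_all add: gdom_def gran_def)

lemma src_src [simp]: "src (src g) = src g"
  using src_mul[of "opp g" g] by (simp add: opp_mul_self)

lemma tgt_src [simp]: "tgt (src g) = src g"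
  using tgt_mul[of "opp g" g] by (simp add: opp_mul_self)

lemma src_tgt [simp]: "src (tgt g) = tgt g"
  using src_src[of "opp g"] by simp

lemma tgt_mul_self [simp]: "tgt g \<star> g = g"
  using mul_cancel_opp[of g "opp g"] by (simp add: mul_opp_self inv_inv)

lemma mul_src_self [simp]: "g \<star> src g = g"
  using assoc[of g "opp g" g] by (simp add: opp_mul_self mul_opp_self)

text \<open>
  With \<open>z\<close> the inverse of \<open>g \<star> h\<close>, both \<open>z \<star> g\<close> and \<open>opp h\<close> are obtained from \<open>z \<star> (g \<star> h) = src h\<close> by
  multiplying by \<open>opp h\<close> on the right.
\<close>

lemma opp_mul: "src g = tgt h \<Longrightarrow> opp (g \<star> h) = opp h \<star> opp g"
proof -
  assume gh: "src g = tgt h"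
  let ?z = "opp (g \<star> h)"
  have "?z \<star> g = ?z \<star> ((g \<star> h) \<star> opp h)" using gh by simp
  also have "\<dots> = (?z \<star> (g \<star> h)) \<star> opp h" by (rule assoc[symmetric]) (use gh in simp_all)
  also have "\<dots> = tgt (opp h) \<star> opp h" using gh by (simp add: opp_mul_self)
  also have "\<dots> = opp h" by (rule tgt_mul_self)
  finally show ?thesis
    using mul_cancel_opp[of ?z g] gh by simp
qed

lemma mem_units_iff: "x \<in> gunits G \<longleftrightarrow> src x = x"
  unfolding gunits_def by (metis src_src rangeE rangeI)

lemma src_in_units [simp]: "src g \<in> gunits G"
  by (simp add: mem_units_iff)

lemma unit_simps: "x \<in> gunits G \<Longrightarrow> src x = x" "x \<in> gunits G \<Longrightarrow> tgt x = x"
  unfolding mem_units_iff by simp (metis tgt_src)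

lemma unit_mul_self: "x \<in> gunits G \<Longrightarrow> x \<star> x = x"
  using mul_src_self[of x] by (simp add: mem_units_iff)

lemma opp_unit: "x \<in> gunits G \<Longrightarrow> opp x = x"
  using mul_src_self[of "opp x"] opp_mul_self[of x] by (simp add: unit_simps)

subsection \<open>Openness of the structure maps\<close>

lemma continuous_on_opp: "continuous_on S f \<Longrightarrow> continuous_on S (\<lambda>x. opp (f x))"
  using continuous_on_compose2[OF continuous_inv] by blast

lemma continuous_on_mul:
  assumes "continuous_on S f" "continuous_on S g" "\<And>x. x \<in> S \<Longrightarrow> src (f x) = tgt (g x)"
  shows "continuous_on S (\<lambda>x. f x \<star> g x)"
proof -
  have "continuous_on S (\<lambda>x. (\<lambda>(g, h). g \<star> h) (f x, g x))"
    by (rule continuous_on_compose2[OF continuous_mul])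
       (use assms in \<open>auto intro!: continuous_on_Pair simp: gcomposable_def\<close>)
  then show ?thesis by simp
qed

lemma continuous_src: "continuous_on S src" and continuous_tgt: "continuous_on S tgt"
  unfolding gdom_def gran_def
  by (intro continuous_on_mul continuous_on_opp continuous_on_id; simp)+

lemma continuous_on_src: "continuous_on S f \<Longrightarrow> continuous_on S (\<lambda>x. src (f x))"
  and continuous_on_tgt: "continuous_on S f \<Longrightarrow> continuous_on S (\<lambda>x. tgt (f x))"
  using continuous_on_compose2[OF continuous_src[of UNIV], of S f]
    continuous_on_compose2[OF continuous_tgt[of UNIV], of S f] by auto

lemma open_src_vimage: "open V \<Longrightarrow> open (src -` V)"
  and open_tgt_vimage: "open V \<Longrightarrow> open (tgt -` V)"
  and open_opp_vimage: "open V \<Longrightarrow> open (opp -` V)"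
  using continuous_src[of UNIV] continuous_tgt[of UNIV] continuous_inv
  by (auto simp: continuous_on_open_vimage)

lemma opp_image: "opp ` V = opp -` V"
  by (auto simp: inv_inv image_iff) (metis inv_inv)

lemma open_opp_image: "open V \<Longrightarrow> open (opp ` V)"
  by (simp add: opp_image open_opp_vimage)

lemma src_local_injective:
  obtains U where "open U" "g \<in> U" "inj_on src U"
    "\<And>V. open V \<Longrightarrow> V \<subseteq> U \<Longrightarrow> openin (top_of_set (gunits G)) (src ` V)"
proof -
  obtain U i where U: "open U" "g \<in> U" "openin (top_of_set (gunits G)) (src ` U)"
    "homeomorphism U (src ` U) src i"
    using dom_local_homeomorphism[of g] by blast
  show ?thesis
  proof (rule that[of U])
    show "inj_on src U" using U(4) by (metis homeomorphism_def inj_on_inverseI)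
    show "openin (top_of_set (gunits G)) (src ` V)" if "open V" "V \<subseteq> U" for V
    proof -
      have "openin (top_of_set (src ` U)) (src ` V)"
        using homeomorphism_imp_open_map[OF U(4)] that by (simp add: openin_open_eq U(1))
      then show ?thesis using U(3) openin_trans by blast
    qed
  qed (use U in auto)
qed

text \<open>
  If \<open>src\<close> is injective on an open neighbourhood \<open>U\<close> of the unit \<open>x\<close>, then an arrow \<open>y \<in> U\<close> with
  \<open>src y \<in> U\<close> has the same source as the arrow \<open>src y\<close>, hence equals it.
\<close>

lemma open_units: "open (gunits G)"
proof (rule Topological_Spaces.openI)
  fix x assume x: "x \<in> gunits G"
  obtain U where U: "open U" "x \<in> U" "inj_on src U"
    using src_local_injective[of x] by metis
  have "src y = y" if "y \<in> U \<inter> src -` U" for y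
    using that U(3) by (auto simp: inj_on_def)
  then show "\<exists>T. open T \<and> x \<in> T \<and> T \<subseteq> gunits G"
    using U x by (intro exI[of _ "U \<inter> src -` U"]) (auto simp: open_src_vimage mem_units_iff)
qed

lemma open_src_image:
  assumes "open V"
  shows "open (src ` V)"
proof (rule Topological_Spaces.openI)
  fix x assume "x \<in> src ` V"
  then obtain g where g: "g \<in> V" "x = src g" by auto
  obtain U where U: "open U" "g \<in> U"
    "\<And>V. open V \<Longrightarrow> V \<subseteq> U \<Longrightarrow> openin (top_of_set (gunits G)) (src ` V)"
    using src_local_injective[of g] by metis
  have "open (src ` (U \<inter> V))"
    using U(3)[of "U \<inter> V"] openin_open_trans open_units U(1) assms by auto
  then show "\<exists>T. open T \<and> x \<in> T \<and> T \<subseteq> src ` V"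
    using g U by (intro exI[of _ "src ` (U \<inter> V)"]) auto
qed

lemma open_tgt_image: "open V \<Longrightarrow> open (tgt ` V)"
  using open_src_image[OF open_opp_image, of V] by (simp add: image_image)

lemma bisectionD:
  assumes "B \<in> local_bisections G"
  shows "open B" "inj_on src B" "inj_on tgt B"
  using assms by (auto simp: local_bisections_def)

lemma bisection_subset:
  "B \<in> local_bisections G \<Longrightarrow> open C \<Longrightarrow> C \<subseteq> B \<Longrightarrow> C \<in> local_bisections G"
  unfolding local_bisections_def using inj_on_subset by blast

lemma bisection_opp:
  assumes "B \<in> local_bisections G"
  shows "opp ` B \<in> local_bisections G"
  using assms open_opp_image unfolding local_bisections_def inj_on_def by auto

lemma bisection_base:
  assumes "open V" "g \<in> V"
  obtains B where "B \<in> local_bisections G" "g \<in> B" "B \<subseteq> V"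
proof -
  obtain U where U: "open U" "g \<in> U" "inj_on src U" using src_local_injective[of g] by metis
  obtain W where W: "open W" "opp g \<in> W" "inj_on src W"
    using src_local_injective[of "opp g"] by metis
  have "inj_on tgt (opp -` W)"
  proof (rule inj_onI)
    fix a b assume "a \<in> opp -` W" "b \<in> opp -` W" "tgt a = tgt b"
    then have "opp a = opp b" using W(3) by (auto simp: inj_on_def)
    then show "a = b" by (metis inv_inv)
  qed
  then have "V \<inter> U \<inter> opp -` W \<in> local_bisections G"
    using U W assms unfolding local_bisections_def
    by (auto simp: open_opp_vimage intro: inj_on_subset)
  then show thesis using that U W assms by auto
qed

lemma src_section:
  assumes B: "open B" "inj_on src B"
  shows "continuous_on (src ` B) (inv_into B src)"
proof (rule continuous_on_inverse_open_map[OF continuous_src])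
  fix U assume "openin (top_of_set B) U"
  then have "open U" "U \<subseteq> B" using B openin_open_trans openin_imp_subset by blast+
  then show "openin (top_of_set (src ` B)) (src ` U)"
    by (metis B(1) image_mono open_src_image openin_open_eq)
qed (use B in auto)

lemma tgt_section:
  assumes B: "open B" "inj_on tgt B"
  shows "continuous_on (tgt ` B) (inv_into B tgt)"
proof (rule continuous_on_inverse_open_map[OF continuous_tgt])
  fix U assume "openin (top_of_set B) U"
  then have "open U" "U \<subseteq> B" using B openin_open_trans openin_imp_subset by blast+
  then show "openin (top_of_set (tgt ` B)) (tgt ` U)"
    by (metis B(1) image_mono open_tgt_image openin_open_eq)
qed (use B in auto)

text \<open>
  Right division by a local bisection \<open>B\<close>: the unique factorization of \<open>g\<close> with right factor in \<open>B\<close>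
  is \<open>left_factor B g \<star> right_factor B g\<close>, and both factors depend continuously on \<open>g\<close>. This makes
  sense for \<open>src g \<in> src ` B\<close> only.
\<close>

definition right_factor :: "'g set \<Rightarrow> 'g \<Rightarrow> 'g" where
  "right_factor B g = inv_into B src (src g)"

definition left_factor :: "'g set \<Rightarrow> 'g \<Rightarrow> 'g" where
  "left_factor B g = g \<star> opp (right_factor B g)"

lemma right_factor_mem: "src g \<in> src ` B \<Longrightarrow> right_factor B g \<in> B"
  and src_right_factor: "src g \<in> src ` B \<Longrightarrow> src (right_factor B g) = src g"
  unfolding right_factor_def by (auto intro: inv_into_into f_inv_into_f)

lemma src_left_factor: "src g \<in> src ` B \<Longrightarrow> src (left_factor B g) = tgt (right_factor B g)"
  and factor_mul: "src g \<in> src ` B \<Longrightarrow> left_factor B g \<star> right_factor B g = g"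
  unfolding left_factor_def by (simp_all add: src_right_factor)

lemma factor_mul_eq:
  assumes "inj_on src B" "k \<in> B" "src h = tgt k"
  shows "right_factor B (h \<star> k) = k" "left_factor B (h \<star> k) = h"
proof -
  show "right_factor B (h \<star> k) = k" using assms by (simp add: right_factor_def)
  then show "left_factor B (h \<star> k) = h" using assms by (simp add: left_factor_def)
qed

lemma continuous_right_factor:
  assumes "open B" "inj_on src B"
  shows "continuous_on (src -` src ` B) (right_factor B)"
  unfolding right_factor_def
  by (rule continuous_on_compose2[OF src_section[OF assms] continuous_src]) auto

lemma continuous_left_factor:
  assumes "open B" "inj_on src B"
  shows "continuous_on (src -` src ` B) (left_factor B)"
  unfolding left_factor_def
  by (intro continuous_on_mul continuous_on_opp continuous_right_factor[OF assms] continuous_on_id)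
     (auto simp: src_right_factor)

text \<open>
  Near \<open>h \<star> k\<close> the factorization with right factor in a small local bisection around \<open>k\<close> is
  continuous, so its left factor stays in \<open>U\<close>.
\<close>

lemma open_set_mul:
  assumes "open U" "open V"
  shows "open (set_mul G U V)"
proof (rule Topological_Spaces.openI)
  fix g assume "g \<in> set_mul G U V"
  then obtain h k where hk: "g = h \<star> k" "h \<in> U" "k \<in> V" "src h = tgt k"
    by (auto simp: set_mul_def)
  obtain B where B: "B \<in> local_bisections G" "k \<in> B" "B \<subseteq> V"
    using bisection_base[OF assms(2) hk(3)] by metis
  note B' = bisectionD[OF B(1)]
  let ?D = "src -` src ` B"
  let ?O = "?D \<inter> left_factor B -` U"
  have D: "open ?D" by (intro open_src_vimage open_src_image B')
  have "open ?O"
    using continuous_left_factor[OF B'(1,2)] D assms(1)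
    by (simp add: continuous_on_open_vimage Int_commute)
  moreover have "g \<in> ?O" using hk B factor_mul_eq[OF B'(2)] by auto
  moreover have "?O \<subseteq> set_mul G U V"
    using factor_mul src_left_factor right_factor_mem B(3) unfolding set_mul_def
    by (smt (verit, best) IntE mem_Collect_eq subset_eq vimageE)
  ultimately show "\<exists>T. open T \<and> g \<in> T \<and> T \<subseteq> set_mul G U V" by blast
qed

lemma bisection_set_mul:
  assumes A: "A \<in> local_bisections G" and B: "B \<in> local_bisections G"
  shows "set_mul G A B \<in> local_bisections G"
proof -
  note A' = bisectionD[OF A] and B' = bisectionD[OF B]
  have "inj_on src (set_mul G A B)"
  proof (rule inj_onI; clarsimp simp: set_mul_def)
    fix h k h' k' assume *: "h \<in> A" "k \<in> B" "src h = tgt k" "h' \<in> A" "k' \<in> B" "src h' = tgt k'"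
      "src k = src k'"
    then have "k = k'" using B'(2) by (auto simp: inj_on_def)
    moreover have "h = h'" using calculation * A'(2) by (auto simp: inj_on_def)
    ultimately show "h \<star> k = h' \<star> k'" by simp
  qed
  moreover have "inj_on tgt (set_mul G A B)"
  proof (rule inj_onI; clarsimp simp: set_mul_def)
    fix h k h' k' assume *: "h \<in> A" "k \<in> B" "src h = tgt k" "h' \<in> A" "k' \<in> B" "src h' = tgt k'"
      "tgt h = tgt h'"
    then have "h = h'" using A'(3) by (auto simp: inj_on_def)
    moreover have "k = k'" using calculation * B'(3) by (auto simp: inj_on_def)
    ultimately show "h \<star> k = h' \<star> k'" by simp
  qed
  ultimately show ?thesis
    using open_set_mul[OF A'(1) B'(1)] by (simp add: local_bisections_def)
qed

lemma set_mul_assoc: "set_mul G (set_mul G U V) W = set_mul G U (set_mul G V W)"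
proof (intro equalityI subsetI)
  fix x assume "x \<in> set_mul G (set_mul G U V) W"
  then obtain g h k where *: "x = (g \<star> h) \<star> k" "g \<in> U" "h \<in> V" "k \<in> W" "src g = tgt h" "src h = tgt k"
    by (auto simp: set_mul_def)
  then have "x = g \<star> (h \<star> k)" "src g = tgt (h \<star> k)" "h \<star> k \<in> set_mul G V W"
    by (auto simp: assoc set_mul_def)
  then show "x \<in> set_mul G U (set_mul G V W)" using * unfolding set_mul_def by blast
next
  fix x assume "x \<in> set_mul G U (set_mul G V W)"
  then obtain g h k where *: "x = g \<star> (h \<star> k)" "g \<in> U" "h \<in> V" "k \<in> W" "src g = tgt h" "src h = tgt k"
    by (auto simp: set_mul_def)
  then have "x = (g \<star> h) \<star> k" "src (g \<star> h) = tgt k" "g \<star> h \<in> set_mul G U V"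
    by (auto simp: assoc set_mul_def)
  then show "x \<in> set_mul G (set_mul G U V) W" using * unfolding set_mul_def by blast
qed

lemma opp_set_mul: "opp ` set_mul G U V = set_mul G (opp ` V) (opp ` U)"
proof (intro equalityI subsetI)
  fix x assume "x \<in> opp ` set_mul G U V"
  then show "x \<in> set_mul G (opp ` V) (opp ` U)"
    by (auto simp: set_mul_def opp_mul) (metis src_opp imageI tgt_opp)
next
  fix x assume "x \<in> set_mul G (opp ` V) (opp ` U)"
  then obtain g h where "x = opp (g \<star> h)" "g \<in> U" "h \<in> V" "src g = tgt h"
    by (auto simp: set_mul_def opp_mul)
  then show "x \<in> opp ` set_mul G U V" by (auto simp: set_mul_def)
qed

lemma set_mul_Union: "set_mul G U (\<Union>S) = \<Union>(set_mul G U ` S)"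
  and Union_set_mul: "set_mul G (\<Union>S) U = \<Union>((\<lambda>V. set_mul G V U) ` S)"
  unfolding set_mul_def by blast+

lemma open_quantale_complete_lattice:
  shows "Complete_Lattice.complete_lattice (open_quantale G)"
    and qsup_open_quantale: "S \<subseteq> {U. open U} \<Longrightarrow> qsup (open_quantale G) S = \<Union>S"
proof -
  have lub: "\<Union>S \<in> carrier (open_quantale G) \<and> (\<forall>B\<in>S. B \<subseteq> \<Union>S) \<and>
     (\<forall>C\<in>carrier (open_quantale G). (\<forall>B\<in>S. B \<subseteq> C) \<longrightarrow> \<Union>S \<subseteq> C)"
    if "S \<subseteq> carrier (open_quantale G)" for S
    using that by (auto intro!: open_Union)
  have glb: "interior (\<Inter>S) \<in> carrier (open_quantale G) \<and> (\<forall>B\<in>S. interior (\<Inter>S) \<subseteq> B) \<and>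
     (\<forall>C\<in>carrier (open_quantale G). (\<forall>B\<in>S. C \<subseteq> B) \<longrightarrow> C \<subseteq> interior (\<Inter>S))" for S
    using interior_subset[of "\<Inter>S"] by (auto simp: le_Inf_iff interior_maximal)
  note * = inclusion_complete_lattice[of "open_quantale G" Union "\<lambda>S. interior (\<Inter>S)"]
  show "Complete_Lattice.complete_lattice (open_quantale G)"
    by (rule *(1)[OF _ _ lub glb]) simp_all
  show "S \<subseteq> {U. open U} \<Longrightarrow> qsup (open_quantale G) S = \<Union>S"
    by (rule *(2)[OF _ _ lub glb]) simp_all
qed

lemma open_quantale_involutive_quantale: "involutive_quantale (open_quantale G)"
proof (rule involutive_quantale.intro)
  show "Complete_Lattice.complete_lattice (open_quantale G)"
    by (rule open_quantale_complete_lattice)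
next
  fix U S assume "S \<subseteq> carrier (open_quantale G)" "U \<in> carrier (open_quantale G)"
  then have S: "S \<subseteq> {U. open U}" and U: "open U" by simp_all
  have "set_mul G U ` S \<subseteq> {U. open U}" "(\<lambda>V. set_mul G V U) ` S \<subseteq> {U. open U}"
    using S U by (auto simp: open_set_mul)
  then show "qmul (open_quantale G) U (qsup (open_quantale G) S) =
      qsup (open_quantale G) (qmul (open_quantale G) U ` S)"
    "qmul (open_quantale G) (qsup (open_quantale G) S) U =
      qsup (open_quantale G) ((\<lambda>V. qmul (open_quantale G) V U) ` S)"
    using S by (simp_all add: qsup_open_quantale set_mul_Union Union_set_mul)
next
  fix S assume "S \<subseteq> carrier (open_quantale G)"
  then show "qinv (open_quantale G) (qsup (open_quantale G) S) =
      qsup (open_quantale G) (qinv (open_quantale G) ` S)"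
    by (subst (1 2) qsup_open_quantale) (auto simp: open_opp_image image_Union)
qed (simp_all add: open_set_mul open_opp_image set_mul_assoc opp_set_mul image_image inv_inv)

end


section \<open>Compact neighbourhoods and cutoff functions\<close>

locale hausdorff_etale_groupoid = etale_groupoid G
  for G :: "('g::t2_space) groupoid"
begin

lemma Hausdorff_space_arrows: "Hausdorff_space (euclidean :: 'g topology)"
  unfolding Hausdorff_space_def using hausdorff by (fastforce simp: disjnt_def)

text \<open>
  Local inverses of \<open>src\<close> transport compact neighbourhoods from the unit space.
\<close>

lemma locally_compact_arrows: "locally_compact_space (euclidean :: 'g topology)"
  unfolding locally_compact_space_def
proof (intro ballI)
  fix g :: 'g
  obtain U where U: "open U" "g \<in> U" "inj_on src U" using src_local_injective[of g] by metis
  have "neighbourhood_base_of (compactin (top_of_set (gunits G))) (top_of_set (gunits G))"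
    using locally_compact_units Hausdorff_units locally_compact_space_neighbourhood_base by blast
  moreover have "openin (top_of_set (gunits G)) (src ` U)" "src g \<in> src ` U"
    using U open_src_image[OF U(1)] by (auto simp: openin_open_eq open_units)
  ultimately obtain V K where V: "openin (top_of_set (gunits G)) V"
    "compactin (top_of_set (gunits G)) K" "src g \<in> V" "V \<subseteq> K" "K \<subseteq> src ` U"
    unfolding neighbourhood_base_of by meson
  then have VK: "open V" "compact K"
    using openin_open_trans open_units by (auto simp: compactin_subtopology)
  let ?s = "inv_into U src"
  have "compact (?s ` K)"
    by (intro compact_continuous_image VK continuous_on_subset[OF src_section[OF U(1,3)] V(5)])
  moreover have "U \<inter> src -` V \<subseteq> ?s ` K"
    using V(4) U(3) by (force simp: image_iff)
  ultimately show "\<exists>U K. openin euclidean U \<and> compactin euclidean K \<and> g \<in> U \<and> U \<subseteq> K"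
    using U V(3) open_src_vimage[OF VK(1)]
    by (intro exI[of _ "U \<inter> src -` V"] exI[of _ "?s ` K"]) auto
qed

lemma compact_neighbourhood:
  assumes "open V" "(g::'g) \<in> V"
  obtains O' K where "open O'" "compact K" "g \<in> O'" "O' \<subseteq> K" "K \<subseteq> V"
proof -
  have "neighbourhood_base_of (compactin euclidean) (euclidean :: 'g topology)"
    using locally_compact_arrows Hausdorff_space_arrows locally_compact_space_neighbourhood_base
    by blast
  then show thesis
    using assms that unfolding neighbourhood_base_of by (metis compactin_euclidean_iff open_openin)
qed

lemma cutoff_function:
  assumes "open V" "(g::'g) \<in> V"
  obtains f :: "'g \<Rightarrow> real" and O' where "continuous_on UNIV f" "open O'" "g \<in> O'"
    "\<And>x. x \<in> O' \<Longrightarrow> f x = 1" "compact (closure {x. f x \<noteq> 0})" "closure {x. f x \<noteq> 0} \<subseteq> V"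
proof -
  obtain W K where W: "open W" "compact K" "g \<in> W" "W \<subseteq> K" "K \<subseteq> V"
    using compact_neighbourhood[OF assms] by metis
  have "completely_regular_space (euclidean :: 'g topology)"
    using locally_compact_regular_imp_completely_regular_space locally_compact_arrows
      Hausdorff_space_arrows by blast
  moreover have "closedin euclidean (- W)" "g \<in> topspace euclidean - (- W)"
    using W by auto
  ultimately obtain f :: "'g \<Rightarrow> real" where f: "continuous_map euclidean (top_of_set {0..1}) f"
    "f g = 0" "f ` (- W) \<subseteq> {1}"
    unfolding completely_regular_space_def by blast
  then have cf: "continuous_on UNIV f" by (simp add: continuous_map_in_subtopology)
  \<comment> \<open>Only \<open>f g = 0\<close> is known; truncation gives a function that is one wherever \<open>f < 1 / 2\<close>.\<close>
  define h where "h x = max 0 (min 1 (2 - 2 * f x))" for x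
  have sub: "closure {x. h x \<noteq> 0} \<subseteq> K"
    by (rule closure_minimal) (use f(3) W(4) compact_imp_closed[OF W(2)] in \<open>force simp: h_def\<close>)+
  show thesis
  proof (rule that[of h "f -` {..<1/2}"])
    show "continuous_on UNIV h" unfolding h_def by (intro continuous_intros cf)
    show "open (f -` {..<1/2})" using cf by (simp add: continuous_on_open_vimage)
    show "compact (closure {x. h x \<noteq> 0})"
      using W(2) sub by (metis closed_closure compact_Int_closed inf.absorb2)
  qed (use f(2) sub W(5) in \<open>auto simp: h_def\<close>)
qed

end


section \<open>Fell line bundles in coordinates\<close>

locale hausdorff_fell_line_bundle = hausdorff_etale_groupoid G + fell_line_bundle G E
  for G :: "('g::t2_space) groupoid"
    and E :: "('g, 'e::topological_space) fell_bundle"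
begin

abbreviation "\<pi> \<equiv> proj E"

subsection \<open>Fibrewise arithmetic\<close>

lemma fibre_simps [simp]:
  "carrier (fibre E g) = \<pi> -` {g}" "ring.zero (fibre E g) = fzero E g"
  "add (fibre E g) = fadd E" "smult (fibre E g) = fscale E"
  by (simp_all add: fibre_def)

lemma complex_ring_simps [simp]:
  "carrier complex_ring = UNIV" "monoid.mult complex_ring = (*)" "one complex_ring = 1"
  "ring.zero complex_ring = 0" "add complex_ring = (+)"
  by (simp_all add: complex_ring_def)

lemma proj_fzero [simp]: "\<pi> (fzero E g) = g"
  and proj_fadd [simp]: "\<pi> e = \<pi> f \<Longrightarrow> \<pi> (fadd E e f) = \<pi> f"
  and proj_fscale [simp]: "\<pi> (fscale E c e) = \<pi> e"
  and fadd_fzero: "fadd E e (fzero E (\<pi> e)) = e"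
  and fscale_add_left: "fscale E (b + c) e = fadd E (fscale E b e) (fscale E c e)"
  and fscale_fscale [simp]: "fscale E b (fscale E c e) = fscale E (b * c) e"
  and fscale_one [simp]: "fscale E 1 e = e"
  and fscale_zero_left [simp]: "fscale E 0 e = fzero E (\<pi> e)"
  and fscale_fzero [simp]: "fscale E c (fzero E g) = fzero E g"
proof -
  interpret M: Module.module complex_ring "fibre E (\<pi> e)" by (rule fibre_module)
  interpret M': Module.module complex_ring "fibre E g" by (rule fibre_module)
  show "\<pi> (fzero E g) = g" using M'.zero_closed by simp
  show "\<pi> e = \<pi> f \<Longrightarrow> \<pi> (fadd E e f) = \<pi> f" using M.a_closed[of e f] by simp
  show "\<pi> (fscale E c e) = \<pi> e" using M.smult_closed[of c e] by simp
  show "fadd E e (fzero E (\<pi> e)) = e" using M.r_zero[of e] by simp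
  show "fscale E (b + c) e = fadd E (fscale E b e) (fscale E c e)"
    using M.smult_l_distr[of b c e] by simp
  show "fscale E b (fscale E c e) = fscale E (b * c) e"
    using M.smult_assoc1[of b c e] by simp
  show "fscale E 1 e = e" using M.smult_one[of e] by simp
  show "fscale E 0 e = fzero E (\<pi> e)" using M.smult_l_null[of e] by simp
  show "fscale E c (fzero E g) = fzero E g" using M'.smult_r_null[of c] by simp
qed

lemma fnorm_fzero [simp]: "fnorm E (fzero E g) = 0"
  by (simp add: norm_eq_0_iff)

text \<open>
  Every fibre is identified isometrically with the complex numbers by choosing a vector of norm one
  in it. The choice is arbitrary, so these coordinates need not depend continuously on the base point;
  only their absolute values and ratios are meaningful topologically.
\<close>

definition unit_vector :: "'g \<Rightarrow> 'e" where
  "unit_vector g = (SOME u. \<pi> u = g \<and> fnorm E u = 1 \<and> (\<forall>f. \<pi> f = g \<longrightarrow> (\<exists>c. f = fscale E c u)))"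

definition coord :: "'e \<Rightarrow> complex" where
  "coord e = (SOME c. e = fscale E c (unit_vector (\<pi> e)))"

lemma unit_vector:
  shows proj_unit_vector [simp]: "\<pi> (unit_vector g) = g"
    and fnorm_unit_vector [simp]: "fnorm E (unit_vector g) = 1"
    and fscale_unit_vector: "\<pi> f = g \<Longrightarrow> \<exists>c. f = fscale E c (unit_vector g)"
proof -
  obtain e where e: "\<pi> e = g" "e \<noteq> fzero E g" "\<And>f. \<pi> f = g \<Longrightarrow> \<exists>c. f = fscale E c e"
    using fibre_one_dimensional[of g] by auto
  define n where "n = fnorm E e"
  have n: "n > 0" using e(1,2) norm_nonneg[of e] norm_eq_0_iff[of e] by (simp add: n_def)
  have "\<pi> u = g \<and> fnorm E u = 1 \<and> (\<forall>f. \<pi> f = g \<longrightarrow> (\<exists>c. f = fscale E c u))"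
    if u: "u = fscale E (complex_of_real (1 / n)) e" for u
  proof (intro conjI allI impI)
    show "fnorm E u = 1" using n by (simp add: u norm_scale norm_divide n_def)
    fix f assume "\<pi> f = g"
    then obtain c where "f = fscale E c e" using e(3) by blast
    then have "f = fscale E (c * n) u" using n by (simp add: u)
    then show "\<exists>c. f = fscale E c u" ..
  qed (simp add: u e)
  then have "\<exists>u. \<pi> u = g \<and> fnorm E u = 1 \<and> (\<forall>f. \<pi> f = g \<longrightarrow> (\<exists>c. f = fscale E c u))"
    by blast
  then have *: "\<pi> (unit_vector g) = g \<and> fnorm E (unit_vector g) = 1 \<and>
      (\<forall>f. \<pi> f = g \<longrightarrow> (\<exists>c. f = fscale E c (unit_vector g)))"
    unfolding unit_vector_def by (rule someI_ex)
  then show "\<pi> (unit_vector g) = g" "fnorm E (unit_vector g) = 1"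
    "\<pi> f = g \<Longrightarrow> \<exists>c. f = fscale E c (unit_vector g)" by blast+
qed

lemma coord: "fscale E (coord e) (unit_vector (\<pi> e)) = e"
  unfolding coord_def by (rule sym, rule someI_ex, rule fscale_unit_vector) simp

lemma cmod_coord: "cmod (coord e) = fnorm E e"
  by (subst (2) coord[symmetric]) (simp add: norm_scale)

lemma coord_fscale_unit_vector [simp]: "coord (fscale E c (unit_vector g)) = c"
proof -
  let ?e = "fscale E c (unit_vector g)" and ?d = "coord (fscale E c (unit_vector g))"
  have "fscale E ?d (unit_vector g) = ?e" using coord[of ?e] by simp
  then have "fscale E (?d - c) (unit_vector g) = fscale E (c - c) (unit_vector g)"
    by (simp only: fscale_add_left diff_conv_add_uminus)
  then have "fnorm E (fscale E (?d - c) (unit_vector g)) = 0" by simp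
  then show ?thesis by (simp add: norm_scale)
qed

lemma coord_unit_vector [simp]: "coord (unit_vector g) = 1"
  using coord_fscale_unit_vector[of 1 g] by simp

lemma coord_eqI: "\<pi> e = \<pi> f \<Longrightarrow> coord e = coord f \<Longrightarrow> e = f"
  by (metis coord)

lemma coord_fscale [simp]: "coord (fscale E c e) = c * coord e"
  by (metis coord fscale_fscale coord_fscale_unit_vector)

lemma coord_fadd [simp]: "\<pi> e = \<pi> f \<Longrightarrow> coord (fadd E e f) = coord e + coord f"
  by (metis coord fscale_add_left coord_fscale_unit_vector)

lemma coord_fzero [simp]: "coord (fzero E g) = 0"
  using cmod_coord[of "fzero E g"] by simp

lemma coord_eq_0_iff: "coord e = 0 \<longleftrightarrow> e = fzero E (\<pi> e)"
  by (metis cmod_coord norm_eq_0_iff norm_eq_zero)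

subsection \<open>The topology of the total space\<close>

lemma Hausdorff_total: 
  assumes "(e::'e) \<noteq> f"
  obtains U V where "open U" "open V" "e \<in> U" "f \<in> V" "U \<inter> V = {}"
proof -
  have "Hausdorff_space (top_of_set (UNIV :: 'g set))" using Hausdorff_space_arrows by simp
  then have "Hausdorff_space (top_of_set (\<pi> -` UNIV))" using restriction_Hausdorff[of UNIV] by simp
  then show thesis using assms that unfolding Hausdorff_space_def disjnt_def by simp metis
qed

lemma continuous_on_fadd:
  assumes "continuous_on S s" "continuous_on S t" "\<And>x. x \<in> S \<Longrightarrow> \<pi> (s x) = \<pi> (t x)"
  shows "continuous_on S (\<lambda>x. fadd E (s x) (t x))"
proof -
  have "continuous_on S (\<lambda>x. (\<lambda>(e, f). fadd E e f) (s x, t x))"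
    by (rule continuous_on_compose2[OF add_continuous])
       (use assms in \<open>auto intro!: continuous_on_Pair\<close>)
  then show ?thesis by simp
qed

lemma continuous_on_fscale_const:
  "continuous_on S s \<Longrightarrow> continuous_on S (\<lambda>x. fscale E c (s x))"
  using continuous_on_compose2[OF scale_continuous] by blast

lemma continuous_on_fstar: "continuous_on S s \<Longrightarrow> continuous_on S (\<lambda>x. fstar E (s x))"
  using continuous_on_compose2[OF star_continuous] by blast

lemma continuous_on_fmul:
  assumes "continuous_on S s" "continuous_on S t" "\<And>x. x \<in> S \<Longrightarrow> src (\<pi> (s x)) = tgt (\<pi> (t x))"
  shows "continuous_on S (\<lambda>x. fmul E (s x) (t x))"
proof -
  have "continuous_on S (\<lambda>x. (\<lambda>(e, f). fmul E e f) (s x, t x))"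
    by (rule continuous_on_compose2[OF mul_continuous])
       (use assms in \<open>auto intro!: continuous_on_Pair simp: gcomposable_def\<close>)
  then show ?thesis by simp
qed

lemma open_fnorm_less: 
  assumes "continuous_on S s" "open S"
  shows "open {x \<in> S. fnorm E (s x) < t}"
proof -
  have "open (s -` {e. fnorm E e < t} \<inter> S)"
    using assms norm_upper_semicontinuous continuous_on_open_vimage by blast
  then show ?thesis by (simp add: vimage_def Int_def conj_commute)
qed

text \<open>
  Addition is continuous at \<open>(e, 0)\<close>, and elements of small norm are close to zero. So
  norm estimates in the fibres can do the work of continuous local sections.
\<close>

lemma perturbation_neighbourhood:
  assumes "open W" "e \<in> W"
  obtains V \<epsilon> where "open V" "e \<in> V" "\<epsilon> > 0"
    "\<And>f f'. f \<in> V \<Longrightarrow> \<pi> f' = \<pi> f \<Longrightarrow> cmod (coord f' - coord f) < \<epsilon> \<Longrightarrow> f' \<in> W"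
proof -
  let ?D = "{(e, f). \<pi> e = \<pi> f}" and ?z = "fzero E (\<pi> e)"
  obtain T where T: "open T" "T \<inter> ?D = (\<lambda>(e, f). fadd E e f) -` W \<inter> ?D"
    using add_continuous assms(1) unfolding continuous_on_open_invariant by blast
  have "(e, ?z) \<in> T" using T(2) assms(2) by (auto simp: fadd_fzero)
  then obtain A B where AB: "open A" "open B" "e \<in> A" "?z \<in> B" "A \<times> B \<subseteq> T"
    using open_prod_elim[OF T(1)] by (metis mem_Sigma_iff)
  obtain \<epsilon> U where \<epsilon>: "\<epsilon> > 0" "open U" "\<pi> e \<in> U" "{f \<in> \<pi> -` U. fnorm E f < \<epsilon>} \<subseteq> B"
    using zero_neighbourhoods[OF AB(2,4)] by blast
  show thesis
  proof (rule that[of "A \<inter> \<pi> -` U" \<epsilon>])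
    show "open (A \<inter> \<pi> -` U)"
      using AB(1) \<epsilon>(2) proj_continuous by (simp add: continuous_on_open_vimage open_Int)
    show "f' \<in> W" if f: "f \<in> A \<inter> \<pi> -` U" "\<pi> f' = \<pi> f" "cmod (coord f' - coord f) < \<epsilon>" for f f'
    proof -
      define z where "z = fscale E (coord f' - coord f) (unit_vector (\<pi> f))"
      have "z \<in> B" using f \<epsilon>(4) by (auto simp: z_def norm_scale)
      then have "(f, z) \<in> T \<inter> ?D" using AB(5) f by (auto simp: z_def)
      then have "fadd E f z \<in> W" using T(2) by auto
      moreover have "fadd E f z = f'" by (rule coord_eqI) (auto simp: z_def f)
      ultimately show ?thesis by simp
    qed
  qed (use AB \<epsilon> in auto)
qed

text \<open>
  Continuity of each single scalar multiplication becomes joint continuity, because changing the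
  scalar slightly is a perturbation of small norm.
\<close>

lemma continuous_on_fscale:
  assumes c: "continuous_on S c" and s: "continuous_on S s"
  shows "continuous_on S (\<lambda>x. fscale E (c x) (s x))"
proof -
  have "continuous_on UNIV (\<lambda>(c, e). fscale E c e)"
    unfolding continuous_on_topological
  proof (clarsimp)
    fix c e B assume B: "open B" "fscale E c e \<in> B"
    obtain V \<epsilon> where V: "open V" "fscale E c e \<in> V" "\<epsilon> > 0"
      "\<And>f f'. f \<in> V \<Longrightarrow> \<pi> f' = \<pi> f \<Longrightarrow> cmod (coord f' - coord f) < \<epsilon> \<Longrightarrow> f' \<in> B"
      using perturbation_neighbourhood[OF B] by metis
    define n where "n = fnorm E e + 1"
    have n: "n > 0" using norm_nonneg[of e] by (simp add: n_def)
    define A where "A = ball c (\<epsilon> / n) \<times> (fscale E c -` V \<inter> {f. fnorm E f < n})"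
    have "open A"
      unfolding A_def using V(1) scale_continuous norm_upper_semicontinuous
      by (intro open_Times open_Int) (auto simp: continuous_on_open_vimage)
    moreover have "(c, e) \<in> A" using V n by (simp add: A_def n_def)
    moreover have "fscale E c' f \<in> B" if "(c', f) \<in> A" for c' f
    proof (rule V(4)[of "fscale E c f"])
      have "cmod (c' - c) * cmod (coord f) \<le> cmod (c' - c) * n"
        using that by (intro mult_left_mono) (auto simp: A_def cmod_coord)
      also have "\<dots> < \<epsilon>"
        using that n by (auto simp: A_def dist_norm norm_minus_commute pos_less_divide_eq)
      finally show "cmod (coord (fscale E c' f) - coord (fscale E c f)) < \<epsilon>"
        by (simp add: norm_mult flip: left_diff_distrib)
    qed (use that in \<open>auto simp: A_def\<close>)
    ultimately show "\<exists>A. open A \<and> (c, e) \<in> A \<and> (\<forall>a b. (a, b) \<in> A \<longrightarrow> fscale E a b \<in> B)" by blast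
  qed
  then have "continuous_on S (\<lambda>x. (\<lambda>(c, e). fscale E c e) (c x, s x))"
    by (rule continuous_on_compose2) (auto intro!: continuous_on_Pair c s)
  then show ?thesis by simp
qed

text \<open>
  Elements of small norm near \<open>\<pi> e\<close> accumulate only at zero, so by the Hausdorff property the norm
  is bounded below near a non-zero \<open>e\<close>.
\<close>

lemma coord_bounded_below:
  assumes "coord e \<noteq> 0"
  obtains V \<delta> where "open V" "e \<in> V" "\<delta> > 0" "\<And>f. f \<in> V \<Longrightarrow> \<delta> \<le> cmod (coord f)"
proof -
  have "e \<noteq> fzero E (\<pi> e)" using assms coord_eq_0_iff by auto
  then obtain A B where AB: "open A" "open B" "e \<in> A" "fzero E (\<pi> e) \<in> B" "A \<inter> B = {}"
    using Hausdorff_total by metis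
  obtain \<epsilon> U where \<epsilon>: "\<epsilon> > 0" "open U" "\<pi> e \<in> U" "{f \<in> \<pi> -` U. fnorm E f < \<epsilon>} \<subseteq> B"
    using zero_neighbourhoods[OF AB(2,4)] by blast
  have "open (A \<inter> \<pi> -` U)"
    using AB(1) \<epsilon>(2) proj_continuous by (simp add: continuous_on_open_vimage open_Int)
  moreover have "\<epsilon> \<le> cmod (coord f)" if "f \<in> A \<inter> \<pi> -` U" for f
    using that AB(5) \<epsilon>(4) unfolding cmod_coord by (cases "fnorm E f < \<epsilon>") auto
  ultimately show thesis using that[of "A \<inter> \<pi> -` U" \<epsilon>] AB \<epsilon> by auto
qed

lemma open_nonzero: "open {e. coord e \<noteq> 0}"
proof (rule Topological_Spaces.openI)
  fix e assume "e \<in> {e. coord e \<noteq> 0}"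
  then obtain V \<delta> where V: "open V" "e \<in> V" "\<delta> > 0" "\<And>f. f \<in> V \<Longrightarrow> \<delta> \<le> cmod (coord f)"
    using coord_bounded_below[of e] by auto
  then have "V \<subseteq> {e. coord e \<noteq> 0}" by fastforce
  then show "\<exists>T. open T \<and> e \<in> T \<and> T \<subseteq> {e. coord e \<noteq> 0}" using V by blast
qed

lemma open_section_nonzero:
  assumes "continuous_on S s" "open S"
  shows "open {x \<in> S. coord (s x) \<noteq> 0}"
proof -
  have "open (s -` {e. coord e \<noteq> 0} \<inter> S)"
    using assms open_nonzero continuous_on_open_vimage by blast
  then show ?thesis by (simp add: vimage_def Int_def conj_commute)
qed

text \<open>
  With \<open>c\<close> the value of the quotient at \<open>x\<close>, the section \<open>s - c \<cdot> w\<close> vanishes at \<open>x\<close> and so has small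
  norm near \<open>x\<close>, while the norm of \<open>w\<close> is bounded below there.
\<close>

lemma continuous_on_coord_quotient:
  fixes s w :: "'x::topological_space \<Rightarrow> 'e"
  assumes s: "continuous_on S s" and w: "continuous_on S w"
    and p: "\<And>x. x \<in> S \<Longrightarrow> \<pi> (s x) = \<pi> (w x)" and nz: "\<And>x. x \<in> S \<Longrightarrow> coord (w x) \<noteq> 0"
  shows "continuous_on S (\<lambda>x. coord (s x) / coord (w x))"
  unfolding continuous_on_topological
proof (intro ballI allI impI)
  fix x B assume x: "x \<in> S" and B: "open B" "coord (s x) / coord (w x) \<in> B"
  define c where "c = coord (s x) / coord (w x)"
  obtain \<epsilon> where \<epsilon>: "\<epsilon> > 0" "ball c \<epsilon> \<subseteq> B"
    using B unfolding c_def by (meson open_contains_ball)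
  obtain V \<delta> where V: "open V" "w x \<in> V" "\<delta> > 0" "\<And>f. f \<in> V \<Longrightarrow> \<delta> \<le> cmod (coord f)"
    using coord_bounded_below[OF nz[OF x]] by metis
  define z where "z y = fadd E (s y) (fscale E (- c) (w y))" for y
  have cz: "coord (z y) = coord (s y) - c * coord (w y)" if "y \<in> S" for y
    using p[OF that] by (simp add: z_def)
  have "continuous_on S z"
    unfolding z_def by (intro continuous_on_fadd continuous_on_fscale_const s w) (simp add: p)
  moreover have "z x \<in> {e. fnorm E e < \<epsilon> * \<delta>}"
    using cz[OF x] nz[OF x] \<epsilon> V(3) by (simp add: c_def flip: cmod_coord)
  ultimately obtain A1 where A1: "open A1" "x \<in> A1" "\<And>y. y \<in> S \<Longrightarrow> y \<in> A1 \<Longrightarrow> fnorm E (z y) < \<epsilon> * \<delta>"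
    using norm_upper_semicontinuous x unfolding continuous_on_topological by (metis mem_Collect_eq)
  obtain A2 where A2: "open A2" "x \<in> A2" "\<And>y. y \<in> S \<Longrightarrow> y \<in> A2 \<Longrightarrow> w y \<in> V"
    using w V x unfolding continuous_on_topological by metis
  have "coord (s y) / coord (w y) \<in> B" if y: "y \<in> S" "y \<in> A1 \<inter> A2" for y
  proof -
    have \<delta>: "\<delta> \<le> cmod (coord (w y))" using A2 V y by auto
    have "(coord (s y) / coord (w y) - c) * coord (w y) = coord (z y)"
      using nz[OF y(1)] by (simp add: cz y left_diff_distrib)
    then have "cmod (coord (s y) / coord (w y) - c) * cmod (coord (w y)) = fnorm E (z y)"
      by (simp add: cmod_coord[symmetric] flip: norm_mult)
    also have "\<dots> < \<epsilon> * \<delta>" using A1(3)[of y] y by auto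
    also have "\<dots> \<le> \<epsilon> * cmod (coord (w y))" using \<delta> \<epsilon>(1) by (intro mult_left_mono) auto
    finally have "coord (s y) / coord (w y) \<in> ball c \<epsilon>"
      using nz[OF y(1)] by (simp add: dist_norm norm_minus_commute)
    then show ?thesis using \<epsilon> by auto
  qed
  then show "\<exists>A. open A \<and> x \<in> A \<and> (\<forall>y\<in>S. y \<in> A \<longrightarrow> coord (s y) / coord (w y) \<in> B)"
    using A1 A2 by (intro exI[of _ "A1 \<inter> A2"]) auto
qed

subsection \<open>Units of the fibres over the unit space\<close>

lemma proj_fmul [simp]: "src (\<pi> e) = tgt (\<pi> f) \<Longrightarrow> \<pi> (fmul E e f) = \<pi> e \<star> \<pi> f"
  using proj_mul by (simp add: gcomposable_def)

lemma proj_fstar [simp]: "\<pi> (fstar E e) = opp (\<pi> e)"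
  by (rule proj_star)

lemma fmul_fscale_left [simp]:
    "src (\<pi> e) = tgt (\<pi> f) \<Longrightarrow> fmul E (fscale E c e) f = fscale E c (fmul E e f)"
  and fmul_fscale_right [simp]:
    "src (\<pi> e) = tgt (\<pi> f) \<Longrightarrow> fmul E e (fscale E c f) = fscale E c (fmul E e f)"
  using fmul_scale_left fmul_scale_right by (simp_all add: gcomposable_def)

lemma fmul_assoc':
  "src (\<pi> e) = tgt (\<pi> f) \<Longrightarrow> src (\<pi> f) = tgt (\<pi> k) \<Longrightarrow>
    fmul E (fmul E e f) k = fmul E e (fmul E f k)"
  using fmul_assoc by (simp add: gcomposable_def)

lemma fmul_fzero_left [simp]:
  "src g = tgt (\<pi> f) \<Longrightarrow> fmul E (fzero E g) f = fzero E (g \<star> \<pi> f)"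
  using fmul_fscale_left[of "fzero E g" f 0] by simp

lemma fmul_fzero_right [simp]:
  "src (\<pi> e) = tgt g \<Longrightarrow> fmul E e (fzero E g) = fzero E (\<pi> e \<star> g)"
  using fmul_fscale_right[of e "fzero E g" 0] by simp

lemma coord_fstar_mul:
  assumes "coord e \<noteq> 0"
  shows "coord (fmul E (fstar E e) e) \<noteq> 0"
  using assms norm_star_mul[of e] by (auto simp flip: cmod_coord)

definition fibre_unit :: "'g \<Rightarrow> 'e" where
  "fibre_unit x = (SOME e. \<pi> e = x \<and> coord e \<noteq> 0 \<and> fmul E e e = e)"

text \<open>
  For the chosen vector \<open>u\<close>, \<open>u u = \<kappa> \<cdot> u\<close>, and \<open>\<kappa>\<close> is not zero because \<open>u\<^sup>* u \<noteq> 0\<close> is a multiple of \<open>u u\<close>. So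
  \<open>u\<close> divided by \<open>\<kappa>\<close> is idempotent.
\<close>

lemma fibre_unit:
  assumes x: "x \<in> gunits G"
  shows "\<pi> (fibre_unit x) = x" "coord (fibre_unit x) \<noteq> 0"
    "fmul E (fibre_unit x) (fibre_unit x) = fibre_unit x"
proof -
  note x' = unit_simps[OF x] unit_mul_self[OF x] opp_unit[OF x]
  let ?u = "unit_vector x"
  define \<kappa> where "\<kappa> = coord (fmul E ?u ?u)"
  have uu: "fmul E ?u ?u = fscale E \<kappa> ?u" by (rule coord_eqI) (simp_all add: x' \<kappa>_def)
  have "\<kappa> \<noteq> 0"
  proof
    assume "\<kappa> = 0"
    obtain c where c: "fstar E ?u = fscale E c ?u" using fscale_unit_vector[of "fstar E ?u" x] x' by auto
    have "coord (fmul E (fstar E ?u) ?u) = 0"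
      unfolding c using uu \<open>\<kappa> = 0\<close> by (simp add: x')
    then show False using coord_fstar_mul[of ?u] cmod_coord[of ?u] by auto
  qed
  then have "\<pi> e = x \<and> coord e \<noteq> 0 \<and> fmul E e e = e" if "e = fscale E (1 / \<kappa>) ?u" for e
    using cmod_coord[of ?u] by (auto simp: that uu x')
  then have "\<pi> (fibre_unit x) = x \<and> coord (fibre_unit x) \<noteq> 0 \<and>
      fmul E (fibre_unit x) (fibre_unit x) = fibre_unit x"
    unfolding fibre_unit_def by (rule someI) simp
  then show "\<pi> (fibre_unit x) = x" "coord (fibre_unit x) \<noteq> 0"
    "fmul E (fibre_unit x) (fibre_unit x) = fibre_unit x" by auto
qed

lemma fibre_unit_multiple:
  assumes "x \<in> gunits G" "\<pi> e = x"
  shows "e = fscale E (coord e / coord (fibre_unit x)) (fibre_unit x)"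
  by (rule coord_eqI) (simp_all add: assms fibre_unit)

lemma fibre_idempotent:
  assumes x: "x \<in> gunits G" and e: "\<pi> e = x" "coord e \<noteq> 0" "fmul E e e = e"
  shows "e = fibre_unit x"
proof -
  note x' = unit_simps[OF x] unit_mul_self[OF x] fibre_unit[OF x]
  define c where "c = coord e / coord (fibre_unit x)"
  have ec: "e = fscale E c (fibre_unit x)" using fibre_unit_multiple[OF x e(1)] by (simp add: c_def)
  have "coord (fmul E e e) = c * c * coord (fibre_unit x)" by (simp add: ec x')
  moreover have "coord (fmul E e e) = c * coord (fibre_unit x)" using e(3) ec by (metis coord_fscale)
  moreover have "c \<noteq> 0" using e x' by (simp add: c_def)
  ultimately have "c = 1" using x' by simp
  then show ?thesis using ec by simp
qed

text \<open>
  The adjoint of the non-zero idempotent is another one, so the idempotent is self-adjoint and the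
  C*-identity gives it norm one.
\<close>

lemma cmod_coord_fibre_unit:
  assumes x: "x \<in> gunits G"
  shows "cmod (coord (fibre_unit x)) = 1"
proof -
  note x' = unit_simps[OF x] unit_mul_self[OF x] opp_unit[OF x] fibre_unit[OF x]
  let ?e = "fibre_unit x"
  have "fstar E ?e = ?e"
  proof (rule fibre_idempotent[OF x])
    show "coord (fstar E ?e) \<noteq> 0"
      using cmod_coord[of "fstar E ?e"] cmod_coord[of ?e] norm_star[of ?e] x' by auto
    show "fmul E (fstar E ?e) (fstar E ?e) = fstar E ?e"
      using star_mul[of ?e ?e] by (simp add: gcomposable_def x')
  qed (simp add: x')
  then have "fnorm E ?e = (fnorm E ?e)\<^sup>2" using norm_star_mul[of ?e] x' by simp
  moreover have "fnorm E ?e \<noteq> 0" using x' cmod_coord[of ?e] by auto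
  ultimately show ?thesis by (simp add: cmod_coord power2_eq_square)
qed

text \<open>
  Right multiplication by the idempotent is a scalar \<open>\<mu>\<close> with \<open>\<mu>\<^sup>2 = \<mu>\<close> on the fibre of \<open>e\<close>. It is not
  zero, since \<open>e\<^sup>* e\<close> is a non-zero multiple of the idempotent.
\<close>

lemma fmul_fibre_unit: "fmul E e (fibre_unit (src (\<pi> e))) = e"
proof (cases "coord e = 0")
  case True
  then have "e = fzero E (\<pi> e)" by (simp add: coord_eq_0_iff)
  then show ?thesis
    using fmul_fzero_left[of "\<pi> e" "fibre_unit (src (\<pi> e))"] by (simp add: fibre_unit)
next
  case False
  let ?x = "src (\<pi> e)"
  let ?i = "fibre_unit ?x"
  have i: "\<pi> ?i = ?x" "coord ?i \<noteq> 0" "fmul E ?i ?i = ?i" by (simp_all add: fibre_unit)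
  define \<mu> where "\<mu> = coord (fmul E e ?i) / coord e"
  have ei: "fmul E e ?i = fscale E \<mu> e"
    by (rule coord_eqI) (use False in \<open>simp_all add: \<mu>_def i\<close>)
  have "fscale E \<mu> (fmul E e ?i) = fmul E (fmul E e ?i) ?i" by (subst (2) ei) (simp add: i)
  also have "\<dots> = fmul E e ?i" by (simp add: fmul_assoc' i)
  finally have "\<mu> * \<mu> * coord e = \<mu> * coord e"
    unfolding ei by (metis coord_fscale mult.assoc)
  then have "\<mu> = 0 \<or> \<mu> = 1" using False by simp
  moreover have "\<mu> \<noteq> 0"
  proof
    assume "\<mu> = 0"
    let ?p = "fmul E (fstar E e) e"
    have p: "\<pi> ?p = ?x" by (simp add: opp_mul_self)
    have "fmul E ?p ?i = fmul E (fstar E e) (fmul E e ?i)" by (simp add: fmul_assoc' i)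
    also have "coord \<dots> = 0" using \<open>\<mu> = 0\<close> by (simp add: ei)
    finally have "coord (fmul E ?p ?i) = 0" .
    moreover have "fmul E ?p ?i = ?p"
      by (subst (1 2) fibre_unit_multiple[OF src_in_units p]) (simp add: i)
    ultimately show False using coord_fstar_mul[OF False] by simp
  qed
  ultimately show ?thesis using ei by simp
qed

text \<open>
  Multiplying \<open>e f\<close> by \<open>f\<^sup>*\<close> on the right gives a non-zero multiple of \<open>e\<close>.
\<close>

lemma coord_fmul_nonzero:
  assumes ef: "src (\<pi> e) = tgt (\<pi> f)" and "coord e \<noteq> 0" "coord f \<noteq> 0"
  shows "coord (fmul E e f) \<noteq> 0"
proof
  assume "coord (fmul E e f) = 0"
  then have 0: "fmul E e f = fzero E (\<pi> e \<star> \<pi> f)" using coord_eq_0_iff ef by simp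
  let ?x = "src (\<pi> e)" and ?q = "fmul E f (fstar E f)"
  have q: "\<pi> ?q = ?x" by (simp add: ef mul_opp_self)
  have "coord (fstar E f) \<noteq> 0"
    using assms(3) cmod_coord[of f] cmod_coord[of "fstar E f"] norm_star[of f] by auto
  then have "coord ?q \<noteq> 0" using coord_fstar_mul[of "fstar E f"] by (simp add: star_star)
  moreover have "coord (fmul E e ?q) = 0"
  proof -
    have "fmul E e ?q = fmul E (fmul E e f) (fstar E f)" by (simp add: fmul_assoc' ef)
    then show ?thesis using ef by (simp add: 0)
  qed
  moreover have "coord (fmul E e ?q) = coord ?q / coord (fibre_unit ?x) * coord e"
    by (subst (1) fibre_unit_multiple[OF src_in_units q]) (simp add: fibre_unit fmul_fibre_unit)
  ultimately show False using assms(2) fibre_unit(2)[of ?x] by simp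
qed

text \<open>
  The projection being open, every fibre near \<open>x\<close> contains an element close to \<open>fibre_unit x\<close>. This
  element is nearly idempotent and its norm is bounded below, so it is close to the unit of its fibre.
\<close>

lemma continuous_fibre_unit: "continuous_on (gunits G) fibre_unit"
  unfolding continuous_on_topological
proof (intro ballI allI impI)
  fix x B assume x: "x \<in> gunits G" and B: "open B" "fibre_unit x \<in> B"
  let ?U = "\<pi> -` gunits G"
  have U: "open ?U" using open_units proj_continuous by (simp add: continuous_on_open_vimage)
  obtain V \<epsilon> where V: "open V" "fibre_unit x \<in> V" "\<epsilon> > 0"
      "\<And>f f'. f \<in> V \<Longrightarrow> \<pi> f' = \<pi> f \<Longrightarrow> cmod (coord f' - coord f) < \<epsilon> \<Longrightarrow> f' \<in> B"
    using perturbation_neighbourhood[OF B] by metis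
  obtain V1 \<delta> where V1: "open V1" "fibre_unit x \<in> V1" "\<delta> > 0" "\<And>f. f \<in> V1 \<Longrightarrow> \<delta> \<le> cmod (coord f)"
    using coord_bounded_below[OF fibre_unit(2)[OF x]] by metis
  define q where "q f = fadd E (fmul E f f) (fscale E (-1) f)" for f
  have "continuous_on ?U q"
    unfolding q_def
    by (intro continuous_on_fadd continuous_on_fscale_const continuous_on_fmul continuous_on_id)
       (auto simp: unit_simps unit_mul_self)
  then have V2: "open {f \<in> ?U. fnorm E (q f) < \<epsilon> * \<delta>}" using U by (rule open_fnorm_less)
  let ?V = "V \<inter> V1 \<inter> {f \<in> ?U. fnorm E (q f) < \<epsilon> * \<delta>}"
  have "open (\<pi> ` ?V)" using V V1 V2 proj_open by (simp add: open_Int)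
  moreover have "x \<in> \<pi> ` ?V"
  proof -
    have "coord (q (fibre_unit x)) = 0"
      using x by (simp add: q_def fibre_unit)
    then have "fibre_unit x \<in> ?V" using V V1 x by (simp add: fibre_unit flip: cmod_coord)
    then show ?thesis by (rule image_eqI[rotated]) (use fibre_unit(1)[OF x] in simp)
  qed
  moreover have "fibre_unit y \<in> B" if y: "y \<in> \<pi> ` ?V" for y
  proof -
    obtain f where f: "f \<in> ?V" "\<pi> f = y" using y by auto
    then have yu: "y \<in> gunits G" by auto
    note y' = unit_simps[OF yu] unit_mul_self[OF yu] fibre_unit[OF yu] cmod_coord_fibre_unit[OF yu]
    define c where "c = coord f / coord (fibre_unit y)"
    have fc: "f = fscale E c (fibre_unit y)" using fibre_unit_multiple[OF yu f(2)] by (simp add: c_def)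
    have nf: "cmod (coord f) = cmod c" by (simp add: fc y' norm_mult)
    have "coord (q f) = c * (c - 1) * coord (fibre_unit y)"
      by (simp add: q_def fc y' algebra_simps)
    then have "cmod c * cmod (c - 1) < \<epsilon> * \<delta>"
      using f(1) by (simp add: norm_mult y' flip: cmod_coord)
    moreover have "\<delta> * cmod (c - 1) \<le> cmod c * cmod (c - 1)"
      using f(1) V1(4)[of f] nf by (intro mult_right_mono) auto
    ultimately have "\<delta> * cmod (c - 1) < \<delta> * \<epsilon>" by (simp add: mult.commute)
    then have "cmod (c - 1) < \<epsilon>" using V1(3) by simp
    moreover have "coord (fibre_unit y) - coord f = (1 - c) * coord (fibre_unit y)"
      by (simp add: fc algebra_simps)
    ultimately have "cmod (coord (fibre_unit y) - coord f) < \<epsilon>"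
      by (simp add: norm_mult y' norm_minus_commute)
    then show ?thesis using V(4)[of f "fibre_unit y"] f y' by simp
  qed
  ultimately show "\<exists>A. open A \<and> x \<in> A \<and> (\<forall>y\<in>gunits G. y \<in> A \<longrightarrow> fibre_unit y \<in> B)" by blast
qed

text \<open>
  The axioms make the norm upper semicontinuous only. But \<open>e\<^sup>* e\<close> is a multiple of the unit of its
  fibre by a factor of absolute value \<open>\<parallel>e\<parallel>\<^sup>2\<close>, and this factor is continuous in \<open>e\<close> as a quotient of
  continuous sections.
\<close>

lemma continuous_fnorm: "continuous_on UNIV (fnorm E)"
proof -
  let ?c = "\<lambda>e. coord (fmul E (fstar E e) e) / coord (fibre_unit (src (\<pi> e)))"
  have "continuous_on UNIV ?c"
  proof (rule continuous_on_coord_quotient)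
    show "continuous_on UNIV (\<lambda>e. fmul E (fstar E e) e)"
      by (intro continuous_on_fmul continuous_on_fstar continuous_on_id) simp
    show "continuous_on UNIV (\<lambda>e. fibre_unit (src (\<pi> e)))"
      by (rule continuous_on_compose2[OF continuous_fibre_unit])
         (auto intro!: continuous_on_src proj_continuous)
  qed (simp_all add: fibre_unit opp_mul_self)
  then have "continuous_on UNIV (\<lambda>e. sqrt (cmod (?c e)))"
    by (intro continuous_on_real_sqrt continuous_on_norm)
  moreover have "sqrt (cmod (?c e)) = fnorm E e" for e
    by (simp add: norm_divide cmod_coord_fibre_unit[unfolded cmod_coord] norm_star_mul
        norm_nonneg cmod_coord)
  ultimately show ?thesis by simp
qed

lemma continuous_on_fnorm: "continuous_on S s \<Longrightarrow> continuous_on S (\<lambda>x. fnorm E (s x))"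
  using continuous_on_compose2[OF continuous_fnorm] by blast


section \<open>Local sections\<close>

text \<open>
  Normalization is continuous on the non-zero elements and preserves fibres, so the image is also
  that of an open set of non-zero elements.
\<close>

lemma open_proj_sphere:
  assumes "open A"
  shows "open (\<pi> ` {e \<in> A. fnorm E e = 1})"
proof -
  let ?N = "{e. coord e \<noteq> 0}"
  let ?n = "\<lambda>e. fscale E (of_real (1 / fnorm E e)) e"
  have pos: "fnorm E e \<noteq> 0" if "coord e \<noteq> 0" for e
    using that by (simp flip: cmod_coord)
  have "continuous_on ?N ?n"
    by (intro continuous_on_fscale continuous_intros continuous_on_fnorm) (use pos in auto)
  then have "open (?n -` A \<inter> ?N)"
    using assms open_nonzero continuous_on_open_vimage by blast
  then have "open (\<pi> ` (?n -` A \<inter> ?N))" by (rule proj_open)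
  also have "\<pi> ` (?n -` A \<inter> ?N) = \<pi> ` {e \<in> A. fnorm E e = 1}"
  proof (intro equalityI subsetI)
    fix x assume "x \<in> \<pi> ` (?n -` A \<inter> ?N)"
    then obtain e where "x = \<pi> e" "coord e \<noteq> 0" "?n e \<in> A" by auto
    moreover have "fnorm E (?n e) = 1" using pos[OF calculation(2)] norm_nonneg[of e]
      by (simp add: norm_scale norm_divide)
    ultimately show "x \<in> \<pi> ` {e \<in> A. fnorm E e = 1}"
      by (intro image_eqI[of _ _ "?n e"]) simp_all
  next
    fix x assume "x \<in> \<pi> ` {e \<in> A. fnorm E e = 1}"
    then obtain e where "x = \<pi> e" "e \<in> A" "fnorm E e = 1" by auto
    moreover have "coord e \<noteq> 0" using calculation(3) cmod_coord[of e] by auto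
    ultimately show "x \<in> \<pi> ` (?n -` A \<inter> ?N)" by (intro image_eqI[of _ _ e]) auto
  qed
  finally show ?thesis .
qed

definition sphere_over :: "'g set \<Rightarrow> 'e set" where
  "sphere_over K = {e. \<pi> e \<in> K \<and> fnorm E e = 1}"

lemma same_circle:
  assumes "\<pi> e = \<pi> f" "fnorm E e = 1" "fnorm E f = 1"
  obtains \<theta> where "e = fscale E (cis \<theta>) f" "0 \<le> \<theta>" "\<theta> \<le> 2 * pi"
proof -
  have nz: "coord f \<noteq> 0" using assms(3) cmod_coord[of f] by auto
  define t where "t = coord e / coord f"
  have "cmod t = 1" by (simp add: t_def norm_divide cmod_coord assms)
  then have "t = cis (Arg2pi t)" using Arg2pi_eq[of t] by (simp add: cis_conv_exp)
  moreover have "e = fscale E t f" by (rule coord_eqI) (use assms nz in \<open>simp_all add: t_def\<close>)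
  ultimately show thesis
    using that[of "Arg2pi t"] Arg2pi_ge_0[of t] Arg2pi_lt_2pi[of t] by simp
qed

text \<open>
  The circle over each point is compact, and by the tube lemma a neighbourhood of it contains the
  circles over all nearby points. So a finite cover of one circle covers those over a whole
  neighbourhood, and finitely many such neighbourhoods cover \<open>K\<close>.
\<close>

lemma compact_sphere_over:
  assumes "compact K"
  shows "compact (sphere_over K)"
proof (rule compactI)
  fix C assume C: "\<forall>t\<in>C. open t" "sphere_over K \<subseteq> \<Union>C"
  have "\<exists>D V. D \<subseteq> C \<and> finite D \<and> open V \<and> h \<in> V \<and> sphere_over V \<subseteq> \<Union>D" if h: "h \<in> K" for h
  proof -
    let ?circle = "(\<lambda>t. fscale E t (unit_vector h)) ` sphere 0 1"
    have "compact ?circle"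
      by (intro compact_continuous_image continuous_on_fscale continuous_on_id continuous_on_const)
         simp
    moreover have "?circle \<subseteq> \<Union>C"
      using C(2) h by (auto simp: sphere_over_def norm_scale dest!: subsetD)
    ultimately obtain D where D: "D \<subseteq> C" "finite D" "?circle \<subseteq> \<Union>D"
      using C(1) by (meson compactE)
    have "continuous_on UNIV (\<lambda>x. fscale E (snd x) (fst x))"
      by (intro continuous_on_fscale continuous_intros)
    then have "open ((\<lambda>x. fscale E (snd x) (fst x)) -` \<Union>D)"
      using C(1) D(1) by (subst (asm) continuous_on_open_vimage) (auto intro!: open_Union)
    moreover have "{unit_vector h} \<times> sphere 0 1 \<subseteq> (\<lambda>x. fscale E (snd x) (fst x)) -` \<Union>D"
      using D(3) unfolding image_subset_iff by auto
    ultimately obtain A where A: "unit_vector h \<in> A" "open A"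
      "A \<times> sphere 0 1 \<subseteq> (\<lambda>x. fscale E (snd x) (fst x)) -` \<Union>D"
      using Elementary_Topology.tube_lemma[of "sphere (0::complex) 1"
        "(\<lambda>x. fscale E (snd x) (fst x)) -` \<Union>D" "unit_vector h"] by auto
    let ?V = "\<pi> ` {e \<in> A. fnorm E e = 1}"
    have "sphere_over ?V \<subseteq> \<Union>D"
    proof
      fix e assume "e \<in> sphere_over ?V"
      then obtain f where f: "f \<in> A" "fnorm E f = 1" "\<pi> e = \<pi> f" "fnorm E e = 1"
        by (auto simp: sphere_over_def)
      obtain \<theta> where "e = fscale E (cis \<theta>) f" using same_circle[OF f(3,4,2)] by metis
      moreover have "(f, cis \<theta>) \<in> A \<times> sphere 0 1" using f by simp
      ultimately show "e \<in> \<Union>D" using subsetD[OF A(3), of "(f, cis \<theta>)"] by simp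
    qed
    moreover have "h \<in> ?V" using A(1) by (intro image_eqI[of _ _ "unit_vector h"]) simp_all
    ultimately show ?thesis using D open_proj_sphere[OF A(2)] by blast
  qed
  then obtain D V where DV: "\<And>h. h \<in> K \<Longrightarrow> D h \<subseteq> C \<and> finite (D h) \<and> open (V h) \<and> h \<in> V h \<and>
      sphere_over (V h) \<subseteq> \<Union>(D h)"
    by metis
  obtain F where F: "F \<subseteq> K" "finite F" "K \<subseteq> (\<Union>h\<in>F. V h)"
    using compactE_image[OF assms, of K V] DV by (metis UN_I subsetI)
  have "(\<Union>h\<in>F. D h) \<subseteq> C" "finite (\<Union>h\<in>F. D h)" using DV F by blast+
  moreover have "sphere_over K \<subseteq> \<Union>(\<Union>h\<in>F. D h)"
  proof
    fix e assume e: "e \<in> sphere_over K"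
    then obtain h where h: "h \<in> F" "\<pi> e \<in> V h" using F(3) by (auto simp: sphere_over_def)
    then have "e \<in> sphere_over (V h)" using e by (simp add: sphere_over_def)
    then show "e \<in> \<Union>(\<Union>h\<in>F. D h)" using DV[of h] h F(1) by blast
  qed
  ultimately show "\<exists>C'\<subseteq>C. finite C' \<and> sphere_over K \<subseteq> \<Union>C'" by blast
qed

lemma normal_sphere_over:
  assumes "compact K"
  shows "normal_space (top_of_set (sphere_over K))"
proof (rule compact_Hausdorff_or_regular_imp_normal_space)
  show "compact_space (top_of_set (sphere_over K))"
    using compact_sphere_over[OF assms] by (simp add: compact_space_subtopology)
  have "Hausdorff_space (euclidean :: 'e topology)"
    unfolding Hausdorff_space_def disjnt_def by (metis Hausdorff_total open_openin)
  then show "Hausdorff_space (top_of_set (sphere_over K)) \<or> regular_space (top_of_set (sphere_over K))"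
    by (simp add: Hausdorff_space_subtopology)
qed

end

lemma integral_periodic_shift:
  fixes p :: "real \<Rightarrow> 'a::banach"
  assumes cont: "continuous_on UNIV p" and per: "\<And>t. p (t + T) = p t" and a: "0 \<le> a" "a \<le> T"
  shows "integral {0..T} (\<lambda>t. p (t + a)) = integral {0..T} p"
proof -
  have int: "p integrable_on {x..y}" for x y
    using cont by (intro integrable_continuous_interval) (auto intro: continuous_on_subset)
  have "integral {0..T} (\<lambda>t. p (t + a)) = integral {a..T + a} p"
    using integral_shift_Icc_real[of 0 T p a] by (simp add: comp_def add.commute)
  also have "\<dots> = integral {a..T} p + integral {T..T + a} p"
    using a by (subst Henstock_Kurzweil_Integration.integral_combine[OF _ _ int]) auto
  also have "integral {T..T + a} p = integral {0..a} p"
    using integral_shift_Icc_real[of 0 a p T] per by (simp add: comp_def add.commute)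
  also have "integral {a..T} p + integral {0..a} p = integral {0..T} p"
    using Henstock_Kurzweil_Integration.integral_combine[OF a int] by (simp add: add.commute)
  finally show ?thesis .
qed

context hausdorff_fell_line_bundle
begin

text \<open>
  Over a compact neighbourhood \<open>K\<close> of \<open>g\<close>, Urysohn's lemma gives a bump function \<open>\<psi>\<close> on the sphere
  bundle, concentrated near a chosen unit vector \<open>e\<close> over \<open>g\<close>. Averaging it against \<open>cis (- \<theta>)\<close> over
  the circle action gives a continuous \<open>\<phi>\<close> with \<open>\<phi> (t \<cdot> f) = t * \<phi> f\<close> for \<open>t\<close> of modulus one. Then
  \<open>cnj (\<phi> f) \<cdot> f\<close> is the same for all \<open>f\<close> of norm one in a fibre, and this common value is the section.
\<close>

theorem local_section:
  obtains V w where "open V" "g \<in> V" "\<And>h. \<pi> (w h) = h" "continuous_on V w"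
    "\<And>h. h \<in> V \<Longrightarrow> coord (w h) \<noteq> 0"
proof -
  obtain O' K where K: "open O'" "compact K" "g \<in> O'" "O' \<subseteq> K"
    using compact_neighbourhood[of UNIV g] by auto
  let ?S = "sphere_over K"
  define e where "e = unit_vector g"
  have e: "e \<in> ?S" "coord e = 1" "\<pi> e = g" using K by (auto simp: e_def sphere_over_def)
  have scale_sphere: "fscale E t f \<in> ?S" if "f \<in> ?S" "cmod t = 1" for t f
    using that by (simp add: sphere_over_def norm_scale)
  \<comment> \<open>Where \<open>cos \<theta> \<le> 0\<close> the bump has to vanish at \<open>cis \<theta> \<cdot> e\<close>, so that the average at \<open>e\<close> has positive
    real part.\<close>
  define N where "N = (\<lambda>t. fscale E t e) ` {t \<in> sphere 0 1. Re t \<le> 0}"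
  have "compact {t \<in> sphere (0::complex) 1. Re t \<le> 0}"
  proof -
    have "closed {t. Re t \<le> 0}" by (intro closed_Collect_le continuous_intros)
    then have "compact (sphere (0::complex) 1 \<inter> {t. Re t \<le> 0})" by (intro compact_Int_closed) simp_all
    then show ?thesis by (simp add: Int_def)
  qed
  then have "compact N"
    unfolding N_def
    by (intro compact_continuous_image continuous_on_fscale continuous_on_id continuous_on_const)
  have NS: "N \<subseteq> ?S" unfolding N_def using scale_sphere[OF e(1)] by auto
  have haus: "Hausdorff_space (top_of_set ?S)"
    unfolding Hausdorff_space_def disjnt_def
    by (metis (no_types, lifting) Hausdorff_total Hausdorff_space_def Hausdorff_space_subtopology
        disjnt_def open_openin)
  have "closedin (top_of_set ?S) N" "closedin (top_of_set ?S) {e}"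
    using \<open>compact N\<close> NS e(1)
    by (auto intro!: compactin_imp_closedin[OF haus] simp: compactin_subtopology)
  moreover have "disjnt N {e}"
  proof -
    have "fscale E t e \<noteq> e" if "Re t \<le> 0" for t
    proof
      assume "fscale E t e = e"
      then have "coord (fscale E t e) = coord e" by simp
      then show False using that e(2) by simp
    qed
    then show ?thesis unfolding N_def by (auto simp: disjnt_def) metis
  qed
  ultimately obtain \<psi> :: "'e \<Rightarrow> real" where \<psi>: "continuous_map (top_of_set ?S) (top_of_set {0..1}) \<psi>"
    "\<psi> ` N \<subseteq> {0}" "\<psi> ` {e} \<subseteq> {1}"
    using normal_sphere_over[OF K(2)] unfolding normal_space_iff_Urysohn by metis
  then have \<psi>c: "continuous_on ?S \<psi>" and \<psi>0: "\<And>f. f \<in> ?S \<Longrightarrow> 0 \<le> \<psi> f"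
    by (auto simp: continuous_map_in_subtopology image_subset_iff Pi_iff)
  define p where "p f \<theta> = cis (- \<theta>) * complex_of_real (\<psi> (fscale E (cis \<theta>) f))" for f \<theta>
  have pc: "continuous_on (?S \<times> UNIV) (\<lambda>(f, \<theta>). p f \<theta>)"
  proof -
    have "continuous_on (?S \<times> UNIV) (\<lambda>x. \<psi> (fscale E (cis (snd x)) (fst x)))"
      by (rule continuous_on_compose2[OF \<psi>c])
         (auto intro!: continuous_on_fscale continuous_intros scale_sphere)
    then show ?thesis
      unfolding p_def case_prod_unfold by (intro continuous_intros)
  qed
  have pc1: "continuous_on S (p f)" if "f \<in> ?S" for f S
  proof -
    have "continuous_on S (\<lambda>\<theta>. (\<lambda>(f, \<theta>). p f \<theta>) (f, \<theta>))"
      by (rule continuous_on_compose2[OF pc]) (use that in \<open>auto intro!: continuous_intros\<close>)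
    then show ?thesis by simp
  qed
  define \<phi> where "\<phi> f = integral {0..2 * pi} (p f)" for f
  have "continuous_on ?S (\<lambda>f. integral (cbox 0 (2 * pi)) (p f))"
    by (rule integral_continuous_on_param) (rule continuous_on_subset[OF pc], auto)
  then have \<phi>c: "continuous_on ?S \<phi>" by (simp add: \<phi>_def[abs_def])
  have \<phi>_equivariant: "\<phi> (fscale E (cis \<alpha>) f) = cis \<alpha> * \<phi> f"
    if f: "f \<in> ?S" and \<alpha>: "0 \<le> \<alpha>" "\<alpha> \<le> 2 * pi" for f \<alpha>
  proof -
    have "p (fscale E (cis \<alpha>) f) = (\<lambda>\<theta>. cis \<alpha> * p f (\<theta> + \<alpha>))"
      by (simp add: p_def cis_mult fun_eq_iff)
    then have "\<phi> (fscale E (cis \<alpha>) f) = cis \<alpha> * integral {0..2 * pi} (\<lambda>\<theta>. p f (\<theta> + \<alpha>))"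
      by (simp add: \<phi>_def)
    also have "integral {0..2 * pi} (\<lambda>\<theta>. p f (\<theta> + \<alpha>)) = \<phi> f"
    proof -
      have "cis (\<theta> + 2 * pi) = cis \<theta>" for \<theta> by (simp add: complex_eq_iff)
      then have "p f (\<theta> + 2 * pi) = p f \<theta>" for \<theta> by (simp only: p_def flip: cis_cnj)
      then show ?thesis
        unfolding \<phi>_def by (intro integral_periodic_shift pc1 f \<alpha>)
    qed
    finally show ?thesis .
  qed
  have \<phi>e: "\<phi> e \<noteq> 0"
  proof
    assume "\<phi> e = 0"
    have "p e integrable_on {0..2 * pi}" by (intro integrable_continuous_interval pc1 e)
    then have "integral {0..2 * pi} (\<lambda>\<theta>. Re (p e \<theta>)) = 0"
      using \<open>\<phi> e = 0\<close> integral_linear[OF _ bounded_linear_Re, of "p e" "{0..2 * pi}"]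
      by (simp add: \<phi>_def comp_def)
    moreover have "continuous_on {0..2 * pi} (\<lambda>\<theta>. Re (p e \<theta>))"
      by (intro continuous_intros pc1 e)
    moreover have "0 \<le> Re (p e \<theta>)" for \<theta>
    proof (cases "cos \<theta> \<le> 0")
      case True
      then have "fscale E (cis \<theta>) e \<in> N" unfolding N_def by (intro imageI) simp
      then show ?thesis using \<psi>(2) by (auto simp: p_def)
    next
      case False
      then show ?thesis using \<psi>0[OF scale_sphere[OF e(1), of "cis \<theta>"]] by (simp add: p_def)
    qed
    ultimately have "Re (p e 0) = 0"
      using integral_eq_0_iff[of 0 "2 * pi" "\<lambda>\<theta>. Re (p e \<theta>)"] by simp
    then show False using \<psi>(3) by (simp add: p_def)
  qed
  define v where "v f = fscale E (cnj (\<phi> f)) f" for f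
  have vc: "continuous_on ?S v"
    unfolding v_def by (intro continuous_on_fscale continuous_intros \<phi>c)
  have v_eq: "v f = v f'" if ff': "f \<in> ?S" "f' \<in> ?S" "\<pi> f = \<pi> f'" for f f'
  proof -
    obtain \<theta> where \<theta>: "f = fscale E (cis \<theta>) f'" "0 \<le> \<theta>" "\<theta> \<le> 2 * pi"
      using same_circle ff' unfolding sphere_over_def by blast
    have "cnj (cis \<theta> * \<phi> f') * cis \<theta> = (cnj (cis \<theta>) * cis \<theta>) * cnj (\<phi> f')" by simp
    also have "cnj (cis \<theta>) * cis \<theta> = 1" by (simp add: cis_cnj cis_mult)
    finally show ?thesis
      by (simp only: v_def \<theta>(1) \<phi>_equivariant[OF ff'(2) \<theta>(2,3)] fscale_fscale mult_1_left)
  qed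
  define w where "w h = v (unit_vector h)" for h
  have pw: "\<pi> (w h) = h" for h by (simp add: w_def v_def)
  have wc: "continuous_on O' w"
    unfolding continuous_on_topological
  proof (intro ballI allI impI)
    fix h B assume h: "h \<in> O'" and B: "open B" "w h \<in> B"
    have "unit_vector h \<in> ?S" using h K by (auto simp: sphere_over_def)
    then obtain A where A: "open A" "unit_vector h \<in> A" "\<And>f. f \<in> ?S \<Longrightarrow> f \<in> A \<Longrightarrow> v f \<in> B"
      using vc B unfolding continuous_on_topological w_def by metis
    have "w y \<in> B" if y: "y \<in> O'" "y \<in> \<pi> ` {e \<in> A. fnorm E e = 1}" for y
    proof -
      obtain f where f: "f \<in> A" "fnorm E f = 1" "\<pi> f = y" using y by auto
      then have "f \<in> ?S" "unit_vector y \<in> ?S" using y K by (auto simp: sphere_over_def)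
      then have "w y = v f" unfolding w_def using f by (intro v_eq) simp_all
      then show ?thesis using A f \<open>f \<in> ?S\<close> by simp
    qed
    moreover have "h \<in> \<pi> ` {e \<in> A. fnorm E e = 1}"
      using A(2) by (intro image_eqI[of _ _ "unit_vector h"]) simp_all
    ultimately show "\<exists>A. open A \<and> h \<in> A \<and> (\<forall>y\<in>O'. y \<in> A \<longrightarrow> w y \<in> B)"
      using open_proj_sphere[OF A(1)] by blast
  qed
  show thesis
  proof (rule that[of "{h \<in> O'. coord (w h) \<noteq> 0}" w])
    show "open {h \<in> O'. coord (w h) \<noteq> 0}" by (rule open_section_nonzero[OF wc K(1)])
    show "g \<in> {h \<in> O'. coord (w h) \<noteq> 0}" using K(3) \<phi>e by (simp add: w_def v_def flip: e_def)
    show "continuous_on {h \<in> O'. coord (w h) \<noteq> 0} w" by (rule continuous_on_subset[OF wc]) auto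
  qed (use pw in auto)
qed

end


section \<open>Compactly supported sections\<close>

context hausdorff_fell_line_bundle
begin

lemma continuous_fzero: "continuous_on S (fzero E)"
  unfolding continuous_on_topological
proof (intro ballI allI impI)
  fix x B assume "x \<in> S" "open B" "fzero E x \<in> B"
  then obtain \<epsilon> U where "\<epsilon> > 0" "open U" "x \<in> U" "{f \<in> \<pi> -` U. fnorm E f < \<epsilon>} \<subseteq> B"
    using zero_neighbourhoods[of B x] by blast
  then show "\<exists>A. open A \<and> x \<in> A \<and> (\<forall>y\<in>S. y \<in> A \<longrightarrow> fzero E y \<in> B)"
    by (intro exI[of _ U]) auto
qed

lemma Cc_onD:
  assumes "s \<in> Cc_on E U"
  shows "\<pi> (s g) = g" "continuous_on S s" "compact (section_support E s)" "section_support E s \<subseteq> U"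
    "closed (section_support E s)" "g \<notin> section_support E s \<Longrightarrow> s g = fzero E g"
proof -
  show "\<pi> (s g) = g" "continuous_on S s" "compact (section_support E s)" "section_support E s \<subseteq> U"
    using assms continuous_on_subset[of UNIV s] by (auto simp: Cc_on_def)
  show "closed (section_support E s)" by (simp add: section_support_def)
  show "g \<notin> section_support E s \<Longrightarrow> s g = fzero E g"
    unfolding section_support_def using closure_subset[of "{g. s g \<noteq> fzero E g}"] by blast
qed

lemma Cc_on_outside: "s \<in> Cc_on E U \<Longrightarrow> g \<notin> U \<Longrightarrow> s g = fzero E g"
  using Cc_onD(4,6) by blast

lemma Cc_onI:
  assumes p: "\<And>g. \<pi> (s g) = g" and W: "open W" "continuous_on W s"
    and K: "compact K" "K \<subseteq> W" "K \<subseteq> U" "\<And>g. g \<notin> K \<Longrightarrow> s g = fzero E g"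
  shows "s \<in> Cc_on E U"
proof -
  have "closed K" using K(1) by (rule compact_imp_closed)
  have "continuous_on (- K) s"
    using continuous_fzero by (rule continuous_on_eq) (simp add: K)
  then have "continuous_on (W \<union> - K) s"
    using W \<open>closed K\<close> by (intro continuous_on_open_Un) auto
  moreover have "W \<union> - K = UNIV" using K by auto
  moreover have sub: "section_support E s \<subseteq> K"
    unfolding section_support_def using K \<open>closed K\<close> by (intro closure_minimal) auto
  moreover have "compact (section_support E s)"
    using compact_Int_closed[OF K(1), of "section_support E s"] sub
    by (simp add: section_support_def Int_absorb1)
  ultimately show ?thesis using p K(3) by (auto simp: Cc_on_def)
qed

lemma Cc_on_mono: "U \<subseteq> V \<Longrightarrow> Cc_on E U \<subseteq> Cc_on E V"
  by (auto simp: Cc_on_def)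

lemma Cc_on_Cc: "s \<in> Cc_on E U \<Longrightarrow> s \<in> Cc E"
  using Cc_on_mono[of U UNIV] by auto

lemma sadd_Cc_on:
  assumes s: "s \<in> Cc_on E U" and t: "t \<in> Cc_on E U"
  shows "sadd E s t \<in> Cc_on E U"
  unfolding sadd_def
proof (rule Cc_onI[where K = "section_support E s \<union> section_support E t" and W = UNIV])
  show "continuous_on UNIV (\<lambda>g. fadd E (s g) (t g))"
    using Cc_onD(1,2)[OF s] Cc_onD(1,2)[OF t] by (intro continuous_on_fadd) simp_all
  show "fadd E (s g) (t g) = fzero E g" if "g \<notin> section_support E s \<union> section_support E t" for g
    using that Cc_onD(6)[OF s] Cc_onD(6)[OF t] fadd_fzero[of "fzero E g"] by simp
qed (use Cc_onD[OF s] Cc_onD[OF t] in \<open>auto intro: compact_Un\<close>)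

lemma fscale_Cc_on:
  assumes s: "s \<in> Cc_on E U" and f: "continuous_on UNIV f"
    and K: "closure {x. f x \<noteq> 0} \<subseteq> V"
  shows "(\<lambda>g. fscale E (f g) (s g)) \<in> Cc_on E (V \<inter> U)"
proof (rule Cc_onI[where K = "closure {x. f x \<noteq> 0} \<inter> section_support E s" and W = UNIV])
  show "continuous_on UNIV (\<lambda>g. fscale E (f g) (s g))"
    by (intro continuous_on_fscale f Cc_onD(2)[OF s])
  show "compact (closure {x. f x \<noteq> 0} \<inter> section_support E s)"
    using Cc_onD(3)[OF s] by (simp add: closed_Int_compact)
  show "fscale E (f g) (s g) = fzero E g" if "g \<notin> closure {x. f x \<noteq> 0} \<inter> section_support E s" for g
  proof (cases "f g = 0")
    case False
    then have "g \<in> closure {x. f x \<noteq> 0}" using closure_subset[of "{x. f x \<noteq> 0}"] by blast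
    then show ?thesis using that Cc_onD(6)[OF s, of g] by simp
  qed (use Cc_onD(1)[OF s] in simp)
qed (use Cc_onD[OF s] K in auto)

lemma sscale_Cc_on: "s \<in> Cc_on E U \<Longrightarrow> sscale E c s \<in> Cc_on E U"
  using fscale_Cc_on[of s U "\<lambda>_. c" UNIV] by (simp add: sscale_def)

lemma bdd_above_fnorm:
  assumes s: "s \<in> Cc E"
  shows "bdd_above (range (\<lambda>g. fnorm E (s g)))"
proof -
  have "compact ((\<lambda>g. fnorm E (s g)) ` section_support E s)"
    by (intro compact_continuous_image continuous_on_fnorm Cc_onD[OF s])
  then have "bdd_above (insert 0 ((\<lambda>g. fnorm E (s g)) ` section_support E s))"
    by (simp add: bounded_imp_bdd_above compact_imp_bounded)
  moreover have "range (\<lambda>g. fnorm E (s g)) \<subseteq> insert 0 ((\<lambda>g. fnorm E (s g)) ` section_support E s)"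
    using Cc_onD(6)[OF s] by force
  ultimately show ?thesis by (rule bdd_above_mono)
qed

text \<open>
  A local section, cut off near \<open>g\<close>.
\<close>

lemma section_at:
  assumes "open U" "g \<in> U"
  obtains B s where "B \<in> local_bisections G" "g \<in> B" "B \<subseteq> U" "s \<in> Cc_on E B" "coord (s g) \<noteq> 0"
proof -
  obtain V w where w: "open V" "g \<in> V" "\<And>h. \<pi> (w h) = h" "continuous_on V w"
    "\<And>h. h \<in> V \<Longrightarrow> coord (w h) \<noteq> 0"
    using local_section by metis
  obtain B where B: "B \<in> local_bisections G" "g \<in> B" "B \<subseteq> U" using bisection_base assms by metis
  have BV: "open (B \<inter> V)" "g \<in> B \<inter> V"
    using w(1,2) B(2) bisectionD(1)[OF B(1)] by (simp_all add: open_Int)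
  obtain f :: "'g \<Rightarrow> real" and O' where f: "continuous_on UNIV f" "open O'" "g \<in> O'"
    "\<And>x. x \<in> O' \<Longrightarrow> f x = 1" "compact (closure {x. f x \<noteq> 0})" "closure {x. f x \<noteq> 0} \<subseteq> B \<inter> V"
    by (rule cutoff_function[OF BV]) (rule that)
  let ?s = "\<lambda>h. fscale E (complex_of_real (f h)) (w h)"
  have "?s \<in> Cc_on E B"
  proof (rule Cc_onI[OF _ w(1) _ f(5)])
    show "continuous_on V ?s"
      by (intro continuous_on_fscale w continuous_on_of_real continuous_on_subset[OF f(1)]) simp
    show "?s h = fzero E h" if "h \<notin> closure {x. f x \<noteq> 0}" for h
    proof -
      have "f h = 0" using that closure_subset[of "{x. f x \<noteq> 0}"] by auto
      then show ?thesis by (simp add: w)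
    qed
  qed (use f w in auto)
  then show thesis using that B f w by simp
qed

subsection \<open>Convolution and involution of sections on local bisections\<close>

lemma compact_set_mul:
  assumes "compact K" "compact L"
  shows "compact (set_mul G K L)"
proof -
  have "closed {x. src (fst x) = tgt (snd x)}"
    by (intro closed_Collect_eq continuous_on_src continuous_on_tgt continuous_intros)
  then have "compact ((K \<times> L) \<inter> {x. src (fst x) = tgt (snd x)})"
    using assms by (intro compact_Int_closed compact_Times)
  then have "compact ((\<lambda>x. fst x \<star> snd x) ` ((K \<times> L) \<inter> {x. src (fst x) = tgt (snd x)}))"
    by (intro compact_continuous_image continuous_on_mul continuous_intros) auto
  also have "(\<lambda>x. fst x \<star> snd x) ` ((K \<times> L) \<inter> {x. src (fst x) = tgt (snd x)}) = set_mul G K L"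
    by (force simp: set_mul_def)
  finally show ?thesis .
qed

lemma factors_unique:
  assumes A: "A \<in> local_bisections G" and B: "B \<in> local_bisections G"
    and "h \<in> A" "k \<in> B" "src h = tgt k" "h' \<in> A" "k' \<in> B" "src h' = tgt k'" "h \<star> k = h' \<star> k'"
  shows "h' = h" "k' = k"
proof -
  have "src k = src k'" "tgt h = tgt h'"
    using assms src_mul[of h k] src_mul[of h' k'] tgt_mul[of h k] tgt_mul[of h' k'] by simp_all
  then show "h' = h" "k' = k"
    using assms bisectionD(3)[OF A] bisectionD(2)[OF B] by (auto simp: inj_on_def)
qed

text \<open>
  An arrow has at most one factorization over two local bisections, so the convolution sum has at
  most one non-zero term.
\<close>

lemma sconv_at:
  assumes A: "A \<in> local_bisections G" and B: "B \<in> local_bisections G"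
    and s: "s \<in> Cc_on E A" and t: "t \<in> Cc_on E B"
  shows sconv_mul: "h \<in> A \<Longrightarrow> k \<in> B \<Longrightarrow> src h = tgt k \<Longrightarrow> sconv G E s t (h \<star> k) = fmul E (s h) (t k)"
    and sconv_outside: "g \<notin> set_mul G A B \<Longrightarrow> sconv G E s t g = fzero E g"
proof -
  let ?P = "\<lambda>g. {(h, k). (h, k) \<in> gcomposable G \<and> h \<star> k = g \<and> fmul E (s h) (t k) \<noteq> fzero E g}"
  note ps = Cc_onD(1)[OF s] and pt = Cc_onD(1)[OF t]
  have P: "h \<in> A \<and> k \<in> B \<and> src h = tgt k \<and> h \<star> k = g \<and> fmul E (s h) (t k) \<noteq> fzero E g"
    if "(h, k) \<in> ?P g" for g h k
  proof -
    have hk: "src h = tgt k" "h \<star> k = g" "fmul E (s h) (t k) \<noteq> fzero E g"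
      using that by (auto simp: gcomposable_def)
    have "h \<in> A"
    proof (rule ccontr)
      assume "h \<notin> A"
      then show False using hk Cc_on_outside[OF s, of h] fmul_fzero_left[of h "t k"] by (simp add: pt)
    qed
    moreover have "k \<in> B"
    proof (rule ccontr)
      assume "k \<notin> B"
      then show False using hk Cc_on_outside[OF t, of k] fmul_fzero_right[of "s h" k] by (simp add: ps)
    qed
    ultimately show ?thesis using hk by blast
  qed
  show "sconv G E s t g = fzero E g" if "g \<notin> set_mul G A B"
  proof -
    interpret M: Module.module complex_ring "fibre E g" by (rule fibre_module)
    have "?P g = {}"
    proof (rule equals0I)
      fix x assume "x \<in> ?P g"
      then obtain h k where "(h, k) \<in> ?P g" by (cases x) auto
      from P[OF this] that show False by (auto simp: set_mul_def)
    qed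
    then show ?thesis unfolding sconv_def using M.finsum_empty by (simp only: fibre_simps)
  qed
  show "sconv G E s t (h \<star> k) = fmul E (s h) (t k)" if hk: "h \<in> A" "k \<in> B" "src h = tgt k"
  proof -
    interpret M: Module.module complex_ring "fibre E (h \<star> k)" by (rule fibre_module)
    have sub: "?P (h \<star> k) \<subseteq> {(h, k)}"
    proof
      fix x assume x: "x \<in> ?P (h \<star> k)"
      obtain h' k' where x': "x = (h', k')" by (cases x)
      from P[of h' k' "h \<star> k"] x have "h' \<in> A" "k' \<in> B" "src h' = tgt k'" "h' \<star> k' = h \<star> k"
        unfolding x' by blast+
      then show "x \<in> {(h, k)}" using factors_unique[OF A B hk] unfolding x' by simp
    qed
    show ?thesis
    proof (cases "fmul E (s h) (t k) = fzero E (h \<star> k)")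
      case True
      then have "?P (h \<star> k) = {}" using sub by auto
      then show ?thesis unfolding sconv_def using M.finsum_empty True by (simp only: fibre_simps)
    next
      case False
      then have "?P (h \<star> k) = {(h, k)}" using sub hk by (auto simp: gcomposable_def)
      moreover have "finsum (fibre E (h \<star> k)) (\<lambda>(h, k). fmul E (s h) (t k)) {(h, k)} = fmul E (s h) (t k)"
        using M.finsum_insert[of "{}" "(h, k)" "\<lambda>(h, k). fmul E (s h) (t k)"]
          fadd_fzero[of "fmul E (s h) (t k)"] hk by (simp add: ps pt)
      ultimately show ?thesis unfolding sconv_def by simp
    qed
  qed
qed

lemma sconv_Cc_on:
  assumes A: "A \<in> local_bisections G" and B: "B \<in> local_bisections G"
    and s: "s \<in> Cc_on E A" and t: "t \<in> Cc_on E B"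
  shows "sconv G E s t \<in> Cc_on E (set_mul G A B)"
proof -
  note ps = Cc_onD(1)[OF s] and pt = Cc_onD(1)[OF t]
  note B' = bisectionD[OF B]
  let ?K = "set_mul G (section_support E s) (section_support E t)"
  have cases: thesis
    if "g \<notin> set_mul G A B \<Longrightarrow> thesis" and
      "\<And>h k. g = h \<star> k \<Longrightarrow> h \<in> A \<Longrightarrow> k \<in> B \<Longrightarrow> src h = tgt k \<Longrightarrow> thesis" for g thesis
    using that unfolding set_mul_def by blast
  show ?thesis
  proof (rule Cc_onI[where K = ?K and W = "set_mul G A B"])
    show "\<pi> (sconv G E s t g) = g" for g
      by (rule cases[of g])
         (simp_all add: sconv_mul[OF A B s t] sconv_outside[OF A B s t] ps pt)
    show "open (set_mul G A B)" by (intro open_set_mul bisectionD A B)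
    show "compact ?K" using Cc_onD(3) s t by (intro compact_set_mul) auto
    show "?K \<subseteq> set_mul G A B" using Cc_onD(4) s t unfolding set_mul_def by blast
    then show "?K \<subseteq> set_mul G A B" .
    have sub: "set_mul G A B \<subseteq> src -` src ` B" by (auto simp: set_mul_def)
    have "continuous_on (set_mul G A B) (\<lambda>g. fmul E (s (left_factor B g)) (t (right_factor B g)))"
    proof (intro continuous_on_fmul)
      show "continuous_on (set_mul G A B) (\<lambda>g. s (left_factor B g))"
        using continuous_left_factor[OF B'(1,2)] sub
        by (intro continuous_on_compose2[OF Cc_onD(2)[OF s, of UNIV]])
           (auto intro: continuous_on_subset)
      show "continuous_on (set_mul G A B) (\<lambda>g. t (right_factor B g))"
        using continuous_right_factor[OF B'(1,2)] sub
        by (intro continuous_on_compose2[OF Cc_onD(2)[OF t, of UNIV]])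
           (auto intro: continuous_on_subset)
      show "src (\<pi> (s (left_factor B g))) = tgt (\<pi> (t (right_factor B g)))"
        if "g \<in> set_mul G A B" for g
        using that sub by (auto simp: ps pt src_left_factor)
    qed
    then show "continuous_on (set_mul G A B) (sconv G E s t)"
    proof (rule continuous_on_eq)
      fix g assume "g \<in> set_mul G A B"
      then obtain h k where "g = h \<star> k" "h \<in> A" "k \<in> B" "src h = tgt k" by (auto simp: set_mul_def)
      then show "fmul E (s (left_factor B g)) (t (right_factor B g)) = sconv G E s t g"
        using factor_mul_eq[OF B'(2)] sconv_mul[OF A B s t] by simp
    qed
    show "sconv G E s t g = fzero E g" if g: "g \<notin> ?K" for g
    proof (rule cases[of g])
      fix h k assume *: "g = h \<star> k" "h \<in> A" "k \<in> B" "src h = tgt k"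
      then have "h \<notin> section_support E s \<or> k \<notin> section_support E t"
        using g by (auto simp: set_mul_def)
      then show ?thesis
        using * Cc_onD(6)[OF s, of h] Cc_onD(6)[OF t, of k] sconv_mul[OF A B s t]
        by (auto simp: ps pt)
    qed (simp add: sconv_outside[OF A B s t])
  qed
qed

lemma sstar_Cc_on:
  assumes s: "s \<in> Cc_on E U"
  shows "sstar G E s \<in> Cc_on E (opp ` U)"
proof (rule Cc_onI[where K = "opp ` section_support E s" and W = UNIV])
  show "continuous_on UNIV (sstar G E s)"
    unfolding sstar_def
    by (intro continuous_on_fstar continuous_on_compose2[OF Cc_onD(2)[OF s, of UNIV] continuous_inv]) simp
  show "compact (opp ` section_support E s)"
    by (intro compact_continuous_image Cc_onD(3)[OF s] continuous_on_subset[OF continuous_inv]) simp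
  show "sstar G E s g = fzero E g" if "g \<notin> opp ` section_support E s" for g
  proof -
    have "opp g \<notin> section_support E s" using that by (metis imageI inv_inv)
    then have "s (opp g) = fzero E (opp g)" by (rule Cc_onD(6)[OF s])
    then show ?thesis
      using norm_star[of "fzero E (opp g)"] norm_eq_0_iff[of "fstar E (fzero E (opp g))"]
      by (simp add: sstar_def inv_inv)
  qed
qed (use Cc_onD[OF s] in \<open>auto simp: sstar_def inv_inv\<close>)

text \<open>
  The continuous quotient \<open>t / (t1 t2)\<close> is a function on a local bisection, so it may be read as a
  function of the range of its argument, and it is in this form that it multiplies \<open>t1\<close>.
\<close>

lemma sconv_division:
  assumes A: "A \<in> local_bisections G" and B: "B \<in> local_bisections G"
    and t1: "t1 \<in> Cc_on E A" and t2: "t2 \<in> Cc_on E B"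
    and t: "t \<in> Cc_on E {g. coord (sconv G E t1 t2 g) \<noteq> 0}"
  obtains t1' where "t1' \<in> Cc_on E A" "sconv G E t1' t2 = t"
proof -
  define w where "w = sconv G E t1 t2"
  let ?O = "{g. coord (w g) \<noteq> 0}" and ?C = "set_mul G A B"
  have w: "w \<in> Cc_on E ?C" unfolding w_def by (rule sconv_Cc_on[OF A B t1 t2])
  have t: "t \<in> Cc_on E ?O" using t by (simp add: w_def)
  have C: "?C \<in> local_bisections G" by (rule bisection_set_mul[OF A B])
  have OC: "?O \<subseteq> ?C" using Cc_on_outside[OF w] by force
  have O: "open ?O" using open_section_nonzero[OF Cc_onD(2)[OF w, of UNIV]] by simp
  have Oi: "inj_on tgt ?O" using bisectionD(3)[OF C] OC inj_on_subset by blast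
  define q where "q g = coord (t g) / coord (w g)" for g
  have qc: "continuous_on ?O q"
    unfolding q_def using Cc_onD(1,2)[OF t] Cc_onD(1,2)[OF w]
    by (intro continuous_on_coord_quotient) simp_all
  let ?o = "inv_into ?O tgt" and ?W = "tgt -` tgt ` ?O"
  have o_mem: "?o (tgt h) \<in> ?O" "tgt (?o (tgt h)) = tgt h" if "h \<in> ?W" for h
    using inv_into_into[OF vimageD[OF that]] f_inv_into_f[OF vimageD[OF that]] by blast+
  define t1' where "t1' h = (if h \<in> ?W then fscale E (q (?o (tgt h))) (t1 h) else fzero E h)" for h
  let ?K = "section_support E t1 \<inter> tgt -` tgt ` section_support E t"
  have t1'_mem: "t1' \<in> Cc_on E A"
  proof (rule Cc_onI[where K = ?K and W = ?W])
    show "\<pi> (t1' g) = g" for g using Cc_onD(1)[OF t1] by (simp add: t1'_def)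
    show "open ?W" by (intro open_tgt_vimage open_tgt_image O)
    have "continuous_on ?W (\<lambda>h. ?o (tgt h))"
      by (rule continuous_on_compose2[OF tgt_section[OF O Oi] continuous_tgt]) auto
    then have "continuous_on ?W (\<lambda>h. q (?o (tgt h)))"
      by (rule continuous_on_compose2[OF qc]) (use o_mem in blast)
    then have "continuous_on ?W (\<lambda>h. fscale E (q (?o (tgt h))) (t1 h))"
      by (intro continuous_on_fscale Cc_onD(2)[OF t1])
    then show "continuous_on ?W t1'" by (rule continuous_on_eq) (simp add: t1'_def)
    have "compact (tgt ` section_support E t)"
      by (intro compact_continuous_image continuous_tgt Cc_onD(3)[OF t])
    then have "closed (tgt -` tgt ` section_support E t)"
      by (intro closed_vimage compact_imp_closed continuous_tgt)
    then show "compact ?K" using Cc_onD(3)[OF t1] by (intro compact_Int_closed)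
    show "?K \<subseteq> ?W" using Cc_onD(4)[OF t] by blast
    show "?K \<subseteq> A" using Cc_onD(4)[OF t1] by blast
    show "t1' h = fzero E h" if h: "h \<notin> ?K" for h
    proof (cases "h \<in> section_support E t1 \<and> h \<in> ?W")
      case True
      then have "tgt (?o (tgt h)) = tgt h" by (intro o_mem) simp
      then have "?o (tgt h) \<notin> section_support E t" using h True by (metis IntI imageI vimageI)
      then have "q (?o (tgt h)) = 0" using Cc_onD(6)[OF t] by (simp add: q_def)
      then show ?thesis using Cc_onD(1)[OF t1] by (simp add: t1'_def)
    next
      case False
      then show ?thesis using Cc_onD(6)[OF t1] by (auto simp: t1'_def)
    qed
  qed
  have "sconv G E t1' t2 g = t g" for g
  proof (cases "g \<in> ?C")
    case False
    then have "g \<notin> ?O" using OC by blast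
    then have "t g = fzero E g" by (rule Cc_on_outside[OF t])
    then show ?thesis using sconv_outside[OF A B t1'_mem t2 False] by simp
  next
    case True
    then obtain h k where hk: "g = h \<star> k" "h \<in> A" "k \<in> B" "src h = tgt k" by (auto simp: set_mul_def)
    have wg: "w g = fmul E (t1 h) (t2 k)" using sconv_mul[OF A B t1 t2] hk by (simp add: w_def)
    have g': "sconv G E t1' t2 g = fmul E (t1' h) (t2 k)"
      using sconv_mul[OF A B t1'_mem t2] hk by simp
    have tgtg: "tgt h = tgt g" using hk by simp
    note comp = Cc_onD(1)[OF t1] Cc_onD(1)[OF t2] hk(4)
    show ?thesis
    proof (cases "h \<in> ?W")
      case True
      then have "?o (tgt h) \<in> ?O" "tgt (?o (tgt h)) = tgt g"
        using o_mem[OF True] tgtg by simp_all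
      then have o: "?o (tgt h) = g" "g \<in> ?O"
        using bisectionD(3)[OF C] OC \<open>g \<in> ?C\<close> by (metis (no_types, lifting) inj_onD subsetD)+
      have "sconv G E t1' t2 g = fscale E (q g) (w g)"
        using True o(1) by (simp add: g' wg t1'_def comp)
      also have "\<dots> = t g"
        by (rule coord_eqI) (use o(2) Cc_onD(1)[OF t] Cc_onD(1)[OF w] in \<open>simp_all add: q_def\<close>)
      finally show ?thesis .
    next
      case False
      then have "g \<notin> ?O" using tgtg by (metis imageI vimageI)
      then have "t g = fzero E g" by (rule Cc_on_outside[OF t])
      moreover have "t1' h = fzero E h" using False by (simp add: t1'_def)
      ultimately show ?thesis using g' hk(1) fmul_fzero_left[of h "t2 k"] comp by simp
    qed
  qed
  then show thesis using that t1'_mem by blast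
qed

end


section \<open>Localizable completions\<close>

locale line_completion = hausdorff_fell_line_bundle G E + localizable_completion G E N A \<iota>
  for G :: "('g::t2_space) groupoid"
    and E :: "('g, 'e::topological_space) fell_bundle"
    and N :: "('g \<Rightarrow> 'e) \<Rightarrow> real"
    and A :: "('a::{real_normed_algebra, banach}) cstar_algebra"
    and \<iota> :: "('g \<Rightarrow> 'e) \<Rightarrow> 'a"
begin

subsection \<open>Evaluation\<close>

text \<open>
  A compatible norm dominates the supremum norm. This makes evaluation at \<open>g\<close> contractive, and in
  particular dependent only on the embedded section.
\<close>

lemma coord_diff_le:
  assumes s: "s \<in> Cc E" and t: "t \<in> Cc E"
  shows "cmod (coord (s g) - coord (t g)) \<le> norm (\<iota> s - \<iota> t)"
proof -
  let ?d = "sadd E s (sscale E (-1) t)"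
  have t': "sscale E (-1) t \<in> Cc E" by (rule sscale_Cc_on[OF t])
  have d: "?d \<in> Cc E" by (rule sadd_Cc_on[OF s t'])
  have m1: "cscale A (-1) x = - x" for x using cscale_of_real[of "-1" x] by simp
  have "coord (s g) - coord (t g) = coord (?d g)"
    using Cc_onD(1)[OF s, of g] Cc_onD(1)[OF t, of g] by (simp add: sadd_def sscale_def)
  then have "cmod (coord (s g) - coord (t g)) = fnorm E (?d g)" by (simp add: cmod_coord)
  also have "\<dots> \<le> sup_norm E ?d"
    unfolding sup_norm_def by (intro cSUP_upper bdd_above_fnorm[OF d]) simp
  also have "\<dots> \<le> norm (\<iota> ?d)" using sup_norm_le[OF d] embed_norm[OF d] by simp
  also have "\<iota> ?d = \<iota> s - \<iota> t" by (simp add: embed_add[OF s t'] embed_scale[OF t] m1)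
  finally show ?thesis .
qed

lemma dense_eq:
  fixes f f' :: "'a \<Rightarrow> complex"
  assumes "continuous_on UNIV f" "continuous_on UNIV f'" "\<And>s. s \<in> Cc E \<Longrightarrow> f (\<iota> s) = f' (\<iota> s)"
  shows "f a = f' a"
proof -
  have "closed {a. f a = f' a}" by (intro closed_Collect_eq assms)
  then have "closure (\<iota> ` Cc E) \<subseteq> {a. f a = f' a}"
    using assms(3) by (intro closure_minimal) auto
  then show ?thesis using embed_dense by auto
qed

text \<open>
  Evaluation of sections is contractive, so it extends to the completion by uniform continuity;
  linearity and the bound hold on a dense set and pass to the closure.
\<close>

lemma eval_functional:
  obtains F where "\<And>a b. F (a + b) = F a + F b" "\<And>c a. F (cscale A c a) = c * F a"
    "\<And>a. cmod (F a) \<le> norm a" "\<And>s. s \<in> Cc E \<Longrightarrow> F (\<iota> s) = coord (s g)"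
proof -
  define F0 where "F0 a = coord ((SOME s. s \<in> Cc E \<and> \<iota> s = a) g)" for a
  have some: "(SOME s. s \<in> Cc E \<and> \<iota> s = a) \<in> Cc E \<and> \<iota> (SOME s. s \<in> Cc E \<and> \<iota> s = a) = a"
    if "a \<in> \<iota> ` Cc E" for a
    using someI_ex[of "\<lambda>s. s \<in> Cc E \<and> \<iota> s = a"] that by blast
  have F0: "F0 (\<iota> s) = coord (s g)" if "s \<in> Cc E" for s
    using coord_diff_le[of "SOME t. t \<in> Cc E \<and> \<iota> t = \<iota> s" s g] some[of "\<iota> s"] that
    by (simp add: F0_def)
  have lip: "dist (F0 x) (F0 y) \<le> dist x y" if "x \<in> \<iota> ` Cc E" "y \<in> \<iota> ` Cc E" for x y
    using that coord_diff_le by (auto simp: F0 dist_norm)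
  have "uniformly_continuous_on (\<iota> ` Cc E) F0"
    unfolding uniformly_continuous_on_def using lip by (meson le_less_trans)
  then obtain F where F: "uniformly_continuous_on (closure (\<iota> ` Cc E)) F"
    "\<And>x. x \<in> \<iota> ` Cc E \<Longrightarrow> F0 x = F x"
    using uniformly_continuous_on_extension_on_closure by metis
  have Fc: "continuous_on UNIV F" using F(1) embed_dense uniformly_continuous_imp_continuous by auto
  have F\<iota>: "F (\<iota> s) = coord (s g)" if "s \<in> Cc E" for s using F(2) F0 that by force
  have c1: "continuous_on UNIV (\<lambda>b. F (x + b))" "continuous_on UNIV (\<lambda>b. F (b + x))"
    "continuous_on UNIV (\<lambda>b. F (cscale A c b))" for x c
    by (intro continuous_on_compose2[OF Fc] continuous_intros continuous_cscale; simp)+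
  have add1: "F (\<iota> s + b) = F (\<iota> s) + F b" if s: "s \<in> Cc E" for s b
  proof (rule dense_eq[where a = b])
    fix t assume t: "t \<in> Cc E"
    show "F (\<iota> s + \<iota> t) = F (\<iota> s) + F (\<iota> t)"
      using F\<iota>[OF sadd_Cc_on[OF s t]] Cc_onD(1)[OF s, of g] Cc_onD(1)[OF t, of g]
      unfolding embed_add[OF s t] F\<iota>[OF s] F\<iota>[OF t] by (simp add: sadd_def)
  qed (intro continuous_intros c1 Fc)+
  show thesis
  proof (rule that[of F])
    show "F (a + b) = F a + F b" for a b
      by (rule dense_eq[where a = a]) (intro continuous_intros c1 Fc, intro continuous_intros c1 Fc, rule add1)
    show "F (cscale A c a) = c * F a" for c a
    proof (rule dense_eq[where a = a])
      fix t assume t: "t \<in> Cc E"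
      show "F (cscale A c (\<iota> t)) = c * F (\<iota> t)"
        using F\<iota>[OF sscale_Cc_on[OF t]] unfolding embed_scale[OF t] F\<iota>[OF t]
        by (simp add: sscale_def)
    qed (intro continuous_intros c1 Fc)+
    show "cmod (F a) \<le> norm a" for a
    proof -
      have "closed {a. cmod (F a) \<le> norm a}" by (intro closed_Collect_le continuous_intros Fc)
      moreover have "cmod (F (\<iota> s)) \<le> norm (\<iota> s)" if s: "s \<in> Cc E" for s
      proof -
        let ?z = "sscale E 0 s"
        have z: "?z \<in> Cc E" by (rule sscale_Cc_on[OF s])
        have "\<iota> ?z = 0" using cscale_of_real[of 0 "\<iota> s"] by (simp add: embed_scale[OF s])
        then show ?thesis using coord_diff_le[OF s z, of g] by (simp add: F\<iota>[OF s] sscale_def)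
      qed
      ultimately have "closure (\<iota> ` Cc E) \<subseteq> {a. cmod (F a) \<le> norm a}"
        by (intro closure_minimal) auto
      then show ?thesis using embed_dense by auto
    qed
  qed (rule F\<iota>)
qed

definition ev :: "'g \<Rightarrow> 'a \<Rightarrow> complex" where
  "ev g a = coord (eval_at E A \<iota> g a)"

lemma eval_at_properties:
  shows proj_eval_at: "\<pi> (eval_at E A \<iota> g a) = g"
    and ev_add: "ev g (a + b) = ev g a + ev g b"
    and ev_cscale: "ev g (cscale A c a) = c * ev g a"
    and ev_bound: "cmod (ev g a) \<le> norm a"
    and eval_at_embed: "s \<in> Cc E \<Longrightarrow> eval_at E A \<iota> g (\<iota> s) = s g"
proof -
  obtain F where F: "\<And>a b. F (a + b) = F a + F b" "\<And>c a. F (cscale A c a) = c * F a"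
    "\<And>a. cmod (F a) \<le> norm a" "\<And>s. s \<in> Cc E \<Longrightarrow> F (\<iota> s) = coord (s g)"
    using eval_functional by blast
  let ?P = "\<lambda>f. (\<forall>a. \<pi> (f a) = g) \<and> (\<forall>a b. f (a + b) = fadd E (f a) (f b)) \<and>
     (\<forall>c a. f (cscale A c a) = fscale E c (f a)) \<and>
     (\<exists>K. \<forall>a. fnorm E (f a) \<le> K * norm a) \<and> (\<forall>s \<in> Cc E. f (\<iota> s) = s g)"
  let ?f = "\<lambda>a. fscale E (F a) (unit_vector g)"
  have P: "?P ?f"
  proof (intro conjI allI ballI)
    show "\<exists>K. \<forall>a. fnorm E (?f a) \<le> K * norm a"
      by (rule exI[of _ 1]) (simp add: norm_scale F(3))
    show "?f (\<iota> s) = s g" if "s \<in> Cc E" for s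
      using coord[of "s g"] Cc_onD(1)[OF that, of g] by (simp add: F(4)[OF that])
  qed (simp_all add: F fscale_add_left)
  have "f = ?f" if f: "?P f" for f
  proof
    fix a
    obtain K where K: "\<And>a. fnorm E (f a) \<le> K * norm a" using f by blast
    have lin: "bounded_linear (\<lambda>a. coord (f a))"
    proof (rule bounded_linear_intro[where K = K])
      show "coord (f (r *\<^sub>R x)) = r *\<^sub>R coord (f x)" for r x
        using f cscale_of_real[of r x] by (metis coord_fscale scaleR_conv_of_real)
      show "norm (coord (f x)) \<le> norm x * K" for x using K by (simp add: cmod_coord mult.commute)
    qed (use f in simp)
    have linF: "bounded_linear F"
    proof (rule bounded_linear_intro[where K = 1])
      show "F (r *\<^sub>R x) = r *\<^sub>R F x" for r x
        using F(2)[of "complex_of_real r" x] by (simp add: cscale_of_real scaleR_conv_of_real)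
    qed (use F in simp_all)
    have "coord (f a) = F a"
      by (rule dense_eq) (use lin linF f F(4) in \<open>auto intro: linear_continuous_on\<close>)
    then show "f a = ?f a" using f by (intro coord_eqI) simp_all
  qed
  then have eval: "eval_at E A \<iota> g = ?f"
    unfolding eval_at_def by (intro the_equality P)
  show "\<pi> (eval_at E A \<iota> g a) = g" by (simp add: eval)
  show "ev g (a + b) = ev g a + ev g b" by (simp add: eval ev_def F)
  show "ev g (cscale A c a) = c * ev g a" by (simp add: eval ev_def F)
  show "cmod (ev g a) \<le> norm a" by (simp add: eval ev_def F)
  show "eval_at E A \<iota> g (\<iota> s) = s g" if "s \<in> Cc E" using P that by (simp add: eval)
qed

lemma ev_embed: "s \<in> Cc E \<Longrightarrow> ev g (\<iota> s) = coord (s g)"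
  by (simp add: ev_def eval_at_embed)

lemma bounded_linear_ev: "bounded_linear (ev g)"
proof (rule bounded_linear_intro[where K = 1])
  show "ev g (r *\<^sub>R x) = r *\<^sub>R ev g x" for r x
    using ev_cscale[of g "complex_of_real r" x] by (simp add: cscale_of_real scaleR_conv_of_real)
qed (simp_all add: ev_add ev_bound)

lemma continuous_on_ev: "continuous_on S f \<Longrightarrow> continuous_on S (\<lambda>x. ev g (f x))"
  using bounded_linear.continuous_on[OF bounded_linear_ev] .

lemma ev_0 [simp]: "ev g 0 = 0"
  using linear_0[OF bounded_linear.linear[OF bounded_linear_ev]] .

text \<open>
  Evaluations of an arbitrary element are uniform limits of evaluations of sections, and the norm is
  continuous on the bundle; so the set where the evaluation does not vanish is already open.
\<close>

lemma open_support_eq: "open_support E A \<iota> a = {g. ev g a \<noteq> 0}"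
proof -
  have "open {g. ev g a \<noteq> 0}"
  proof (rule Topological_Spaces.openI)
    fix g assume "g \<in> {g. ev g a \<noteq> 0}"
    then have c: "cmod (ev g a) / 2 > 0" by simp
    have "a \<in> closure (\<iota> ` Cc E)" by (simp add: embed_dense)
    then have "\<exists>y\<in>\<iota> ` Cc E. dist y a < cmod (ev g a) / 2"
      using c unfolding closure_approachable by blast
    then obtain s where s: "s \<in> Cc E" "norm (\<iota> s - a) < cmod (ev g a) / 2"
      by (auto simp: dist_norm)
    have close: "cmod (coord (s h) - ev h a) < cmod (ev g a) / 2" for h
    proof -
      have "coord (s h) - ev h a = ev h (\<iota> s - a)"
        using linear_diff[OF bounded_linear.linear[OF bounded_linear_ev]] by (simp add: ev_embed s)
      then show ?thesis using ev_bound[of h "\<iota> s - a"] s(2) by simp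
    qed
    let ?O = "{h. cmod (ev g a) / 2 < fnorm E (s h)}"
    have "open ?O"
      by (intro open_Collect_less continuous_intros continuous_on_fnorm Cc_onD(2)[OF s(1)])
    moreover have "g \<in> ?O"
      using close[of g] norm_triangle_ineq2[of "ev g a" "coord (s g)"]
      by (simp add: norm_minus_commute flip: cmod_coord)
    moreover have "?O \<subseteq> {g. ev g a \<noteq> 0}"
    proof clarify
      fix h assume "cmod (ev g a) / 2 < fnorm E (s h)" "ev h a = 0"
      then show False using close[of h] by (simp add: cmod_coord)
    qed
    ultimately show "\<exists>T. open T \<and> g \<in> T \<and> T \<subseteq> {g. ev g a \<noteq> 0}" by blast
  qed
  moreover have "eval_at E A \<iota> g a \<noteq> fzero E g \<longleftrightarrow> ev g a \<noteq> 0" for g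
    using coord_eq_0_iff[of "eval_at E A \<iota> g a"] by (simp add: ev_def proj_eval_at)
  ultimately show ?thesis unfolding open_support_def by (simp add: interior_open)
qed

subsection \<open>The associated map of quantales\<close>

abbreviation "ps \<equiv> assoc_map G E A \<iota>"

definition bisection_sections :: "'g set \<Rightarrow> 'a set" where
  "bisection_sections V = (\<Union>B \<in> {B \<in> local_bisections G. B \<subseteq> V}. \<iota> ` Cc_on E B)"

lemma ps_eq: "ps V = closed_span (bisection_sections V)"
  by (simp add: assoc_map_def closed_span_def bisection_sections_def)

lemma bisection_sectionsI:
  "B \<in> local_bisections G \<Longrightarrow> B \<subseteq> V \<Longrightarrow> s \<in> Cc_on E B \<Longrightarrow> \<iota> s \<in> bisection_sections V"
  by (auto simp: bisection_sections_def)

lemma bisection_sectionsE: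
  assumes "a \<in> bisection_sections V"
  obtains B s where "B \<in> local_bisections G" "B \<subseteq> V" "s \<in> Cc_on E B" "a = \<iota> s"
  using assms by (auto simp: bisection_sections_def)

lemma ps_closed_subspace: "ps V \<in> closed_subspaces"
  unfolding ps_eq by (rule closed_span_closed_subspace)

lemma ps_mono: "U \<subseteq> V \<Longrightarrow> ps U \<subseteq> ps V"
  unfolding ps_eq bisection_sections_def by (intro closed_span_mono) blast

lemma embed_in_ps: "B \<in> local_bisections G \<Longrightarrow> B \<subseteq> V \<Longrightarrow> s \<in> Cc_on E B \<Longrightarrow> \<iota> s \<in> ps V"
  unfolding ps_eq by (intro subsetD[OF closed_span_superset] bisection_sectionsI)

lemma ps_least:
  assumes "M \<in> closed_subspaces"
    and "\<And>B s. B \<in> local_bisections G \<Longrightarrow> B \<subseteq> V \<Longrightarrow> s \<in> Cc_on E B \<Longrightarrow> \<iota> s \<in> M"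
  shows "ps V \<subseteq> M"
  unfolding ps_eq using assms by (intro closed_span_least) (auto elim!: bisection_sectionsE)

text \<open>
  Evaluation at \<open>g\<close> is linear and continuous and kills the generators of \<open>ps V\<close>.
\<close>

lemma ev_outside:
  assumes "a \<in> ps V" "g \<notin> V"
  shows "ev g a = 0"
proof -
  have "ps V \<subseteq> {a. ev g a = 0}"
  proof (rule ps_least)
    show "{a. ev g a = 0} \<in> closed_subspaces"
      by (rule closed_subspacesI)
         (auto intro!: closed_Collect_eq continuous_on_ev continuous_intros simp: ev_add ev_cscale)
    fix B s assume "B \<subseteq> V" and s: "s \<in> Cc_on E B"
    then have "g \<notin> B" using assms(2) by blast
    then show "\<iota> s \<in> {a. ev g a = 0}"
      using Cc_on_outside[OF s] ev_embed[OF Cc_on_Cc[OF s]] by simp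
  qed
  then show ?thesis using assms(1) by auto
qed

text \<open>
  Membership of a section in a closed subspace is a local matter on its support. Finitely many
  cutoff functions \<open>f\<close> suffice, each equal to one near some point of the support, and
  \<open>s = f s + (1 - f) s\<close> removes them one at a time.
\<close>

lemma local_membership:
  assumes M: "M \<in> closed_subspaces" and s: "s \<in> Cc_on E W"
    and loc: "\<And>g. g \<in> W \<Longrightarrow> \<exists>V. open V \<and> g \<in> V \<and> (\<forall>t\<in>Cc_on E (V \<inter> W). \<iota> t \<in> M)"
  shows "\<iota> s \<in> M"
proof -
  have split: "\<iota> t \<in> M"
    if "finite F" "t \<in> Cc_on E W" "\<And>f. f \<in> F \<Longrightarrow> continuous_on UNIV f"
      "\<And>f t. f \<in> F \<Longrightarrow> t \<in> Cc_on E W \<Longrightarrow> \<iota> (\<lambda>g. fscale E (complex_of_real (f g)) (t g)) \<in> M"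
      "\<And>g. coord (t g) \<noteq> 0 \<Longrightarrow> \<exists>f\<in>F. f g = (1::real)" for F t
    using that
  proof (induction F arbitrary: t rule: finite_induct)
    case empty
    then have t: "t \<in> Cc E" "\<And>g. coord (t g) = 0" by (auto intro: Cc_on_Cc)
    have "t = sscale E 0 t"
      by (rule ext, rule coord_eqI) (simp_all add: sscale_def t)
    then have "\<iota> t = 0" using embed_scale[OF t(1), of 0] cscale_of_real[of 0 "\<iota> t"] by simp
    then show ?case using closed_subspacesD(2)[OF M] by simp
  next
    case (insert f F)
    note t = insert.prems(1) and cont = insert.prems(2) and mem = insert.prems(3)
      and cover = insert.prems(4)
    let ?t1 = "\<lambda>g. fscale E (complex_of_real (f g)) (t g)"
    let ?t2 = "\<lambda>g. fscale E (complex_of_real (1 - f g)) (t g)"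
    have fc: "continuous_on UNIV f" by (rule cont) simp
    have "?t1 \<in> Cc_on E (UNIV \<inter> W)" "?t2 \<in> Cc_on E (UNIV \<inter> W)"
      by (rule fscale_Cc_on[OF t], intro continuous_intros fc, simp)+
    then have t12: "?t1 \<in> Cc_on E W" "?t2 \<in> Cc_on E W" by simp_all
    have "\<iota> ?t2 \<in> M"
    proof (rule insert.IH[OF t12(2)])
      show "\<exists>f\<in>F. f g = 1" if "coord (?t2 g) \<noteq> 0" for g
        using cover[of g] that by auto
    qed (use cont mem in auto)
    moreover have "\<iota> ?t1 \<in> M" using mem t by blast
    ultimately have "\<iota> (sadd E ?t1 ?t2) \<in> M"
      using embed_add[OF Cc_on_Cc[OF t12(1)] Cc_on_Cc[OF t12(2)]] closed_subspacesD(3)[OF M] by simp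
    moreover have "t = sadd E ?t1 ?t2"
      by (rule ext, rule coord_eqI) (simp_all add: sadd_def algebra_simps)
    ultimately show ?case by (rule ssubst[where P = "\<lambda>t. \<iota> t \<in> M", rotated])
  qed
  have "\<exists>f O'. continuous_on UNIV f \<and> open O' \<and> g \<in> O' \<and> (\<forall>x\<in>O'. f x = (1::real)) \<and>
      (\<forall>t\<in>Cc_on E W. \<iota> (\<lambda>g. fscale E (complex_of_real (f g)) (t g)) \<in> M)"
    if g: "g \<in> section_support E s" for g
  proof -
    obtain V where V: "open V" "g \<in> V" "\<forall>t\<in>Cc_on E (V \<inter> W). \<iota> t \<in> M"
      using loc Cc_onD(4)[OF s] g by blast
    obtain f :: "'g \<Rightarrow> real" and O' where f: "continuous_on UNIV f" "open O'" "g \<in> O'"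
      "\<And>x. x \<in> O' \<Longrightarrow> f x = 1" "compact (closure {x. f x \<noteq> 0})" "closure {x. f x \<noteq> 0} \<subseteq> V"
      by (rule cutoff_function[OF V(1,2)]) (rule that)
    have "(\<lambda>g. fscale E (complex_of_real (f g)) (t g)) \<in> Cc_on E (V \<inter> W)" if "t \<in> Cc_on E W" for t
      by (rule fscale_Cc_on[OF that]) (use f in \<open>auto intro!: continuous_intros\<close>)
    then show ?thesis using f V(3) by blast
  qed
  then obtain f O' where fO: "\<And>g. g \<in> section_support E s \<Longrightarrow> continuous_on UNIV (f g) \<and>
      open (O' g) \<and> g \<in> O' g \<and> (\<forall>x\<in>O' g. f g x = (1::real)) \<and>
      (\<forall>t\<in>Cc_on E W. \<iota> (\<lambda>h. fscale E (complex_of_real (f g h)) (t h)) \<in> M)"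
    by metis
  obtain D where D: "D \<subseteq> section_support E s" "finite D" "section_support E s \<subseteq> (\<Union>g\<in>D. O' g)"
    by (rule compactE_image[OF Cc_onD(3)[OF s], of "section_support E s" O']) (use fO in blast)+
  show ?thesis
  proof (rule split[of "f ` D" s])
    show "\<exists>f'\<in>f ` D. f' g = 1" if "coord (s g) \<noteq> 0" for g
    proof -
      have "g \<in> section_support E s" using that Cc_onD(6)[OF s, of g] by (cases "g \<in> section_support E s") simp_all
      then obtain d where "d \<in> D" "g \<in> O' d" using D(3) by blast
      then show ?thesis using fO[of d] D(1) by blast
    qed
  qed (use D fO s in auto)
qed

text \<open>
  Every section is locally a section on a local bisection.
\<close>

lemma ps_UNIV: "ps UNIV = UNIV"
proof -
  have "\<iota> ` Cc E \<subseteq> ps UNIV"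
  proof clarify
    fix s assume s: "s \<in> Cc E"
    show "\<iota> s \<in> ps UNIV"
    proof (rule local_membership[OF ps_closed_subspace s])
      fix g :: 'g
      obtain B where B: "B \<in> local_bisections G" "g \<in> B" by (rule bisection_base[of UNIV g]) auto
      then show "\<exists>V. open V \<and> g \<in> V \<and> (\<forall>t\<in>Cc_on E (V \<inter> UNIV). \<iota> t \<in> ps UNIV)"
        using bisectionD(1)[OF B(1)] embed_in_ps[OF B(1)] by (intro exI[of _ B]) auto
    qed
  qed
  then have "closure (\<iota> ` Cc E) \<subseteq> ps UNIV"
    by (intro closure_minimal closed_subspacesD ps_closed_subspace)
  then show ?thesis using embed_dense by auto
qed

lemma ps_Union:
  assumes "S \<subseteq> {U. open U}"
  shows "ps (\<Union>S) = closed_span (\<Union>(ps ` S))"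
proof
  show "closed_span (\<Union>(ps ` S)) \<subseteq> ps (\<Union>S)"
    by (intro closed_span_least ps_closed_subspace UN_least ps_mono) blast
  show "ps (\<Union>S) \<subseteq> closed_span (\<Union>(ps ` S))"
  proof (rule ps_least[OF closed_span_closed_subspace])
    fix B s assume B: "B \<in> local_bisections G" "B \<subseteq> \<Union>S" and s: "s \<in> Cc_on E B"
    show "\<iota> s \<in> closed_span (\<Union>(ps ` S))"
    proof (rule local_membership[OF closed_span_closed_subspace s])
      fix g assume "g \<in> B"
      then obtain V where V: "V \<in> S" "g \<in> V" using B(2) by blast
      then have "open V" using assms by blast
      have "V \<inter> B \<in> local_bisections G"
        using B(1) bisectionD(1)[OF B(1)] \<open>open V\<close> by (intro bisection_subset[OF B(1)]) auto
      then have "\<iota> t \<in> ps V" if "t \<in> Cc_on E (V \<inter> B)" for t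
        using that by (intro embed_in_ps[of "V \<inter> B"]) auto
      moreover have "ps V \<subseteq> closed_span (\<Union>(ps ` S))"
        using V(1) closed_span_superset[of "\<Union>(ps ` S)"] by blast
      ultimately show "\<exists>V. open V \<and> g \<in> V \<and> (\<forall>t\<in>Cc_on E (V \<inter> B). \<iota> t \<in> closed_span (\<Union>(ps ` S)))"
        using V \<open>open V\<close> by blast
    qed
  qed
qed

text \<open>
  For the inclusion of the left side, write a point of the support of \<open>s\<close> as \<open>h \<star> k\<close> and choose
  sections \<open>t1\<close> and \<open>t2\<close> on small local bisections that are non-zero at \<open>h\<close> and \<open>k\<close>. Their product is
  non-zero near \<open>h \<star> k\<close>, so by division a section supported there is itself a product.
\<close>

lemma ps_set_mul:
  assumes U: "open U" and V: "open V"
  shows "ps (set_mul G U V) = subspace_product (ps U) (ps V)"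
proof
  show "subspace_product (ps U) (ps V) \<subseteq> ps (set_mul G U V)"
    unfolding ps_eq[of U] ps_eq[of V]
  proof (rule subspace_product_least[OF ps_closed_subspace])
    fix a b assume "a \<in> bisection_sections U" "b \<in> bisection_sections V"
    then obtain B s B' t where B: "B \<in> local_bisections G" "B \<subseteq> U" "s \<in> Cc_on E B" "a = \<iota> s"
      "B' \<in> local_bisections G" "B' \<subseteq> V" "t \<in> Cc_on E B'" "b = \<iota> t"
      by (metis bisection_sectionsE)
    have "\<iota> (sconv G E s t) \<in> ps (set_mul G U V)"
    proof (rule embed_in_ps)
      show "set_mul G B B' \<subseteq> set_mul G U V" using B(2,6) unfolding set_mul_def by blast
    qed (rule bisection_set_mul sconv_Cc_on; fact B)+
    then show "a * b \<in> ps (set_mul G U V)"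
      using embed_conv[OF Cc_on_Cc[OF B(3)] Cc_on_Cc[OF B(7)]] by (simp add: B(4,8))
  qed
next
  show "ps (set_mul G U V) \<subseteq> subspace_product (ps U) (ps V)"
  proof (rule ps_least[OF subspace_product_closed_subspace])
    fix W s assume W: "W \<in> local_bisections G" "W \<subseteq> set_mul G U V" and s: "s \<in> Cc_on E W"
    show "\<iota> s \<in> subspace_product (ps U) (ps V)"
    proof (rule local_membership[OF subspace_product_closed_subspace s])
      fix g assume "g \<in> W"
      then obtain h k where hk: "g = h \<star> k" "h \<in> U" "k \<in> V" "src h = tgt k"
        using W(2) by (auto simp: set_mul_def)
      obtain B t1 where B: "B \<in> local_bisections G" "h \<in> B" "B \<subseteq> U" "t1 \<in> Cc_on E B" "coord (t1 h) \<noteq> 0"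
        using section_at[OF U hk(2)] by metis
      obtain B' t2 where B': "B' \<in> local_bisections G" "k \<in> B'" "B' \<subseteq> V" "t2 \<in> Cc_on E B'" "coord (t2 k) \<noteq> 0"
        using section_at[OF V hk(3)] by metis
      define w where "w = sconv G E t1 t2"
      have w: "w \<in> Cc_on E (set_mul G B B')"
        unfolding w_def by (rule sconv_Cc_on[OF B(1) B'(1) B(4) B'(4)])
      let ?O = "{g. coord (w g) \<noteq> 0}"
      have "open ?O" using open_section_nonzero[OF Cc_onD(2)[OF w, of UNIV]] by simp
      moreover have "g \<in> ?O"
        using sconv_mul[OF B(1) B'(1) B(4) B'(4) B(2) B'(2) hk(4)] B B' hk(4)
          Cc_onD(1)[OF B(4)] Cc_onD(1)[OF B'(4)]
        by (simp add: w_def hk(1) coord_fmul_nonzero)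
      moreover have "\<iota> t \<in> subspace_product (ps U) (ps V)" if t: "t \<in> Cc_on E (?O \<inter> W)" for t
      proof -
        have "t \<in> Cc_on E ?O" using t Cc_on_mono[of "?O \<inter> W" ?O] by auto
        then obtain t1' where t1': "t1' \<in> Cc_on E B" "sconv G E t1' t2 = t"
          using sconv_division[OF B(1) B'(1) B(4) B'(4)] unfolding w_def by metis
        then have "\<iota> t = \<iota> t1' * \<iota> t2" using embed_conv[OF Cc_on_Cc Cc_on_Cc, OF t1'(1) B'(4)] by simp
        then show ?thesis
          using embed_in_ps[OF B(1,3) t1'(1)] embed_in_ps[OF B'(1,3,4)]
          by (simp add: mult_in_subspace_product)
      qed
      ultimately show "\<exists>V'. open V' \<and> g \<in> V' \<and> (\<forall>t\<in>Cc_on E (V' \<inter> W). \<iota> t \<in> subspace_product (ps U) (ps V))"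
        by blast
    qed
  qed
qed

lemma ps_opp: "ps (opp ` V) = cstar A ` ps V"
proof -
  have sub: "cstar A ` ps V \<subseteq> ps (opp ` V)" for V
  proof -
    have "ps V \<subseteq> cstar A -` ps (opp ` V)"
    proof (rule ps_least)
      show "cstar A -` ps (opp ` V) \<in> closed_subspaces"
        unfolding cstar_image[symmetric] by (rule cstar_closed_subspace[OF ps_closed_subspace])
      fix B s assume B: "B \<in> local_bisections G" "B \<subseteq> V" and s: "s \<in> Cc_on E B"
      have "\<iota> (sstar G E s) \<in> ps (opp ` V)"
        by (rule embed_in_ps[OF bisection_opp[OF B(1)] image_mono[OF B(2)] sstar_Cc_on[OF s]])
      then show "\<iota> s \<in> cstar A -` ps (opp ` V)" by (simp add: embed_star[OF Cc_on_Cc[OF s]])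
    qed
    then show ?thesis by blast
  qed
  have "opp ` opp ` V = V" by (simp add: image_image inv_inv)
  then have "cstar A ` ps (opp ` V) \<subseteq> ps V" using sub[of "opp ` V"] by simp
  then have "ps (opp ` V) \<subseteq> cstar A ` ps V"
    by (simp only: cstar_image[of "ps V"] flip: image_subset_iff_subset_vimage)
  then show ?thesis using sub[of V] by blast
qed

text \<open>
  There is a section supported in \<open>U\<close> and non-zero at any given point of \<open>U\<close>.
\<close>

lemma ps_inj: "inj_on ps {U. open U}"
proof (rule inj_onI)
  have *: "U \<subseteq> V" if U: "open U" and "ps U = ps V" for U V
  proof
    fix g assume "g \<in> U"
    then obtain B s where B: "B \<in> local_bisections G" "B \<subseteq> U" "s \<in> Cc_on E B" "coord (s g) \<noteq> 0"
      using section_at[OF U] by metis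
    then have "\<iota> s \<in> ps V" using embed_in_ps[OF B(1-3)] that by simp
    moreover have "ev g (\<iota> s) \<noteq> 0" using B(4) ev_embed[OF Cc_on_Cc[OF B(3)]] by simp
    ultimately show "g \<in> V" using ev_outside by blast
  qed
  show "U = V" if "U \<in> {U. open U}" "V \<in> {U. open U}" "ps U = ps V" for U V
    using *[of U V] *[of V U] that by auto
qed

lemma ps_quantale_map: "quantale_map (max_quantale A) (open_quantale G) ps"
proof (intro quantale_map.intro quantale_map_axioms.intro)
  show "involutive_quantale (max_quantale A)" by (rule max_quantale_involutive_quantale)
  show "involutive_quantale (open_quantale G)" by (rule open_quantale_involutive_quantale)
  fix S assume "S \<subseteq> carrier (open_quantale G)"
  then have S: "S \<subseteq> {U. open U}" by simp
  have "ps ` S \<subseteq> closed_subspaces" using ps_closed_subspace by blast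
  then show "ps (qsup (open_quantale G) S) = qsup (max_quantale A) (ps ` S)"
    using S by (simp add: qsup_open_quantale qsup_max_quantale ps_Union)
qed (simp_all add: ps_closed_subspace ps_set_mul ps_opp)

subsection \<open>The direct image\<close>

definition pl :: "'a set \<Rightarrow> 'g set" where
  "pl V = (\<Union>a\<in>V. open_support E A \<iota> a)"

lemma mem_pl_iff: "g \<in> pl V \<longleftrightarrow> (\<exists>a\<in>V. ev g a \<noteq> 0)"
  by (simp add: pl_def open_support_eq)

lemma open_pl: "open (pl V)"
  unfolding pl_def open_support_def by (intro open_UN ballI open_interior)

text \<open>
  Localizability gives the adjunction: \<open>pl V \<subseteq> U\<close> says that the elements of \<open>V\<close> have open support in
  \<open>U\<close>, which puts \<open>V\<close> into \<open>gamma U = ps U\<close>.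
\<close>

lemma pl_subset_iff:
  assumes U: "open U"
  shows "pl V \<subseteq> U \<longleftrightarrow> V \<subseteq> ps U"
proof
  assume "pl V \<subseteq> U"
  then have "V \<subseteq> {a. open_support E A \<iota> a \<subseteq> U}" by (auto simp: pl_def)
  also have "\<dots> \<subseteq> closed_span {a. open_support E A \<iota> a \<subseteq> U}" by (rule closed_span_superset)
  also have "\<dots> = ps U" using localizable[OF U] by (simp add: gamma_def closed_span_def)
  finally show "V \<subseteq> ps U" .
next
  assume "V \<subseteq> ps U"
  then show "pl V \<subseteq> U" using ev_outside unfolding mem_pl_iff[THEN eq_reflection] subset_iff by blast
qed

lemma direct_image_pl: "direct_image (max_quantale A) (open_quantale G) ps pl"
  unfolding direct_image_def
  by (intro galois_connection.intro connection.intro galois_connection_axioms.intro)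
     (simp_all add: inclusion_order open_pl ps_closed_subspace pl_subset_iff)

text \<open>
  This half is formal: \<open>V \<subseteq> ps (pl V)\<close>, and \<open>ps\<close> preserves products.
\<close>

lemma pl_product_subset:
  assumes U: "open U"
  shows "pl (subspace_product (subspace_product V (ps U)) W) \<subseteq>
    set_mul G (set_mul G (pl V) U) (pl W)"
proof -
  have "subspace_product (subspace_product V (ps U)) W \<subseteq>
      subspace_product (subspace_product (ps (pl V)) (ps U)) (ps (pl W))"
    using pl_subset_iff[OF open_pl] by (intro subspace_product_mono) auto
  also have "\<dots> = ps (set_mul G (set_mul G (pl V) U) (pl W))"
    by (simp add: ps_set_mul open_set_mul open_pl U)
  finally show ?thesis
    using pl_subset_iff[of "set_mul G (set_mul G (pl V) U) (pl W)"]
    by (simp add: open_set_mul open_pl U)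
qed

subsection \<open>Stability\<close>

text \<open>
  The convolution sum reduces to one term, or to none; in the latter case \<open>h\<close> or \<open>k\<close> lies outside the
  local bisection of the respective section, and the right side vanishes as well.
\<close>

lemma ev_bisection_product:
  assumes B: "B1 \<in> local_bisections G" "B \<in> local_bisections G" "B2 \<in> local_bisections G"
    and s: "s1 \<in> Cc_on E B1" "s \<in> Cc_on E B" "s2 \<in> Cc_on E B2"
    and c: "src h = tgt u" "src u = tgt k" and u: "u \<in> B"
    and unique: "\<And>h' u' k'. u' \<in> B \<Longrightarrow> src h' = tgt u' \<Longrightarrow> src u' = tgt k' \<Longrightarrow>
      (h' \<star> u') \<star> k' = (h \<star> u) \<star> k \<Longrightarrow> h' = h \<and> u' = u \<and> k' = k"
  shows "ev ((h \<star> u) \<star> k) (\<iota> s1 * \<iota> s * \<iota> s2) = coord (fmul E (fmul E (s1 h) (s u)) (s2 k))"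
proof -
  let ?g = "(h \<star> u) \<star> k" and ?C = "set_mul G B1 B"
  note p = Cc_onD(1)[OF s(1)] Cc_onD(1)[OF s(2)] Cc_onD(1)[OF s(3)]
  have C: "?C \<in> local_bisections G" by (rule bisection_set_mul[OF B(1,2)])
  have t: "sconv G E s1 s \<in> Cc_on E ?C" by (rule sconv_Cc_on[OF B(1,2) s(1,2)])
  have t': "sconv G E (sconv G E s1 s) s2 \<in> Cc_on E (set_mul G ?C B2)"
    by (rule sconv_Cc_on[OF C B(3) t s(3)])
  have "\<iota> s1 * \<iota> s * \<iota> s2 = \<iota> (sconv G E (sconv G E s1 s) s2)"
    using embed_conv[OF Cc_on_Cc Cc_on_Cc] s t by metis
  then have ev: "ev ?g (\<iota> s1 * \<iota> s * \<iota> s2) = coord (sconv G E (sconv G E s1 s) s2 ?g)"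
    by (simp add: ev_embed[OF Cc_on_Cc[OF t']])
  show ?thesis
  proof (cases "h \<in> B1 \<and> k \<in> B2")
    case True
    then have "h \<star> u \<in> ?C" using u c by (auto simp: set_mul_def)
    then show ?thesis
      using True u c sconv_mul[OF C B(3) t s(3), of "h \<star> u" k] sconv_mul[OF B(1,2) s(1,2), of h u]
      by (simp add: ev)
  next
    case False
    have "?g \<notin> set_mul G ?C B2"
    proof
      assume "?g \<in> set_mul G ?C B2"
      then obtain h' u' k' where "?g = (h' \<star> u') \<star> k'" "h' \<in> B1" "u' \<in> B" "k' \<in> B2"
        "src h' = tgt u'" "src u' = tgt k'"
        by (auto simp: set_mul_def)
      then show False using unique[of u' h' k'] False by metis
    qed
    then have "ev ?g (\<iota> s1 * \<iota> s * \<iota> s2) = 0" using sconv_outside[OF C B(3) t s(3)] by (simp add: ev)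
    moreover have "s1 h = fzero E h \<or> s2 k = fzero E k"
      using False Cc_on_outside[OF s(1)] Cc_on_outside[OF s(3)] by blast
    ultimately show ?thesis using c by (auto simp: p)
  qed
qed

text \<open>
  If the middle section is supported in a local bisection \<open>B\<close> so small that \<open>(h u) k\<close> factors in
  only one way with middle factor in \<open>B\<close>, then evaluation of \<open>a s b\<close> at \<open>(h u) k\<close> is a single
  product. Both sides are bilinear and continuous in \<open>a\<close> and \<open>b\<close>, so sections on local bisections
  suffice.
\<close>

lemma ev_sandwich:
  assumes B: "B \<in> local_bisections G" and s: "s \<in> Cc_on E B"
    and c: "src h = tgt u" "src u = tgt k" and u: "u \<in> B"
    and unique: "\<And>h' u' k'. u' \<in> B \<Longrightarrow> src h' = tgt u' \<Longrightarrow> src u' = tgt k' \<Longrightarrow>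
      (h' \<star> u') \<star> k' = (h \<star> u) \<star> k \<Longrightarrow> h' = h \<and> u' = u \<and> k' = k"
  shows "ev ((h \<star> u) \<star> k) (a * \<iota> s * b) =
    ev h a * ev k b * coord (fmul E (fmul E (unit_vector h) (s u)) (unit_vector k))"
proof -
  let ?g = "(h \<star> u) \<star> k"
  let ?\<kappa> = "coord (fmul E (fmul E (unit_vector h) (s u)) (unit_vector k))"
  have gen: "ev ?g (\<iota> s1 * \<iota> s * \<iota> s2) = ev h (\<iota> s1) * ev k (\<iota> s2) * ?\<kappa>"
    if B12: "B1 \<in> local_bisections G" "B2 \<in> local_bisections G"
      and s12: "s1 \<in> Cc_on E B1" "s2 \<in> Cc_on E B2" for B1 B2 s1 s2
  proof -
    note p = Cc_onD(1)[OF s12(1)] Cc_onD(1)[OF s12(2)] Cc_onD(1)[OF s]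
    have "coord (fmul E (fmul E (fscale E c (unit_vector h)) (s u)) (fscale E d (unit_vector k))) =
        c * d * ?\<kappa>" for c d
      using c by (simp add: p)
    moreover have "fscale E (coord (s1 h)) (unit_vector h) = s1 h"
      "fscale E (coord (s2 k)) (unit_vector k) = s2 k"
      using coord[of "s1 h"] coord[of "s2 k"] by (simp_all only: p)
    ultimately have "coord (fmul E (fmul E (s1 h) (s u)) (s2 k)) = coord (s1 h) * coord (s2 k) * ?\<kappa>"
      by metis
    moreover have "ev ?g (\<iota> s1 * \<iota> s * \<iota> s2) = coord (fmul E (fmul E (s1 h) (s u)) (s2 k))"
      by (rule ev_bisection_product[OF B12(1) B B12(2) s12(1) s s12(2) c u]) (rule unique)
    ultimately show ?thesis
      by (simp add: ev_embed[OF Cc_on_Cc[OF s12(1)]] ev_embed[OF Cc_on_Cc[OF s12(2)]])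
  qed
  have left: "ev ?g (a * \<iota> s * \<iota> s2) = ev h a * ev k (\<iota> s2) * ?\<kappa>"
    if "B2 \<in> local_bisections G" "s2 \<in> Cc_on E B2" for a B2 s2
  proof -
    have "ps UNIV \<subseteq> {a. ev ?g (a * \<iota> s * \<iota> s2) = ev h a * ev k (\<iota> s2) * ?\<kappa>}"
    proof (rule ps_least)
      show "{a. ev ?g (a * \<iota> s * \<iota> s2) = ev h a * ev k (\<iota> s2) * ?\<kappa>} \<in> closed_subspaces"
        by (rule closed_subspacesI)
           (auto intro!: closed_Collect_eq continuous_on_ev continuous_intros
              simp: ev_add ev_cscale distrib_right cscale_mult_left)
    qed (use gen that in auto)
    then show ?thesis using ps_UNIV by auto
  qed
  have "ps UNIV \<subseteq> {b. ev ?g (a * \<iota> s * b) = ev h a * ev k b * ?\<kappa>}"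
  proof (rule ps_least)
    show "{b. ev ?g (a * \<iota> s * b) = ev h a * ev k b * ?\<kappa>} \<in> closed_subspaces"
      by (rule closed_subspacesI)
         (auto intro!: closed_Collect_eq continuous_on_ev continuous_intros
            simp: ev_add ev_cscale distrib_left distrib_right cscale_mult_right)
  qed (use left in auto)
  then show ?thesis using ps_UNIV by auto
qed

text \<open>
  \<open>opp h \<star> h'\<close> belongs to the isotropy at \<open>src h\<close>, which is trivial.
\<close>

lemma principal_unique:
  assumes "principal_groupoid G" "src h = src h'" "tgt h = tgt h'"
  shows "h = h'"
proof -
  let ?z = "opp h \<star> h'"
  have "src ?z = src h" "tgt ?z = src h" using assms by simp_all
  then have "?z \<in> {g. src g = src h \<and> tgt g = src h}" by blast
  also have "\<dots> = {src h}" using assms(1) src_in_units unfolding principal_groupoid_def by blast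
  finally have "?z = src h" by simp
  moreover have "h \<star> ?z = h'"
    using opp_mul_cancel[of "opp h" h'] assms(3) by (simp add: inv_inv)
  ultimately show ?thesis using mul_src_self[of h] by simp
qed

text \<open>
  Discreteness of the orbit of \<open>src u\<close> allows \<open>B\<close> to be chosen so small that \<open>src u\<close> is the only
  source in that orbit. Then the middle factor of \<open>(h u) k\<close> is determined, and since \<open>G\<close> is principal
  the outer factors are determined by their sources and ranges.
\<close>

lemma unique_factorization_bisection:
  assumes prin: "principal_groupoid G" and disc: "discrete_orbits G"
    and U: "open U" "u \<in> U" and c: "src h = tgt u" "src u = tgt k"
  obtains V where "open V" "u \<in> V" "V \<subseteq> U"
    "\<And>B h' u' k'. B \<in> local_bisections G \<Longrightarrow> B \<subseteq> V \<Longrightarrow> u \<in> B \<Longrightarrow> u' \<in> B \<Longrightarrow> src h' = tgt u' \<Longrightarrow>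
      src u' = tgt k' \<Longrightarrow> (h' \<star> u') \<star> k' = (h \<star> u) \<star> k \<Longrightarrow> h' = h \<and> u' = u \<and> k' = k"
proof -
  let ?S = "orbit_rel G `` {src u}"
  have "?S \<in> gunits G // orbit_rel G" by (rule quotientI) simp
  moreover have "src u \<in> ?S"
    unfolding orbit_rel_def by (auto intro!: exI[of _ "src u"])
  ultimately obtain T where T: "open T" "T \<inter> ?S = {src u}"
    using disc unfolding discrete_orbits_def discrete_def isolated_in_def by blast
  show thesis
  proof (rule that[of "U \<inter> src -` T"])
    fix B h' u' k'
    assume B: "B \<in> local_bisections G" "B \<subseteq> U \<inter> src -` T" "u \<in> B" "u' \<in> B"
      and c': "src h' = tgt u'" "src u' = tgt k'" "(h' \<star> u') \<star> k' = (h \<star> u) \<star> k"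
    have sk: "src k' = src k" "tgt h' = tgt h"
      using arg_cong[OF c'(3), of src] arg_cong[OF c'(3), of tgt] c c'(1,2) by simp_all
    have "src (k' \<star> opp k) = src u" "tgt (k' \<star> opp k) = src u'" using sk c c' by simp_all
    then have "(src u, src u') \<in> orbit_rel G"
      unfolding orbit_rel_def by (intro CollectI exI[of _ "k' \<star> opp k"]) simp
    then have "src u' \<in> T \<inter> ?S" using B by auto
    then have "src u' = src u" using T(2) by blast
    then have eu: "u' = u" using bisectionD(2)[OF B(1)] B(3,4) by (auto simp: inj_on_def)
    have "src h' = src h" "tgt k' = tgt k" using c c'(1,2) eu by simp_all
    then show "h' = h \<and> u' = u \<and> k' = k"
      using principal_unique[OF prin, of h' h] principal_unique[OF prin, of k' k] sk eu by simp
  next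
    show "open (U \<inter> src -` T)" by (intro open_Int open_src_vimage U T)
    have "src u \<in> T \<inter> ?S" unfolding T(2) by simp
    then show "u \<in> U \<inter> src -` T" using U(2) by simp
  qed simp
qed

text \<open>
  If \<open>a \<in> V\<close> and \<open>b \<in> W\<close> do not vanish at \<open>h\<close> and \<open>k\<close>, then for a section \<open>s\<close> on a sufficiently small
  local bisection around \<open>u\<close> there is no cancellation in \<open>a s b\<close> at \<open>(h \<star> u) \<star> k\<close>.
\<close>

lemma pl_product:
  assumes prin: "principal_groupoid G" and disc: "discrete_orbits G" and U: "open U"
  shows "pl (subspace_product (subspace_product V (ps U)) W) = set_mul G (set_mul G (pl V) U) (pl W)"
proof
  show "set_mul G (set_mul G (pl V) U) (pl W) \<subseteq> pl (subspace_product (subspace_product V (ps U)) W)"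
  proof
    fix g assume "g \<in> set_mul G (set_mul G (pl V) U) (pl W)"
    then obtain h u k where g: "g = (h \<star> u) \<star> k" "h \<in> pl V" "u \<in> U" "k \<in> pl W"
      and c: "src h = tgt u" "src u = tgt k"
      by (auto simp: set_mul_def)
    obtain a b where ab: "a \<in> V" "ev h a \<noteq> 0" "b \<in> W" "ev k b \<noteq> 0"
      using g by (auto simp: mem_pl_iff)
    obtain O' where O': "open O'" "u \<in> O'" "O' \<subseteq> U"
      "\<And>B h' u' k'. B \<in> local_bisections G \<Longrightarrow> B \<subseteq> O' \<Longrightarrow> u \<in> B \<Longrightarrow> u' \<in> B \<Longrightarrow> src h' = tgt u' \<Longrightarrow>
        src u' = tgt k' \<Longrightarrow> (h' \<star> u') \<star> k' = (h \<star> u) \<star> k \<Longrightarrow> h' = h \<and> u' = u \<and> k' = k"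
      by (rule unique_factorization_bisection[OF prin disc U g(3) c]) (rule that)
    obtain B s where B: "B \<in> local_bisections G" "u \<in> B" "B \<subseteq> O'" "s \<in> Cc_on E B" "coord (s u) \<noteq> 0"
      using section_at[OF O'(1,2)] by metis
    have "ev g (a * \<iota> s * b) =
        ev h a * ev k b * coord (fmul E (fmul E (unit_vector h) (s u)) (unit_vector k))"
      unfolding g(1) by (rule ev_sandwich[OF B(1,4) c B(2)]) (rule O'(4)[OF B(1,3,2)])
    moreover have "coord (fmul E (fmul E (unit_vector h) (s u)) (unit_vector k)) \<noteq> 0"
      using c B(5) Cc_onD(1)[OF B(4)] by (intro coord_fmul_nonzero) simp_all
    ultimately have "ev g (a * \<iota> s * b) \<noteq> 0" using ab by simp
    moreover have "\<iota> s \<in> ps U" using B O'(3) by (intro embed_in_ps[OF B(1) _ B(4)]) blast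
    then have "a * \<iota> s * b \<in> subspace_product (subspace_product V (ps U)) W"
      using ab by (intro mult_in_subspace_product)
    ultimately show "g \<in> pl (subspace_product (subspace_product V (ps U)) W)"
      unfolding mem_pl_iff by blast
  qed
qed (rule pl_product_subset[OF U])

end

theorem theorem5p8:
  fixes G :: "('g::t2_space) groupoid"
    and E :: "('g, 'e::topological_space) fell_bundle"
    and N :: "('g \<Rightarrow> 'e) \<Rightarrow> real"
    and A :: "('a::{real_normed_algebra, banach}) cstar_algebra"
    and \<iota> :: "('g \<Rightarrow> 'e) \<Rightarrow> 'a"
  assumes "etale_groupoid G"
    and "principal_groupoid G"
    and "discrete_orbits G"
    and "fell_line_bundle G E"
    and "localizable_completion G E N A \<iota>"
  shows "stable_quantic_bundle G (max_quantale A) (assoc_map G E A \<iota>)"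
proof -
  interpret line_completion G E N A \<iota>
    by (intro line_completion.intro hausdorff_fell_line_bundle.intro hausdorff_etale_groupoid.intro assms)
  have stable: "\<forall>U \<in> carrier (open_quantale G). \<forall>a \<in> carrier (max_quantale A). \<forall>b \<in> carrier (max_quantale A).
          pl (qmul (max_quantale A) (qmul (max_quantale A) a (assoc_map G E A \<iota> U)) b) =
          qmul (open_quantale G) (qmul (open_quantale G) (pl a) U) (pl b)"
    using pl_product assms(2,3) by simp
  have "quantic_bundle G (max_quantale A) (assoc_map G E A \<iota>)"
    unfolding quantic_bundle_def using ps_quantale_map ps_inj direct_image_pl stable by auto
  then show ?thesis
    unfolding stable_quantic_bundle_def using direct_image_pl stable by blast
qed

end
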